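(* Let $d\in\{2,3\}$, let $\Omega\subset\mathbb R^d$ be an open bounded connected polygonal ($d=2$) or polyhedral ($d=3$) set, $T>0$, $\rho_0\in L^\infty(\Omega)$ and $\boldsymbol u_0=(u_{0,1},\dots,u_{0,d})\in L^\infty(\Omega)^d$. Let $(\mathcal M^{(m)},\mathcal T^{(m)})_{m\in\mathbb N}$ be a sequence of space-time discretisations of $\Omega\times(0,T)$ (admissible meshes with their dual cells, and uniform time discretisations with step $\delta t^{(m)}=T/N^{(m)}$, as described in the context) such that $h_{\mathcal M^{(m)}}=\max_{K\in\mathcal M^{(m)}}\mathrm{diam}(K)\to 0$ and $\delta t^{(m)}\to 0$ as $m\to+\infty$. Let $(\rho^{(m)},\boldsymbol u^{(m)})_{m\in\mathbb N}$ be an associated sequence of discrete functions (as described in the context), with associated face densities, primal mass fluxes, dual densities, dual-face velocities, and dual mass fluxes satisfying (H1), (H2), (H3) of the context, the constant $C$ in (H3) being independent of $m$. Suppose that: (a) there exists $\theta\in\mathbb R$ such that $\max\{\theta_1(\mathcal M^{(m)}),\theta_2(\mathcal M^{(m)})\}\le\theta$ for all $m\in\mathbb N$, where $\theta_1(\mathcal M)=\max_{K\in\mathcal M}\frac{\mathrm{diam}(K)^d}{|K|}$ and $\theta_2(\mathcal M)=\max\{\frac{|K|}{|L|}: K,L \text{ adjacent cells of }\mathcal M\}$; (b) there exists $N_{\mathcal E}\in\mathbb R$ such that $\mathrm{card}(\mathcal E(K))\le N_{\mathcal E}$ for all $K\in\mathcal M^{(m)}$ and all $m\in\mathbb N$;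 (c) there exist $C_1,C_2\in\mathbb R_+$ independent of $m$ such that $\|\rho^{(m)}\|_{L^\infty(\Omega\times(0,T))}\le C_1$ and $\|\boldsymbol u^{(m)}\|_{L^\infty(\Omega\times(0,T))^d}\le C_2$ for all $m\in\mathbb N$; (d) there exist $\bar\rho\in L^\infty(\Omega\times(0,T))$ and $\bar{\boldsymbol u}=(\bar u_1,\dots,\bar u_d)\in L^\infty(\Omega\times(0,T))^d$ such that $\|\rho^{(m)}-\bar\rho\|_{L^\infty(\Omega\times(0,T))}\to0$ and $\|\boldsymbol u^{(m)}-\bar{\boldsymbol u}\|_{L^\infty(\Omega\times(0,T))^d}\to0$ as $m\to+\infty$. For $i\in\{1,\dots,d\}$ let $\mathcal C_i^{(m)}(\rho^{(m)},\boldsymbol u^{(m)})$ be the discrete convection operator (defined in the context) on $\mathcal M^{(m)}$, and let $\mathcal I_{\mathcal M^{(m)}}(\varphi)$ be the interpolate of $\varphi$ (defined in the context). Then, for every $i\in\{1,\dots,d\}$ and every $\varphi\in C_c^\infty(\Omega\times(0,T))$, $$\lim_{m\to+\infty}\int_0^T\!\!\int_\Omega \mathcal C_i^{(m)}(\rho^{(m)},\boldsymbol u^{(m)})\,\mathcal I_{\mathcal M^{(m)}}(\varphi)\,d\boldsymbol x\,dt = -\int_\Omega\rho_0(\boldsymbol x)\,u_{0,i}(\boldsymbol x)\,\varphi(\boldsymbol x,0)\,d\boldsymbol x-\int_0^T\!\!\int_\Omega\bigl(\bar\rho\,\bar u_i\,\partial_t\varphi+\bar\rho\,\bar u_i\,\bar{\boldsymbol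 u}\cdot\nabla\varphi\bigr)\,d\boldsymbol x\,dt .$$
   Context: **Primal mesh.** A mesh $\mathcal M$ of $\Omega$ is a finite family of disjoint open cells whose closures cover $\overline\Omega$: triangles and quadrangles if $d=2$; tetrahedra, hexahedra, triangular prisms and quadrangle-based pyramids if $d=3$. $\mathcal E$ is the set of faces (edges if $d=2$), $\mathcal E(K)$ the set of faces of the cell $K$. The mesh is conforming: each $\sigma\in\mathcal E$ is either external ($\sigma\subset\partial\Omega$, $\sigma\in\mathcal E_{\rm ext}$) or internal ($\sigma\in\mathcal E_{\rm int}$), i.e. $\sigma=\overline K\cap\overline L$ for two distinct cells $K,L$, written $\sigma=K|L$; $K$ and $L$ are then called adjacent. $|K|$ is the Lebesgue measure of $K$, $|\sigma|$ the $(d-1)$-dimensional measure of $\sigma$, and $\boldsymbol n_{K,\sigma}$ the unit normal to $\sigma$ outward $K$. **Dual mesh.** Each cell $K$ is split (up to a null set) into disjoint measurable subsets $D_{K,\sigma}$, $\sigma\in\mathcal E(K)$ ("half-diamond cells"), all of equal measure $|D_{K,\sigma}|=|K|/\mathrm{card}(\mathcal E(K))$; their precise geometry is otherwise not specified. Set $\xi_K=1/\mathrm{card}(\mathcal E(K))$. The connectivity of the half-diamond cells inside $K$ is by convention that of a regular cell of the same type, split into the cones with bases its faces and vertex its mass center: there is a dual face $\epsilon=D_\sigma|D_{\sigma'}$ (also written $\sigma|\sigma'$), said to be included in $K$ ($\epsilon\subset K$), exactly when $\sigma\neq\sigma'$ in $\mathcal E(K)$ share an edge (if $d=3$) or a vertex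 (if $d=2$). The dual cell of $\sigma$ is $D_\sigma=D_{K,\sigma}\cup D_{L,\sigma}$ if $\sigma=K|L\in\mathcal E_{\rm int}$, and $D_\sigma=D_{K,\sigma}$ if $\sigma\in\mathcal E_{\rm ext}\cap\mathcal E(K)$. $\widetilde{\mathcal E}(D_\sigma)$ is the set of dual faces of $D_\sigma$. (Dual faces are formal objects; only the data attached to them below matter. For external $\sigma$, $\sigma$ itself may be counted as a face of $D_\sigma$, with a flux and a velocity value prescribed by the boundary conditions.) **Time discretisation.** $\delta t=T/N$ with $N\in\mathbb N^*$, $t_n=n\,\delta t$ for $0\le n\le N$. **Discrete unknowns and functions.** The discrete unknowns are real numbers $\rho_K^n$ ($K\in\mathcal M$, $0\le n\le N$) and vectors $\boldsymbol u_\sigma^n=(u_{1,\sigma}^n,\dots,u_{d,\sigma}^n)\in\mathbb R^d$ ($\sigma\in\mathcal E$, $0\le n\le N$), with initialization $\rho_K^0=\frac1{|K|}\int_K\rho_0\,d\boldsymbol x$ and $\boldsymbol u_\sigma^0=\frac1{|D_\sigma|}\int_{D_\sigma}\boldsymbol u_0\,d\boldsymbol x$. The associated discrete functions are $$\rho(\boldsymbol x,t)=\rho_K^{n+1}\ \text{ for }\boldsymbol x\in K,\ t\in(t_n,t_{n+1}],\qquad \boldsymbol u(\boldsymbol x,t)=\boldsymbol u_\sigma^{n+1}\ \text{ for }\boldsymbol x\in D_\sigma,\ t\in(t_n,t_{n+1}],\qquad 0\le n\le N-1.$$ **Primal mass fluxes.** For $\sigma=K|L\in\mathcal E_{\rm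 int}$, $F_{K,\sigma}^n=|\sigma|\,\rho_\sigma^n\,\boldsymbol u_\sigma^n\cdot\boldsymbol n_{K,\sigma}$, where the face density $\rho_\sigma^n$ (the same seen from $K$ and from $L$) is a convex combination of $\rho_K^n$ and $\rho_L^n$ (e.g. the upwind value). On external faces $F_{K,\sigma}^n$ is prescribed by the boundary conditions. **Dual densities.** For $\sigma=K|L\in\mathcal E_{\rm int}$, $|D_\sigma|\,\rho_{D_\sigma}^n=|D_{K,\sigma}|\,\rho_K^n+|D_{L,\sigma}|\,\rho_L^n$; for $\sigma\in\mathcal E_{\rm ext}\cap\mathcal E(K)$, $\rho_{D_\sigma}^n=\rho_K^n$. **Dual mass fluxes.** The real numbers $F_{\sigma,\epsilon}^n$ (mass flux leaving $D_\sigma$ through the dual face $\epsilon$) satisfy, at each time level $n$: - (H1) for all $K\in\mathcal M$ and $\sigma\in\mathcal E(K)$: $\displaystyle F_{K,\sigma}^n+\sum_{\epsilon\in\widetilde{\mathcal E}(D_\sigma),\ \epsilon\subset K}F_{\sigma,\epsilon}^n=\xi_K\sum_{\sigma'\in\mathcal E(K)}F_{K,\sigma'}^n$; - (H2) for every dual face $\epsilon=D_\sigma|D_{\sigma'}$: $F_{\sigma,\epsilon}^n=-F_{\sigma',\epsilon}^n$; - (H3) there is a universal constant $C$ such that $|F_{\sigma,\epsilon}^n|\le C\max\{|F_{K,\sigma'}^n|:\sigma'\in\mathcal E(K)\}$ for all $K\in\mathcal M$, $\sigma\in\mathcal E(K)$, $\epsilon\in\widetilde{\mathcal E}(D_\sigma)$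 with $\epsilon\subset K$. **Discrete convection operator.** For $1\le i\le d$ and $\epsilon=D_\sigma|D_{\sigma'}$, the value $u_{i,\epsilon}^n$ (the same seen from $D_\sigma$ and from $D_{\sigma'}$) is a convex combination of $u_{i,\sigma}^n$ and $u_{i,\sigma'}^n$ (e.g. the upwind value: $u_{i,\sigma}^n$ if $F_{\sigma,\epsilon}^n\ge0$, $u_{i,\sigma'}^n$ otherwise). The operator $\mathcal C_i(\rho,\boldsymbol u):\Omega\times(0,T)\to\mathbb R$ is the piecewise constant function equal, for $\boldsymbol x\in D_\sigma$, $t\in(t_n,t_{n+1})$, to $$\frac1{\delta t}\bigl(\rho_{D_\sigma}^{n+1}u_{i,\sigma}^{n+1}-\rho_{D_\sigma}^{n}u_{i,\sigma}^{n}\bigr)+\frac1{|D_\sigma|}\sum_{\epsilon\in\widetilde{\mathcal E}(D_\sigma)}F_{\sigma,\epsilon}^n\,u_{i,\epsilon}^n,\qquad \sigma\in\mathcal E,\ 0\le n\le N-1.$$ **Interpolate of a test function.** $\mathcal I_{\mathcal M}(\varphi)(\boldsymbol x,t)=\varphi_\sigma^n:=\frac1{|D_\sigma|}\int_{D_\sigma}\varphi(\boldsymbol y,t_n)\,d\boldsymbol y$ for $\boldsymbol x\in D_\sigma$, $t\in(t_n,t_{n+1})$, $0\le n\le N-1$. A superscript $(m)$ denotes quantities attached to the $m$-th discretisation. *)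

theory Defs
  imports "HOL-Analysis.Analysis" "HOL-Probability.Essential_Supremum"
begin

section \<open>Polygonal and polyhedral sets, cells and their faces\<close>

text \<open>Boundary made of finitely many segments (\<open>d = 2\<close>) or convex polygons (\<open>d = 3\<close>).\<close>

definition polyhedral_boundary :: "(real^'d) set \<Rightarrow> bool" where
  "polyhedral_boundary \<Omega> \<longleftrightarrow>
     (\<exists>\<P>. finite \<P> \<and> (\<forall>P\<in>\<P>. polytope P \<and> aff_dim P = int CARD('d) - 1) \<and> frontier \<Omega> = \<Union>\<P>)"

text \<open>A plane quadrangle \<open>abcd\<close>, convex or not, is the union of the two triangles cut off by one of
  its two diagonals. \<open>split_quadrangle\<close> is the case of the diagonal \<open>ac\<close>: the triangles lie on
  opposite sides of it, that is, they have nothing but this diagonal in common.\<close>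

definition split_quadrangle :: "'a::euclidean_space \<Rightarrow> 'a \<Rightarrow> 'a \<Rightarrow> 'a \<Rightarrow> 'a set \<Rightarrow> bool" where
  "split_quadrangle a b c d Q \<longleftrightarrow>
     convex hull {a, b, c} \<inter> convex hull {a, c, d} = closed_segment a c \<and>
     Q = convex hull {a, b, c} \<union> convex hull {a, c, d}"

definition quadrangle :: "'a::euclidean_space \<Rightarrow> 'a \<Rightarrow> 'a \<Rightarrow> 'a \<Rightarrow> 'a set \<Rightarrow> bool" where
  "quadrangle a b c d Q \<longleftrightarrow>
     aff_dim {a, b, c, d} = 2 \<and>
     \<not> collinear {a, b, c} \<and> \<not> collinear {b, c, d} \<and> \<not> collinear {c, d, a} \<and> \<not> collinear {d, a, b} \<and>
     (split_quadrangle a b c d Q \<or> split_quadrangle b c d a Q)"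

text \<open>\<open>flat_face vs S\<close>: \<open>S\<close> is the closed segment, triangle or plane quadrangle with vertices \<open>vs\<close>,
  listed in cyclic order.\<close>

fun flat_face :: "'a::euclidean_space list \<Rightarrow> 'a set \<Rightarrow> bool" where
  "flat_face [a, b] S \<longleftrightarrow> a \<noteq> b \<and> S = closed_segment a b"
| "flat_face [a, b, c] S \<longleftrightarrow> \<not> collinear {a, b, c} \<and> S = convex hull {a, b, c}"
| "flat_face [a, b, c, d] S \<longleftrightarrow> quadrangle a b c d S"
| "flat_face _ S \<longleftrightarrow> False"

text \<open>Combinatorial types of cells: each face is given by the cyclic list of its vertices.\<close>

definition "triangle_type = [[0, 1], [1, 2], [2, 0 :: nat]]"
definition "quadrangle_type = [[0, 1], [1, 2], [2, 3], [3, 0 :: nat]]"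
definition "tetrahedron_type = [[0, 1, 2], [0, 1, 3], [0, 2, 3], [1, 2, 3 :: nat]]"
definition "hexahedron_type =
  [[0, 1, 2, 3], [4, 5, 6, 7], [0, 1, 5, 4], [1, 2, 6, 5], [2, 3, 7, 6], [3, 0, 4, 7 :: nat]]"
definition "prism_type = [[0, 1, 2], [3, 4, 5], [0, 1, 4, 3], [1, 2, 5, 4], [2, 0, 3, 5 :: nat]]"
definition "pyramid_type = [[0, 1, 2, 3], [0, 1, 4], [1, 2, 4], [2, 3, 4], [3, 0, 4 :: nat]]"

definition cell_types :: "nat \<Rightarrow> nat list list set" where
  "cell_types d =
     (if d = 2 then {triangle_type, quadrangle_type}
      else if d = 3 then {tetrahedron_type, hexahedron_type, prism_type, pyramid_type}
      else {})"

text \<open>Two distinct faces of a cell meet along a common vertex or edge, or not at all; they share a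
  vertex (\<open>d = 2\<close>) or an edge (\<open>d = 3\<close>) iff their intersection has dimension \<open>d - 2\<close>.\<close>

definition share_ridge :: "(real^'d) set \<Rightarrow> (real^'d) set \<Rightarrow> bool" where
  "share_ridge \<sigma> \<tau> \<longleftrightarrow> aff_dim (\<sigma> \<inter> \<tau>) = int CARD('d) - 2"

text \<open>\<open>is_cell K F\<close>: the open set \<open>K\<close> is a cell, not necessarily convex, of one of the admissible
  types, and \<open>F\<close> is the set of its (closed, flat) faces. The boundary of \<open>K\<close> is an embedded copy of the
  boundary complex of the type; faces with a common ridge do not lie in the same hyperplane.\<close>

definition is_cell :: "(real^'d) set \<Rightarrow> (real^'d) set set \<Rightarrow> bool" where
  "is_cell K F \<longleftrightarrow> open K \<and> bounded K \<and> connected K \<and> frontier K = \<Union>F \<and>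
     (\<exists>fs\<in>cell_types CARD('d). \<exists>v S.
        inj_on v (\<Union>f\<in>set fs. set f) \<and>
        (\<forall>f\<in>set fs. flat_face (map v f) (S f)) \<and>
        (\<forall>f\<in>set fs. \<forall>g\<in>set fs. f \<noteq> g \<longrightarrow>
            S f \<inter> S g = convex hull (v ` (set f \<inter> set g)) \<and>
            (share_ridge (S f) (S g) \<longrightarrow> aff_dim (S f \<union> S g) = int CARD('d))) \<and>
        F = S ` set fs)"

definition outward_unit_normal :: "(real^'d) set \<Rightarrow> (real^'d) set \<Rightarrow> real^'d \<Rightarrow> bool" where
  "outward_unit_normal K \<sigma> n \<longleftrightarrow> norm n = 1 \<and> (\<forall>x\<in>\<sigma>. \<forall>y\<in>\<sigma>. n \<bullet> (x - y) = 0) \<and>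
     (\<forall>x\<in>rel_interior \<sigma>. \<forall>\<^sub>F s in at_right 0. x - s *\<^sub>R n \<in> K \<and> x + s *\<^sub>R n \<notin> closure K)"

text \<open>\<open>(d-1)\<close>-dimensional Lebesgue measure of a subset \<open>\<sigma>\<close> of a hyperplane with unit normal \<open>n\<close>:
  the volume of the right prism of height 1 over \<open>\<sigma>\<close>.\<close>

definition face_measure :: "real^'d \<Rightarrow> (real^'d) set \<Rightarrow> real" where
  "face_measure n \<sigma> = measure lebesgue {x + s *\<^sub>R n | x s. x \<in> \<sigma> \<and> 0 \<le> s \<and> s \<le> 1}"


section \<open>Primal and dual meshes\<close>

record ('d::finite) mesh =
  cells :: "(real^'d) set set"
  faces :: "(real^'d) set \<Rightarrow> (real^'d) set set"
  normal :: "(real^'d) set \<Rightarrow> (real^'d) set \<Rightarrow> real^'d"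
  half_diamond :: "(real^'d) set \<Rightarrow> (real^'d) set \<Rightarrow> (real^'d) set"

definition all_faces :: "('d::finite) mesh \<Rightarrow> (real^'d) set set" where
  "all_faces M = (\<Union>K\<in>cells M. faces M K)"

text \<open>\<open>interface M K L \<sigma>\<close> is \<open>\<sigma> = K|L\<close>.\<close>

definition interface :: "('d::finite) mesh \<Rightarrow> (real^'d) set \<Rightarrow> (real^'d) set \<Rightarrow> (real^'d) set \<Rightarrow> bool" where
  "interface M K L \<sigma> \<longleftrightarrow> K \<in> cells M \<and> L \<in> cells M \<and> K \<noteq> L \<and>
     \<sigma> \<in> faces M K \<and> \<sigma> \<in> faces M L \<and> \<sigma> = closure K \<inter> closure L"

definition internal_faces :: "('d::finite) mesh \<Rightarrow> (real^'d) set set" where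
  "internal_faces M = {\<sigma>. \<exists>K L. interface M K L \<sigma>}"

definition external_faces :: "(real^'d) set \<Rightarrow> ('d::finite) mesh \<Rightarrow> (real^'d) set set" where
  "external_faces \<Omega> M = {\<sigma> \<in> all_faces M. \<sigma> \<subseteq> frontier \<Omega>}"

definition primal_mesh :: "(real^'d) set \<Rightarrow> ('d::finite) mesh \<Rightarrow> bool" where
  "primal_mesh \<Omega> M \<longleftrightarrow>
     finite (cells M) \<and> pairwise disjnt (cells M) \<and>
     (\<forall>K\<in>cells M. K \<subseteq> \<Omega> \<and> is_cell K (faces M K)) \<and>
     closure \<Omega> \<subseteq> (\<Union>K\<in>cells M. closure K) \<and>
     (\<forall>\<sigma>\<in>all_faces M. (\<sigma> \<in> external_faces \<Omega> M) \<noteq> (\<sigma> \<in> internal_faces M)) \<and>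
     (\<forall>K\<in>cells M. \<forall>\<sigma>\<in>faces M K. outward_unit_normal K \<sigma> (normal M K \<sigma>))"

definition dual_mesh :: "('d::finite) mesh \<Rightarrow> bool" where
  "dual_mesh M \<longleftrightarrow> (\<forall>K\<in>cells M.
     (\<forall>\<sigma>\<in>faces M K. half_diamond M K \<sigma> \<in> sets lebesgue \<and> half_diamond M K \<sigma> \<subseteq> K \<and>
        measure lebesgue (half_diamond M K \<sigma>) = measure lebesgue K / real (card (faces M K))) \<and>
     disjoint_family_on (half_diamond M K) (faces M K) \<and>
     negligible (K - (\<Union>\<sigma>\<in>faces M K. half_diamond M K \<sigma>)))"

definition admissible_mesh :: "(real^'d) set \<Rightarrow> ('d::finite) mesh \<Rightarrow> bool" where
  "admissible_mesh \<Omega> M \<longleftrightarrow> primal_mesh \<Omega> M \<and> dual_mesh M"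

text \<open>This is \<open>D\<^sub>K\<^sub>\<sigma> \<union> D\<^sub>L\<^sub>\<sigma>\<close> for \<open>\<sigma> = K|L\<close>, and \<open>D\<^sub>K\<^sub>\<sigma>\<close> for an external face \<open>\<sigma>\<close> of \<open>K\<close>.\<close>

definition dual_cell :: "('d::finite) mesh \<Rightarrow> (real^'d) set \<Rightarrow> (real^'d) set" where
  "dual_cell M \<sigma> = (\<Union>K\<in>{K \<in> cells M. \<sigma> \<in> faces M K}. half_diamond M K \<sigma>)"

text \<open>The dual face \<open>\<sigma>|\<sigma>'\<close> included in the cell \<open>K\<close> is represented by the formal pair
  \<open>(K, {\<sigma>, \<sigma>'})\<close>.\<close>

type_synonym 'd dual_face = "(real^'d) set \<times> (real^'d) set set"

definition dual_faces :: "('d::finite) mesh \<Rightarrow> (real^'d) set \<Rightarrow> 'd dual_face set" where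
  "dual_faces M \<sigma> = {(K, {\<sigma>, \<sigma>'}) | K \<sigma>'.
     K \<in> cells M \<and> \<sigma> \<in> faces M K \<and> \<sigma>' \<in> faces M K \<and> \<sigma> \<noteq> \<sigma>' \<and> share_ridge \<sigma> \<sigma>'}"

definition mesh_size :: "('d::finite) mesh \<Rightarrow> real" where
  "mesh_size M = Max (diameter ` cells M)"

definition theta1 :: "('d::finite) mesh \<Rightarrow> real" where
  "theta1 M = Max ((\<lambda>K. diameter K ^ CARD('d) / measure lebesgue K) ` cells M)"

text \<open>The quotients are positive; 0 is inserted for meshes without adjacent cells.\<close>

definition theta2 :: "('d::finite) mesh \<Rightarrow> real" where
  "theta2 M = Max (insert 0
     {measure lebesgue K / measure lebesgue L | K L. \<exists>\<sigma>. interface M K L \<sigma>})"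


section \<open>Discrete unknowns, fluxes and functions\<close>

text \<open>The first argument of each field but the first is the time level. \<open>bd_flux\<close> and \<open>bd_velocity\<close>
  are the flux and velocity on an external face seen as a face of its dual cell; they are arbitrary
  (in particular, the flux may vanish if such a face is not to be counted).\<close>

record ('d::finite) scheme =
  steps :: nat
  density :: "nat \<Rightarrow> (real^'d) set \<Rightarrow> real"
  velocity :: "nat \<Rightarrow> (real^'d) set \<Rightarrow> real^'d"
  face_density :: "nat \<Rightarrow> (real^'d) set \<Rightarrow> real"
  flux :: "nat \<Rightarrow> (real^'d) set \<Rightarrow> (real^'d) set \<Rightarrow> real"
  dual_flux :: "nat \<Rightarrow> (real^'d) set \<Rightarrow> 'd dual_face \<Rightarrow> real"
  dual_velocity :: "nat \<Rightarrow> 'd dual_face \<Rightarrow> real^'d"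
  bd_flux :: "nat \<Rightarrow> (real^'d) set \<Rightarrow> real"
  bd_velocity :: "nat \<Rightarrow> (real^'d) set \<Rightarrow> real^'d"

definition time_step :: "real \<Rightarrow> ('d::finite) scheme \<Rightarrow> real" where
  "time_step T S = T / real (steps S)"

definition time_level :: "real \<Rightarrow> ('d::finite) scheme \<Rightarrow> nat \<Rightarrow> real" where
  "time_level T S n = real n * time_step T S"

definition initialization ::
  "((real^'d) \<Rightarrow> real) \<Rightarrow> ((real^'d) \<Rightarrow> real^'d) \<Rightarrow> ('d::finite) mesh \<Rightarrow> 'd scheme \<Rightarrow> bool" where
  "initialization \<rho>0 u0 M S \<longleftrightarrow>
     (\<forall>K\<in>cells M. density S 0 K = (1 / measure lebesgue K) * (LINT x:K|lebesgue. \<rho>0 x)) \<and>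
     (\<forall>\<sigma>\<in>all_faces M. velocity S 0 \<sigma> =
        (1 / measure lebesgue (dual_cell M \<sigma>)) *\<^sub>R (LINT x:dual_cell M \<sigma>|lebesgue. u0 x))"

text \<open>The values of \<open>flux\<close> on external faces are not constrained.\<close>

definition primal_fluxes :: "('d::finite) mesh \<Rightarrow> 'd scheme \<Rightarrow> bool" where
  "primal_fluxes M S \<longleftrightarrow> (\<forall>n\<le>steps S. \<forall>K L \<sigma>. interface M K L \<sigma> \<longrightarrow>
     face_density S n \<sigma> \<in> closed_segment (density S n K) (density S n L) \<and>
     flux S n K \<sigma> = face_measure (normal M K \<sigma>) \<sigma> * face_density S n \<sigma> *
       (velocity S n \<sigma> \<bullet> normal M K \<sigma>))"

definition H1 :: "('d::finite) mesh \<Rightarrow> 'd scheme \<Rightarrow> bool" where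
  "H1 M S \<longleftrightarrow> (\<forall>n\<le>steps S. \<forall>K\<in>cells M. \<forall>\<sigma>\<in>faces M K.
     flux S n K \<sigma> + (\<Sum>\<epsilon>\<in>{\<epsilon>\<in>dual_faces M \<sigma>. fst \<epsilon> = K}. dual_flux S n \<sigma> \<epsilon>)
       = (1 / real (card (faces M K))) * (\<Sum>\<sigma>'\<in>faces M K. flux S n K \<sigma>'))"

definition H2 :: "('d::finite) mesh \<Rightarrow> 'd scheme \<Rightarrow> bool" where
  "H2 M S \<longleftrightarrow> (\<forall>n\<le>steps S. \<forall>K \<sigma> \<sigma>'. (K, {\<sigma>, \<sigma>'}) \<in> dual_faces M \<sigma> \<longrightarrow>
     dual_flux S n \<sigma> (K, {\<sigma>, \<sigma>'}) = - dual_flux S n \<sigma>' (K, {\<sigma>, \<sigma>'}))"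

definition H3 :: "real \<Rightarrow> ('d::finite) mesh \<Rightarrow> 'd scheme \<Rightarrow> bool" where
  "H3 C M S \<longleftrightarrow> (\<forall>n\<le>steps S. \<forall>K\<in>cells M. \<forall>\<sigma>\<in>faces M K. \<forall>\<epsilon>\<in>{\<epsilon>\<in>dual_faces M \<sigma>. fst \<epsilon> = K}.
     \<bar>dual_flux S n \<sigma> \<epsilon>\<bar> \<le> C * Max ((\<lambda>\<sigma>'. \<bar>flux S n K \<sigma>'\<bar>) ` faces M K))"

definition dual_velocities :: "('d::finite) mesh \<Rightarrow> 'd scheme \<Rightarrow> bool" where
  "dual_velocities M S \<longleftrightarrow> (\<forall>n\<le>steps S. \<forall>K \<sigma> \<sigma>'. (K, {\<sigma>, \<sigma>'}) \<in> dual_faces M \<sigma> \<longrightarrow>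
     (\<forall>i. dual_velocity S n (K, {\<sigma>, \<sigma>'}) $ i
            \<in> closed_segment (velocity S n \<sigma> $ i) (velocity S n \<sigma>' $ i)))"

text \<open>For an external face of \<open>K\<close> this is the density in \<open>K\<close>, the sum having a single term.\<close>

definition dual_density :: "('d::finite) mesh \<Rightarrow> 'd scheme \<Rightarrow> nat \<Rightarrow> (real^'d) set \<Rightarrow> real" where
  "dual_density M S n \<sigma> =
     (\<Sum>K\<in>{K \<in> cells M. \<sigma> \<in> faces M K}. measure lebesgue (half_diamond M K \<sigma>) * density S n K)
       / measure lebesgue (dual_cell M \<sigma>)"

definition density_fun :: "real \<Rightarrow> ('d::finite) mesh \<Rightarrow> 'd scheme \<Rightarrow> (real^'d) \<times> real \<Rightarrow> real" where
  "density_fun T M S z = (\<Sum>n<steps S. \<Sum>K\<in>cells M.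
     indicat_real (K \<times> {time_level T S n<..time_level T S (Suc n)}) z * density S (Suc n) K)"

definition velocity_fun :: "real \<Rightarrow> ('d::finite) mesh \<Rightarrow> 'd scheme \<Rightarrow> (real^'d) \<times> real \<Rightarrow> real^'d" where
  "velocity_fun T M S z = (\<Sum>n<steps S. \<Sum>\<sigma>\<in>all_faces M.
     indicat_real (dual_cell M \<sigma> \<times> {time_level T S n<..time_level T S (Suc n)}) z
       *\<^sub>R velocity S (Suc n) \<sigma>)"

definition convection_value ::
  "(real^'d) set \<Rightarrow> real \<Rightarrow> ('d::finite) mesh \<Rightarrow> 'd scheme \<Rightarrow> 'd \<Rightarrow> nat \<Rightarrow> (real^'d) set \<Rightarrow> real" where
  "convection_value \<Omega> T M S i n \<sigma> =
     (1 / time_step T S) * (dual_density M S (Suc n) \<sigma> * velocity S (Suc n) \<sigma> $ i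
        - dual_density M S n \<sigma> * velocity S n \<sigma> $ i)
     + (1 / measure lebesgue (dual_cell M \<sigma>)) *
        ((\<Sum>\<epsilon>\<in>dual_faces M \<sigma>. dual_flux S n \<sigma> \<epsilon> * dual_velocity S n \<epsilon> $ i)
         + (if \<sigma> \<in> external_faces \<Omega> M then bd_flux S n \<sigma> * bd_velocity S n \<sigma> $ i else 0))"

definition convection ::
  "(real^'d) set \<Rightarrow> real \<Rightarrow> ('d::finite) mesh \<Rightarrow> 'd scheme \<Rightarrow> 'd \<Rightarrow> (real^'d) \<times> real \<Rightarrow> real" where
  "convection \<Omega> T M S i z = (\<Sum>n<steps S. \<Sum>\<sigma>\<in>all_faces M.
     indicat_real (dual_cell M \<sigma> \<times> {time_level T S n<..<time_level T S (Suc n)}) z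
       * convection_value \<Omega> T M S i n \<sigma>)"

definition interpolate ::
  "real \<Rightarrow> ('d::finite) mesh \<Rightarrow> 'd scheme \<Rightarrow> ((real^'d) \<times> real \<Rightarrow> real) \<Rightarrow> (real^'d) \<times> real \<Rightarrow> real" where
  "interpolate T M S \<phi> z = (\<Sum>n<steps S. \<Sum>\<sigma>\<in>all_faces M.
     indicat_real (dual_cell M \<sigma> \<times> {time_level T S n<..<time_level T S (Suc n)}) z
       * ((1 / measure lebesgue (dual_cell M \<sigma>))
            * (LINT y:dual_cell M \<sigma>|lebesgue. \<phi> (y, time_level T S n))))"

definition discrete_solution ::
  "((real^'d) \<Rightarrow> real) \<Rightarrow> ((real^'d) \<Rightarrow> real^'d) \<Rightarrow> ('d::finite) mesh \<Rightarrow> 'd scheme \<Rightarrow> bool" where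
  "discrete_solution \<rho>0 u0 M S \<longleftrightarrow> steps S \<ge> 1 \<and> initialization \<rho>0 u0 M S \<and>
     primal_fluxes M S \<and> dual_velocities M S \<and> H1 M S \<and> H2 M S"


section \<open>Function spaces\<close>

definition Linf_norm :: "'a::euclidean_space set \<Rightarrow> ('a \<Rightarrow> 'b::real_normed_vector) \<Rightarrow> ereal" where
  "Linf_norm A f = esssup (lebesgue_on A) (\<lambda>x. ereal (norm (f x)))"

definition Linf :: "'a::euclidean_space set \<Rightarrow> ('a \<Rightarrow> 'b::euclidean_space) set" where
  "Linf A = {f \<in> borel_measurable (lebesgue_on A). Linf_norm A f < \<infinity>}"

fun Ck :: "nat \<Rightarrow> ('a::euclidean_space \<Rightarrow> real) \<Rightarrow> bool" where
  "Ck 0 f \<longleftrightarrow> continuous_on UNIV f"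
| "Ck (Suc k) f \<longleftrightarrow> (\<forall>x. f differentiable at x) \<and>
     (\<forall>b\<in>Basis. Ck k (\<lambda>x. frechet_derivative f (at x) b))"

text \<open>Test functions, extended by 0 to the whole space.\<close>

definition test_functions :: "'a::euclidean_space set \<Rightarrow> ('a \<Rightarrow> real) set" where
  "test_functions A = {f. (\<forall>k. Ck k f) \<and> compact (closure {x. f x \<noteq> 0}) \<and> closure {x. f x \<noteq> 0} \<subseteq> A}"

definition time_derivative :: "((real^'d) \<times> real \<Rightarrow> real) \<Rightarrow> (real^'d) \<times> real \<Rightarrow> real" where
  "time_derivative \<phi> z = frechet_derivative \<phi> (at z) (0, 1)"

definition space_gradient :: "((real^'d) \<times> real \<Rightarrow> real) \<Rightarrow> (real^'d) \<times> real \<Rightarrow> real^'d" where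
  "space_gradient \<phi> z = (\<chi> j. frechet_derivative \<phi> (at z) (axis j 1, 0))"

end

theory Submission
  imports Defs
begin

text \<open>The test function vanishes near the boundary of the space-time cylinder, so that neither the
  initial term nor the boundary cells contribute. The limits \<open>\<rho>\<close> and \<open>u\<close> may be discontinuous: they are
  approximated in \<open>L\<^sup>1\<close> by bounded continuous functions \<open>r\<close> and \<open>U\<close>, and the discrete unknowns of a cell
  \<open>K\<close> are compared with the values of \<open>r\<close> and \<open>U\<close> at one point of \<open>K\<close>. The sum over \<open>K\<close> of these errors,
  weighted by the volume, is small by the convergence assumption, and everything else in a cell is
  estimated by a constant times its volume. After summation by parts, the convection term becomes a
  Riemann sum of \<open>r U\<^sub>i \<partial>\<^sub>t\<phi> + r U\<^sub>i U \<bullet> \<nabla>\<phi>\<close>. In space this rests on a divergence theorem on each cell, obtained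
  by comparing the cell with a translate of itself.\<close>

section \<open>Prisms over flat faces\<close>

text \<open>The scaling behind all cell estimates: fluxes are of the order of a face area, the means
  of \<open>\<phi>\<close> over the dual cells of one cell differ by the order of its diameter, and
  mesh regularity bounds area times diameter by a constant times the volume. A deviation of the
  unknowns in a cell therefore enters with the volume of that cell as weight, and a small weighted
  sum of deviations suffices. The obstacle is the shape of the half-diamonds, of which only the
  volume is known: the mean of \<open>\<phi>\<close> over a dual cell represents its average on the
  face only up to the order of the diameter, so the resulting flux error is of the order of the
  volume, not smaller. It has to cancel between the two cells at the face. For this the flux is
  taken over the prism swept by the face under a shift along an axis, with one length
  \<open>s\<close> for the whole mesh, not above any cell diameter: both cells then see the same
  prism, with opposite normals. The final constant depends only on the bounds assumed uniformly in
  \<open>m\<close>, so the accuracy, and with it \<open>r\<close> and \<open>U\<close>, can be fixed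
  before the mesh is refined.\<close>

definition prism :: "'a::real_vector \<Rightarrow> 'a set \<Rightarrow> 'a set" where
  "prism v \<sigma> = {x + s *\<^sub>R v | x s. x \<in> \<sigma> \<and> 0 \<le> s \<and> s \<le> 1}"

lemma prism_eq: "prism v \<sigma> = (\<lambda>(x, s). x + s *\<^sub>R v) ` (\<sigma> \<times> {0..1})"
proof -
  have "x + s *\<^sub>R v \<in> prism v \<sigma>" if "x \<in> \<sigma>" "0 \<le> s" "s \<le> 1" for x s
    unfolding prism_def using that by blast
  then show ?thesis by (auto simp: prism_def)
qed

lemma compact_prism:
  fixes \<sigma> :: "'a::real_normed_vector set"
  assumes "compact \<sigma>" shows "compact (prism v \<sigma>)"
proof -
  have "compact ((\<lambda>(x, s). x + s *\<^sub>R v) ` (\<sigma> \<times> {0..1::real}))"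
    by (intro compact_continuous_image compact_Times assms)
      (auto simp: case_prod_beta intro!: continuous_intros)
  then show ?thesis by (simp add: prism_eq)
qed

text \<open>The map fixes the hyperplane orthogonal to \<open>n\<close> and sends \<open>n\<close>
  to \<open>v\<close>. Once \<open>n\<close> is rotated onto an axis, its matrix is the identity
  with one column replaced, and Cramer's lemma gives the determinant.\<close>

lemma det_shear_normal:
  fixes n v :: "real^'d"
  assumes n: "norm n = 1"
  shows "linear (\<lambda>z. z + (n \<bullet> z) *\<^sub>R (v - n))"
    and "det (matrix (\<lambda>z. z + (n \<bullet> z) *\<^sub>R (v - n))) = n \<bullet> v"
proof -
  let ?L = "\<lambda>z. z + (n \<bullet> z) *\<^sub>R (v - n)"
  show lin: "linear ?L"
    by (rule linearI) (auto simp: algebra_simps inner_simps)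
  obtain k :: 'd where True by simp
  obtain Q :: "real^'d \<Rightarrow> real^'d" where Q: "orthogonal_transformation Q" "Q (axis k 1) = n"
    using orthogonal_transformation_exists_1[of "axis k 1" n] n by (auto simp: norm_axis_1)
  have linQ: "linear Q" using Q(1) by (simp add: orthogonal_transformation_linear)
  obtain w where w: "Q w = v"
    using orthogonal_transformation_surj[OF Q(1)] by (metis surjD)
  \<comment> \<open>Writing \<open>mat 1 *v w\<close> for \<open>w\<close> gives \<open>?M\<close>
    exactly the form of the matrix in \<open>cramer_lemma\<close>.\<close>
  let ?M = "(\<chi> i j. if j = k then (mat 1 *v w) $ i else mat 1 $ i $ j) :: real^'d^'d"
  have Mz: "?M *v z = z + (z $ k) *\<^sub>R (w - axis k 1)" for z
  proof -
    have "(?M *v z) $ i = (z + (z $ k) *\<^sub>R (w - axis k 1)) $ i" for i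
    proof -
      have "(?M *v z) $ i = (\<Sum>j\<in>UNIV. (if j = k then w $ i else mat 1 $ i $ j) * z $ j)"
        unfolding matrix_vector_mul_lid by (simp add: matrix_vector_mult_def)
      also have "\<dots> = (\<Sum>j\<in>UNIV. (if j = k then w $ i * z $ k - (if i = k then z $ k else 0) else 0)
            + (if j = i then z $ i else 0))"
        by (intro sum.cong) (auto simp: mat_def)
      also have "\<dots> = w $ i * z $ k - (if i = k then z $ k else 0) + z $ i"
        by (simp add: sum.distrib)
      also have "\<dots> = (z + (z $ k) *\<^sub>R (w - axis k 1)) $ i"
        by (simp add: axis_def right_diff_distrib mult.commute)
      finally show ?thesis .
    qed
    then show ?thesis by (simp add: vec_eq_iff)
  qed
  have eq: "?L (Q z) = Q (?M *v z)" for z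
  proof -
    have "n \<bullet> Q z = Q (axis k 1) \<bullet> Q z" by (simp only: Q(2))
    also have "\<dots> = axis k 1 \<bullet> z" using Q(1) unfolding orthogonal_transformation_def by blast
    finally have 1: "n \<bullet> Q z = z $ k" by (simp only: inner_axis' inner_real_def mult_1)
    show ?thesis
      unfolding Mz 1 linear_add[OF linQ] linear_cmul[OF linQ] linear_diff[OF linQ] Q(2) w ..
  qed
  have comp: "?L \<circ> Q = Q \<circ> (\<lambda>z. ?M *v z)"
    unfolding fun_eq_iff o_apply by (intro allI eq)
  have "matrix ?L ** matrix Q = matrix (?L \<circ> Q)"
    by (rule matrix_compose[OF linQ lin, symmetric])
  also have "\<dots> = matrix Q ** matrix (\<lambda>z. ?M *v z)"
    unfolding comp by (rule matrix_compose[OF matrix_vector_mul_linear linQ])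
  also have "matrix (\<lambda>z. ?M *v z) = ?M" by (rule matrix_of_matrix_vector_mul)
  finally have "det (matrix ?L ** matrix Q) = det (matrix Q ** ?M)" by (rule arg_cong)
  then have "det (matrix ?L) * det (matrix Q) = det ?M * det (matrix Q)"
    unfolding det_mul by (simp only: mult.commute)
  moreover have "det (matrix Q) \<noteq> 0"
    using orthogonal_transformation_det[OF Q(1)] by auto
  ultimately have "det (matrix ?L) = det ?M" by (rule mult_right_cancel[THEN iffD1, rotated])
  also have "\<dots> = w $ k" unfolding cramer_lemma by (simp only: det_I mult_1_right)
  also have "w $ k = w \<bullet> axis k 1" by (simp only: inner_axis inner_real_def mult_1_right)
  also have "\<dots> = Q w \<bullet> Q (axis k 1)" using Q(1) unfolding orthogonal_transformation_def by simp
  finally show "det (matrix ?L) = n \<bullet> v" by (simp only: w Q(2) inner_commute)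
qed

text \<open>The library has the measure of a linear image only for well-ordered index types; the axes are
  therefore renumbered by \<open>2\<close> or \<open>3\<close>.\<close>

lemma measure_prism_wellorder:
  fixes n v :: "real^'d::{finite,wellorder}"
  assumes n: "norm n = 1" and "compact \<sigma>" and flat: "\<And>x y. x \<in> \<sigma> \<Longrightarrow> y \<in> \<sigma> \<Longrightarrow> n \<bullet> (x - y) = 0"
  shows "measure lebesgue (prism v \<sigma>) = \<bar>n \<bullet> v\<bar> * face_measure n \<sigma>"
proof (cases "\<sigma> = {}")
  case True
  then show ?thesis by (simp add: prism_def face_measure_def)
next
  case False
  then obtain a where a: "a \<in> \<sigma>" by auto
  let ?L = "\<lambda>z. z + (n \<bullet> z) *\<^sub>R (v - n)"
  have nn: "n \<bullet> n = 1" using n by (simp add: norm_eq_1)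
  \<comment> \<open>After translation by \<open>- a\<close> the face is orthogonal to
    \<open>n\<close>, so the height \<open>s\<close> above the face is the inner product with
    \<open>n\<close>.\<close>
  have L: "?L (- a + (x + s *\<^sub>R n)) = - a + (x + s *\<^sub>R v)" if "x \<in> \<sigma>" for x s
  proof -
    have "n \<bullet> (- a + (x + s *\<^sub>R n)) = s"
      using flat[OF that a] nn by (simp add: inner_simps)
    then show ?thesis by (simp add: algebra_simps)
  qed
  have "(\<lambda>z. - a + z) ` prism v \<sigma> = ?L ` ((\<lambda>z. - a + z) ` prism n \<sigma>)"
    unfolding prism_eq image_image using L by (intro image_cong) (auto split: prod.splits)
  then have "measure lebesgue (prism v \<sigma>) = measure lebesgue (?L ` ((\<lambda>z. - a + z) ` prism n \<sigma>))"
    by (metis measure_translation)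
  also have "\<dots> = \<bar>det (matrix ?L)\<bar> * measure lebesgue ((\<lambda>z. - a + z) ` prism n \<sigma>)"
    by (rule measure_linear_image[OF det_shear_normal(1)[OF n]])
      (intro measurable_translation lmeasurable_compact compact_prism assms)
  also have "\<dots> = \<bar>n \<bullet> v\<bar> * face_measure n \<sigma>"
    unfolding det_shear_normal(2)[OF n] measure_translation face_measure_def prism_def ..
  finally show ?thesis .
qed

lemma prod_Basis_cart:
  fixes x :: "real^'n::finite"
  shows "(\<Prod>b\<in>Basis. x \<bullet> b) = (\<Prod>k\<in>UNIV. x $ k)"
proof -
  have B: "(Basis :: (real^'n) set) = (\<lambda>k. axis k 1) ` UNIV" by (auto simp: Basis_vec_def)
  have inj: "inj (\<lambda>k :: 'n. axis k (1::real))" by (auto simp: inj_on_def axis_eq_axis)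
  show ?thesis unfolding B prod.reindex[OF inj] by (simp add: inner_axis)
qed

text \<open>Lebesgue measure is determined by its values on boxes, and renumbering the axes only
  permutes the side lengths of a box.\<close>

lemma lborel_distr_permute_axes:
  fixes f :: "'n::finite \<Rightarrow> 'd::finite"
  assumes f: "bij f"
  shows "distr lborel borel (\<lambda>x :: real^'d. \<chi> k. x $ f k) = (lborel :: (real^'n) measure)"
proof (rule lborel_eqI[symmetric])
  let ?R = "\<lambda>x :: real^'d. (\<chi> k. x $ f k) :: real^'n"
  let ?Q = "\<lambda>y :: real^'n. (\<chi> j. y $ inv f j) :: real^'d"
  have meas: "?R \<in> borel_measurable borel"
    by (intro borel_measurable_continuous_onI continuous_intros)
  have inv: "inv f (f k) = k" "f (inv f j) = j" for k j
    using f by (auto simp: bij_is_inj bij_is_surj surj_f_inv_f)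
  fix l u :: "real^'n" assume le: "\<And>b. b \<in> Basis \<Longrightarrow> l \<bullet> b \<le> u \<bullet> b"
  have le': "l $ k \<le> u $ k" for k using le[of "axis k 1"] by (simp add: inner_axis)
  have "?R -` box l u = box (?Q l) (?Q u)"
  proof (intro set_eqI iffI)
    fix x assume "x \<in> ?R -` box l u"
    then have "l $ k < x $ f k \<and> x $ f k < u $ k" for k by (simp add: mem_box_cart)
    from this[of "inv f j" for j] show "x \<in> box (?Q l) (?Q u)" by (simp add: mem_box_cart inv)
  next
    fix x assume "x \<in> box (?Q l) (?Q u)"
    then have "l $ inv f j < x $ j \<and> x $ j < u $ inv f j" for j by (simp add: mem_box_cart)
    from this[of "f k" for k] show "x \<in> ?R -` box l u" by (simp add: mem_box_cart inv)
  qed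
  then have "emeasure (distr lborel borel ?R) (box l u) = emeasure lborel (box (?Q l) (?Q u))"
    using meas by (simp add: emeasure_distr)
  also have "\<dots> = ennreal (\<Prod>b\<in>Basis. (?Q u - ?Q l) \<bullet> b)"
    using le' by (intro emeasure_lborel_box) (auto simp: Basis_vec_def inner_axis)
  also have "(\<Prod>b\<in>Basis. (?Q u - ?Q l) \<bullet> b) = (\<Prod>j\<in>UNIV. (?Q u - ?Q l) $ j)"
    by (rule prod_Basis_cart)
  also have "\<dots> = (\<Prod>k\<in>UNIV. (u - l) $ k)"
    by (rule prod.reindex_bij_witness[of _ f "inv f"]) (auto simp: inv)
  also have "\<dots> = (\<Prod>b\<in>Basis. (u - l) \<bullet> b)"
    by (rule prod_Basis_cart[symmetric])
  finally show "emeasure (distr lborel borel ?R) (box l u) = ennreal (\<Prod>b\<in>Basis. (u - l) \<bullet> b)" .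
qed simp

text \<open>Renumbering the axes is a linear isometry that preserves volumes and maps prisms to
  prisms, so the formula can be checked over \<open>'n\<close>.\<close>

lemma measure_prism_reindex:
  fixes n v :: "real^'d" and f :: "'n::{finite,wellorder} \<Rightarrow> 'd::finite"
  assumes f: "bij f"
    and n: "norm n = 1" and "compact \<sigma>" and flat: "\<And>x y. x \<in> \<sigma> \<Longrightarrow> y \<in> \<sigma> \<Longrightarrow> n \<bullet> (x - y) = 0"
  shows "measure lebesgue (prism v \<sigma>) = \<bar>n \<bullet> v\<bar> * face_measure n \<sigma>"
proof -
  let ?R = "\<lambda>x :: real^'d. (\<chi> k. x $ f k) :: real^('n::{finite,wellorder})"
  have lin: "linear ?R" by (rule linearI) (auto simp: vec_eq_iff)
  have cont: "continuous_on S ?R" for S by (intro continuous_intros)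
  have meas: "?R \<in> borel_measurable borel"
    by (intro borel_measurable_continuous_onI cont)
  have inner: "?R x \<bullet> ?R y = x \<bullet> y" for x y
  proof -
    have "(\<Sum>k\<in>UNIV. x $ f k * y $ f k) = (\<Sum>j\<in>UNIV. x $ j * y $ j)"
      by (rule sum.reindex_bij_betw[OF f])
    then show ?thesis by (simp add: inner_vec_def)
  qed
  have norm: "norm (?R x) = norm x" for x unfolding norm_eq_sqrt_inner inner ..
  have inj: "inj ?R"
    unfolding linear_injective_0[OF lin] using norm by (metis norm_eq_zero)
  have prism_R: "?R ` prism w \<sigma> = prism (?R w) (?R ` \<sigma>)" for w
  proof -
    have "?R ` prism w \<sigma> = (\<lambda>(x, s). ?R x + s *\<^sub>R ?R w) ` (\<sigma> \<times> {0..1})"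
      unfolding prism_eq image_image
      by (intro image_cong) (auto simp: vec_eq_iff split: prod.splits)
    also have "\<dots> = (\<lambda>(x, s). x + s *\<^sub>R ?R w) ` (map_prod ?R id ` (\<sigma> \<times> {0..1}))"
      unfolding image_image by (intro image_cong) (auto split: prod.splits)
    also have "map_prod ?R id ` (\<sigma> \<times> {0..1}) = (?R ` \<sigma>) \<times> {0..1::real}"
      by force
    finally show ?thesis by (simp only: prism_eq)
  qed
  have measR: "measure lebesgue (?R ` S) = measure lebesgue S" if "compact S" for S
  proof -
    have c: "compact (?R ` S)" using that cont by (intro compact_continuous_image)
    have "measure lborel (?R ` S) = measure (distr lborel borel ?R) (?R ` S)"
      by (simp add: lborel_distr_permute_axes[OF f])
    also have "\<dots> = measure lborel (?R -` (?R ` S))"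
      using c meas by (subst measure_distr) (auto simp: borel_compact)
    also have "?R -` (?R ` S) = S" using inj by (rule inj_vimage_image_eq)
    finally show ?thesis using c that by (simp add: borel_compact)
  qed
  have cp: "compact (prism w \<sigma>)" for w using assms by (intro compact_prism)
  have "measure lebesgue (prism (?R v) (?R ` \<sigma>)) = \<bar>?R n \<bullet> ?R v\<bar> * face_measure (?R n) (?R ` \<sigma>)"
  proof (rule measure_prism_wellorder)
    show "norm (?R n) = 1" using n norm by simp
    show "compact (?R ` \<sigma>)" using assms cont by (intro compact_continuous_image)
    show "?R n \<bullet> (x - y) = 0" if xy: "x \<in> ?R ` \<sigma>" "y \<in> ?R ` \<sigma>" for x y
    proof -
      obtain p q where "p \<in> \<sigma>" "q \<in> \<sigma>" "x = ?R p" "y = ?R q" using xy by blast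
      then show ?thesis by (simp only: linear_diff[OF lin, symmetric] inner flat)
    qed
  qed
  moreover have "face_measure (?R n) (?R ` \<sigma>) = face_measure n \<sigma>"
    unfolding face_measure_def prism_def[symmetric] prism_R[symmetric] by (rule measR[OF cp])
  ultimately show ?thesis
    unfolding prism_R[symmetric] inner measR[OF cp] by (simp only:)
qed

text \<open>Base times height, \<open>face_measure n \<sigma>\<close> being the volume of
  \<open>prism n \<sigma>\<close>. This turns volumes of swept prisms into fluxes of constant fields
  through flat faces.\<close>

lemma measure_prism:
  fixes n v :: "real^'d"
  assumes d: "CARD('d) \<in> {2, 3}"
    and n: "norm n = 1" and "compact \<sigma>" and flat: "\<And>x y. x \<in> \<sigma> \<Longrightarrow> y \<in> \<sigma> \<Longrightarrow> n \<bullet> (x - y) = 0"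
  shows "measure lebesgue (prism v \<sigma>) = \<bar>n \<bullet> v\<bar> * face_measure n \<sigma>"
proof (cases "CARD('d) = 2")
  case True
  then obtain f :: "2 \<Rightarrow> 'd" where "bij f"
    using finite_same_card_bij[of "UNIV :: 2 set" "UNIV :: 'd set"] by auto
  then show ?thesis using measure_prism_reindex assms by blast
next
  case False
  then obtain f :: "3 \<Rightarrow> 'd" where "bij f"
    using d finite_same_card_bij[of "UNIV :: 3 set" "UNIV :: 'd set"] by auto
  then show ?thesis using measure_prism_reindex assms by blast
qed

text \<open>Base times height for the sweep direction \<open>- n\<close>. The area of a face thus
  does not depend on the side from which it is seen.\<close>

lemma face_measure_uminus:
  fixes n :: "real^'d"
  assumes "CARD('d) \<in> {2, 3}" and "norm n = 1" and "compact \<sigma>" and "\<And>x y. x \<in> \<sigma> \<Longrightarrow> y \<in> \<sigma> \<Longrightarrow> n \<bullet> (x - y) = 0"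
  shows "face_measure (- n) \<sigma> = face_measure n \<sigma>"
  using measure_prism[OF assms, of "- n"] assms(2)
  by (simp add: face_measure_def prism_def dot_square_norm)

lemma negligible_aff_lowdim:
  fixes S :: "'a::euclidean_space set"
  assumes "aff_dim S < DIM('a)" shows "negligible S"
proof -
  obtain a b where "a \<noteq> 0" "S \<subseteq> {x. a \<bullet> x = b}"
    using aff_lowdim_subset_hyperplane[OF assms] by metis
  then show ?thesis
    using negligible_hyperplane[of a b] negligible_subset by blast
qed

text \<open>Sweeping raises the affine dimension by at most one. Segments that meet a cell boundary
  in a ridge can therefore be discarded.\<close>

lemma negligible_prism_lowdim:
  fixes A :: "'a::euclidean_space set"
  assumes "aff_dim A \<le> int DIM('a) - 2" shows "negligible (prism v A)"
proof (cases "A = {}")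
  case True
  then show ?thesis by (simp add: prism_def)
next
  case False
  then obtain a where a: "a \<in> A" by auto
  have sub: "prism v A \<subseteq> affine hull (insert (a + v) A)"
  proof
    fix x assume "x \<in> prism v A"
    then obtain p s where p: "p \<in> A" "x = p + s *\<^sub>R v" by (auto simp: prism_def)
    let ?H = "affine hull (insert (a + v) A)"
    have "p + s *\<^sub>R ((a + v) - a) \<in> ?H"
      using p a by (intro mem_affine_3_minus affine_affine_hull) (auto intro: hull_inc)
    then show "x \<in> ?H" using p by simp
  qed
  have "aff_dim (affine hull (insert (a + v) A)) < DIM('a)"
    using assms by (simp add: aff_dim_insert)
  then show ?thesis using negligible_aff_lowdim negligible_subset sub by blast
qed

text \<open>The outward normal only gives information along one line through \<open>p\<close>. In a
  ball that misses the other faces, the two open half balls are connected and avoid the frontier, so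
  one known point on each side decides for the whole half ball.\<close>

lemma side_of_face:
  fixes K :: "(real^'d) set"
  assumes K: "open K" "frontier K = \<Union>F" and F: "finite F" "\<And>\<tau>. \<tau> \<in> F \<Longrightarrow> closed \<tau>"
    and \<sigma>: "\<sigma> \<in> F" "outward_unit_normal K \<sigma> n"
    and p: "p \<in> rel_interior \<sigma>" "\<And>\<tau>. \<tau> \<in> F \<Longrightarrow> \<tau> \<noteq> \<sigma> \<Longrightarrow> p \<notin> \<tau>"
  shows "\<exists>e>0. \<forall>y\<in>ball p e. (n \<bullet> (y - p) < 0 \<longrightarrow> y \<in> K) \<and> (n \<bullet> (y - p) > 0 \<longrightarrow> y \<notin> K)"
proof -
  have "open (- \<Union>(F - {\<sigma>}))" using F by (auto intro!: closed_Union)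
  moreover have "p \<in> - \<Union>(F - {\<sigma>})" using p by auto
  ultimately obtain e where e: "e > 0" "ball p e \<subseteq> - \<Union>(F - {\<sigma>})"
    by (meson open_contains_ball)
  have n1: "norm n = 1" using \<sigma>(2) by (simp add: outward_unit_normal_def)
  have nn: "n \<bullet> n = 1" using n1 by (simp add: norm_eq_1)
  have p\<sigma>: "p \<in> \<sigma>" using p(1) rel_interior_subset by blast
  have flat: "n \<bullet> (y - p) = 0" if "y \<in> \<sigma>" for y
    using \<sigma>(2) that p\<sigma> by (simp add: outward_unit_normal_def)
  have "\<forall>\<^sub>F s in at_right 0. p - s *\<^sub>R n \<in> K \<and> p + s *\<^sub>R n \<notin> closure K"
    using \<sigma>(2) p(1) by (simp add: outward_unit_normal_def)
  moreover have "\<forall>\<^sub>F s in at_right 0. s < e \<and> s > (0::real)"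
    using e(1) by (auto intro: eventually_conj order_tendstoD simp: eventually_at_right_less eventually_at_right_field)
  ultimately have "\<forall>\<^sub>F s in at_right 0. (p - s *\<^sub>R n \<in> K \<and> p + s *\<^sub>R n \<notin> closure K) \<and> s < e \<and> s > (0::real)"
    by (rule eventually_conj)
  then obtain s where s: "p - s *\<^sub>R n \<in> K" "p + s *\<^sub>R n \<notin> closure K" "s < e" "s > 0"
    by (metis (mono_tags, lifting) eventually_happens trivial_limit_at_right_real)
  let ?A = "ball p e \<inter> {y. n \<bullet> (y - p) < 0}" and ?B = "ball p e \<inter> {y. n \<bullet> (y - p) > 0}"
  have eqs: "{y. n \<bullet> (y - p) < 0} = {y. n \<bullet> y < n \<bullet> p}" "{y. n \<bullet> (y - p) > 0} = {y. n \<bullet> y > n \<bullet> p}"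
    by (auto simp: inner_diff_right)
  have con: "connected ?A" "connected ?B"
    unfolding eqs by (intro convex_connected convex_Int convex_ball convex_halfspace_lt convex_halfspace_gt)+
  have dis: "?A \<inter> frontier K = {}" "?B \<inter> frontier K = {}"
    using e(2) flat K(2) by force+
  have "?A \<subseteq> K"
  proof -
    have "p - s *\<^sub>R n \<in> ?A \<inter> K" using s n1 nn by (auto simp: dist_norm)
    then show ?thesis using connected_Int_frontier[OF con(1), of K] dis by blast
  qed
  moreover have "?B \<inter> K = {}"
  proof -
    have "p + s *\<^sub>R n \<in> ?B - K" using s n1 nn closure_subset by (auto simp: dist_norm)
    then show ?thesis using connected_Int_frontier[OF con(2), of K] dis by blast
  qed
  ultimately show ?thesis using e(1) by (intro exI[of _ e]) blast
qed

section \<open>A divergence theorem on cells\<close>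

text \<open>Along the segment from \<open>x\<close> to \<open>x + v\<close>, the indicator of \<open>K\<close> plus the number of signed crossings so far
  is locally constant. For this to hold at a crossing too, outward crossings are counted when they are
  reached and inward ones after they are passed.\<close>

lemma crossing_identity:
  fixes K :: "(real^'d) set" and v x :: "real^'d"
  assumes K: "open K" "frontier K = \<Union>F" and F: "finite F" "\<And>\<tau>. \<tau> \<in> F \<Longrightarrow> closed \<tau>"
    and N: "\<And>\<tau>. \<tau> \<in> F \<Longrightarrow> outward_unit_normal K \<tau> (N \<tau>)"
    and x: "x \<notin> frontier K" "x + v \<notin> frontier K"
    and par: "\<And>\<tau>. \<tau> \<in> F \<Longrightarrow> N \<tau> \<bullet> v = 0 \<Longrightarrow> x \<notin> prism (- v) \<tau>"
    and int: "\<And>\<tau> \<tau>'. \<tau> \<in> F \<Longrightarrow> \<tau>' \<in> F \<Longrightarrow> \<tau> \<noteq> \<tau>' \<Longrightarrow> x \<notin> prism (- v) (\<tau> \<inter> \<tau>')"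
    and rel: "\<And>\<tau>. \<tau> \<in> F \<Longrightarrow> x \<notin> prism (- v) (\<tau> - rel_interior \<tau>)"
  shows "indicat_real K (x + v) - indicat_real K x
    = - (\<Sum>\<tau>\<in>F. sgn (N \<tau> \<bullet> v) * indicat_real (prism (- v) \<tau>) x)"
proof -
  have in_prism: "x \<in> prism (- v) A \<longleftrightarrow> (\<exists>r\<in>{0..1}. x + r *\<^sub>R v \<in> A)" for A
  proof
    assume "x \<in> prism (- v) A"
    then obtain y s where "y \<in> A" "0 \<le> s" "s \<le> 1" "x = y + s *\<^sub>R (- v)"
      by (auto simp: prism_def)
    then show "\<exists>r\<in>{0..1}. x + r *\<^sub>R v \<in> A" by (intro bexI[of _ s]) auto
  next
    assume "\<exists>r\<in>{0..1}. x + r *\<^sub>R v \<in> A"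
    then obtain r where r: "r \<in> {0..1}" "x + r *\<^sub>R v \<in> A" by blast
    have "x = (x + r *\<^sub>R v) + r *\<^sub>R (- v)" by simp
    then show "x \<in> prism (- v) A"
      unfolding prism_eq by (intro image_eqI[of _ _ "(x + r *\<^sub>R v, r)"]) (use r in auto)
  qed
  define H where "H \<tau> r = (if N \<tau> \<bullet> v > 0 then \<exists>q\<in>{0..1}. q \<le> r \<and> x + q *\<^sub>R v \<in> \<tau>
      else \<exists>q\<in>{0..1}. q < r \<and> x + q *\<^sub>R v \<in> \<tau>)" for \<tau> and r :: real
  define g where "g r = indicat_real K (x + r *\<^sub>R v) + (\<Sum>\<tau>\<in>F. sgn (N \<tau> \<bullet> v) * of_bool (H \<tau> r))" for r
  have line: "r = q" if "\<tau> \<in> F" "N \<tau> \<bullet> v \<noteq> 0" "x + r *\<^sub>R v \<in> \<tau>" "x + q *\<^sub>R v \<in> \<tau>" for r q \<tau>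
  proof -
    have "N \<tau> \<bullet> ((x + r *\<^sub>R v) - (x + q *\<^sub>R v)) = 0"
      using N[OF that(1)] that(3,4) unfolding outward_unit_normal_def by blast
    moreover have "(x + r *\<^sub>R v) - (x + q *\<^sub>R v) = (r - q) *\<^sub>R v" by (simp add: scaleR_left_diff_distrib)
    ultimately have "(r - q) * (N \<tau> \<bullet> v) = 0" by (simp only: inner_scaleR_right)
    then show ?thesis using that(2) by simp
  qed
  have cont': "((\<lambda>q. x + q *\<^sub>R v) \<longlongrightarrow> x + r *\<^sub>R v) (at r within S)" for r S
    by (intro tendsto_intros)
  \<comment> \<open>Near \<open>r\<close> no parameter is a crossing of \<open>\<tau>\<close>, so
    the tests \<open>\<le>\<close> and \<open><\<close> in \<open>H\<close> select the same
    crossings at \<open>q\<close> as at \<open>r\<close>.\<close>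
  have off: "\<forall>\<^sub>F q in at r within {0..1}. H \<tau> q = H \<tau> r"
    if "\<tau> \<in> F" "x + r *\<^sub>R v \<notin> \<tau>" for \<tau> and r
  proof -
    have "((\<lambda>q. x + q *\<^sub>R v) \<longlongrightarrow> x + r *\<^sub>R v) (at r)" by (rule cont')
    then have "\<forall>\<^sub>F q in at r. x + q *\<^sub>R v \<in> - \<tau>"
      by (rule topological_tendstoD) (use F(2)[OF that(1)] that(2) in auto)
    then obtain e where e: "e > 0" "\<And>q. q \<noteq> r \<Longrightarrow> dist q r < e \<Longrightarrow> x + q *\<^sub>R v \<notin> \<tau>"
      unfolding eventually_at by auto
    then have e: "e > 0" "\<And>q. dist q r < e \<Longrightarrow> x + q *\<^sub>R v \<notin> \<tau>"
      using that(2) by (metis, metis)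
    have "H \<tau> q = H \<tau> r" if "dist q r < e" for q
    proof -
      have "(p \<le> q \<longleftrightarrow> p \<le> r) \<and> (p < q \<longleftrightarrow> p < r)" if "x + p *\<^sub>R v \<in> \<tau>" for p
      proof -
        have "\<bar>p - r\<bar> \<ge> e" "\<bar>q - r\<bar> < e"
          using e(2)[of p] that \<open>dist q r < e\<close> unfolding dist_real_def by (metis not_le, metis)
        then show ?thesis by linarith
      qed
      then have "(\<exists>p\<in>{0..1}. p \<le> q \<and> x + p *\<^sub>R v \<in> \<tau>) = (\<exists>p\<in>{0..1}. p \<le> r \<and> x + p *\<^sub>R v \<in> \<tau>)"
        "(\<exists>p\<in>{0..1}. p < q \<and> x + p *\<^sub>R v \<in> \<tau>) = (\<exists>p\<in>{0..1}. p < r \<and> x + p *\<^sub>R v \<in> \<tau>)"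
        by blast+
      then show ?thesis unfolding H_def by (simp only:)
    qed
    then show ?thesis unfolding eventually_at by (intro exI[of _ e] conjI e(1)) blast
  qed
  have sum_ev: "\<forall>\<^sub>F q in at r within {0..1}.
      (\<Sum>\<tau>\<in>G. sgn (N \<tau> \<bullet> v) * of_bool (H \<tau> q)) = (\<Sum>\<tau>\<in>G. sgn (N \<tau> \<bullet> v) * (of_bool (H \<tau> r) :: real))"
    if "G \<subseteq> F" "\<And>\<tau>. \<tau> \<in> G \<Longrightarrow> x + r *\<^sub>R v \<notin> \<tau>" for G r
  proof -
    have "\<forall>\<^sub>F q in at r within {0..1}. \<forall>\<tau>\<in>G. H \<tau> q = H \<tau> r"
      using that off F(1) by (intro eventually_ball_finite) (auto intro: finite_subset)
    then show ?thesis by eventually_elim (auto intro!: sum.cong)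
  qed
  have loc: "\<forall>\<^sub>F q in at r within {0..1}. g r = g q" if r: "r \<in> {0..1}" for r
  proof (cases "x + r *\<^sub>R v \<in> frontier K")
    case False
    have "\<forall>\<^sub>F q in at r within {0..1}. indicat_real K (x + q *\<^sub>R v) = indicat_real K (x + r *\<^sub>R v)"
    proof (cases "x + r *\<^sub>R v \<in> K")
      case True
      then have "\<forall>\<^sub>F q in at r within {0..1}. x + q *\<^sub>R v \<in> K"
        using topological_tendstoD[OF cont' K(1)] by blast
      then show ?thesis by eventually_elim (use True in auto)
    next
      case False
      then have "x + r *\<^sub>R v \<in> - closure K"
        using \<open>x + r *\<^sub>R v \<notin> frontier K\<close> K(1) by (simp add: frontier_def interior_open)
      then have "\<forall>\<^sub>F q in at r within {0..1}. x + q *\<^sub>R v \<in> - closure K"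
        using topological_tendstoD[OF cont', of "- closure K"] by blast
      then show ?thesis by eventually_elim (use False closure_subset[of K] in \<open>auto simp: indicator_def\<close>)
    qed
    moreover have "\<forall>\<^sub>F q in at r within {0..1}.
      (\<Sum>\<tau>\<in>F. sgn (N \<tau> \<bullet> v) * of_bool (H \<tau> q)) = (\<Sum>\<tau>\<in>F. sgn (N \<tau> \<bullet> v) * (of_bool (H \<tau> r) :: real))"
      by (rule sum_ev) (use False K(2) in auto)
    ultimately show ?thesis by eventually_elim (auto simp: g_def)
  next
    case True
    then obtain \<sigma> where \<sigma>: "\<sigma> \<in> F" "x + r *\<^sub>R v \<in> \<sigma>" using K(2) by auto
    let ?p = "x + r *\<^sub>R v"
    have oth: "?p \<notin> \<tau>" if "\<tau> \<in> F" "\<tau> \<noteq> \<sigma>" for \<tau>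
      using int[OF that(1) \<sigma>(1) that(2)] r \<sigma>(2) unfolding in_prism by blast
    have rp: "?p \<in> rel_interior \<sigma>" using rel[OF \<sigma>(1)] \<sigma>(2) r unfolding in_prism by blast
    obtain e where "e > 0" and "\<forall>y\<in>ball ?p e. (N \<sigma> \<bullet> (y - ?p) < 0 \<longrightarrow> y \<in> K) \<and> (N \<sigma> \<bullet> (y - ?p) > 0 \<longrightarrow> y \<notin> K)"
      using side_of_face[OF K F \<sigma>(1) N[OF \<sigma>(1)] rp oth] by blast
    then have e: "e > 0"
        "\<And>y. y \<in> ball ?p e \<Longrightarrow> N \<sigma> \<bullet> (y - ?p) < 0 \<Longrightarrow> y \<in> K"
        "\<And>y. y \<in> ball ?p e \<Longrightarrow> N \<sigma> \<bullet> (y - ?p) > 0 \<Longrightarrow> y \<notin> K"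
      by blast+
    have nv: "N \<sigma> \<bullet> v \<noteq> 0" using par[OF \<sigma>(1)] \<sigma>(2) r unfolding in_prism by blast
    have H\<sigma>: "H \<sigma> q \<longleftrightarrow> (if N \<sigma> \<bullet> v > 0 then r \<le> q else r < q)" for q
    proof -
      have "x + p *\<^sub>R v \<in> \<sigma> \<longleftrightarrow> p = r" for p
        using line[OF \<sigma>(1) nv _ \<sigma>(2)] \<sigma>(2) by blast
      then show ?thesis unfolding H_def using r by auto
    qed
    have "?p \<notin> K" using True K(1) by (simp add: frontier_def interior_open)
    have near: "\<forall>\<^sub>F q in at r within {0..1}. x + q *\<^sub>R v \<in> ball ?p e"
      by (rule topological_tendstoD[OF cont' open_ball]) (use e(1) in simp)
    moreover have ne: "\<forall>\<^sub>F q in at r within {0..1}. q \<noteq> r"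
      by (simp add: eventually_at_filter)
    \<comment> \<open>The jump of the indicator cancels that of the counter. As \<open>?p\<close>
      itself is outside the open set \<open>K\<close>, an exit must count already at
      \<open>r\<close> and an entry only after it.\<close>
    ultimately have *: "\<forall>\<^sub>F q in at r within {0..1}.
        indicat_real K (x + q *\<^sub>R v) + sgn (N \<sigma> \<bullet> v) * of_bool (H \<sigma> q)
        = indicat_real K ?p + sgn (N \<sigma> \<bullet> v) * of_bool (H \<sigma> r)"
    proof eventually_elim
      case (elim q)
      have eq: "N \<sigma> \<bullet> ((x + q *\<^sub>R v) - ?p) = (q - r) * (N \<sigma> \<bullet> v)"
        by (simp add: inner_simps algebra_simps)
      consider "N \<sigma> \<bullet> v > 0" "q < r" | "N \<sigma> \<bullet> v > 0" "q > r" | "N \<sigma> \<bullet> v < 0" "q < r"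
        | "N \<sigma> \<bullet> v < 0" "q > r" using nv elim(2) by linarith
      then show ?case
      proof cases
        case 1
        then have "x + q *\<^sub>R v \<in> K"
          by (intro e(2) elim) (unfold eq, simp add: mult_neg_pos)
        then show ?thesis using 1 \<open>?p \<notin> K\<close> by (simp add: H\<sigma>)
      next
        case 2
        then have "x + q *\<^sub>R v \<notin> K"
          by (intro e(3) elim) (unfold eq, simp)
        then show ?thesis using 2 \<open>?p \<notin> K\<close> by (simp add: H\<sigma>)
      next
        case 3
        then have "x + q *\<^sub>R v \<notin> K"
          by (intro e(3) elim) (unfold eq, simp add: mult_neg_neg)
        then show ?thesis using 3 \<open>?p \<notin> K\<close> by (simp add: H\<sigma>)
      next
        case 4
        then have "x + q *\<^sub>R v \<in> K"
          by (intro e(2) elim) (unfold eq, simp add: mult_pos_neg)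
        then show ?thesis using 4 \<open>?p \<notin> K\<close> by (simp add: H\<sigma>)
      qed
    qed
    have "\<forall>\<^sub>F q in at r within {0..1}.
      (\<Sum>\<tau>\<in>F - {\<sigma>}. sgn (N \<tau> \<bullet> v) * of_bool (H \<tau> q)) = (\<Sum>\<tau>\<in>F - {\<sigma>}. sgn (N \<tau> \<bullet> v) * (of_bool (H \<tau> r) :: real))"
      by (rule sum_ev) (use oth in auto)
    with * show ?thesis
    proof eventually_elim
      case (elim q)
      then show ?case unfolding g_def sum.remove[OF F(1) \<sigma>(1)] by linarith
    qed
  qed
  have "g 0 = g 1"
    by (rule connected_local_const[of "{0..1::real}"]) (use loc in auto)
  moreover have "g 0 = indicat_real K x"
  proof -
    have "\<not> H \<tau> 0" if "\<tau> \<in> F" for \<tau> using x(1) K(2) that by (auto simp: H_def)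
    then show ?thesis by (simp add: g_def)
  qed
  moreover have "g 1 = indicat_real K (x + v) + (\<Sum>\<tau>\<in>F. sgn (N \<tau> \<bullet> v) * indicat_real (prism (- v) \<tau>) x)"
  proof -
    \<comment> \<open>Since \<open>x + v\<close> is not on the frontier, no crossing has parameter
      1, and strict and weak counting agree at the end of the segment.\<close>
    have "H \<tau> 1 = (x \<in> prism (- v) \<tau>)" if "\<tau> \<in> F" for \<tau>
    proof -
      have ne: "x + q *\<^sub>R v \<in> \<tau> \<Longrightarrow> q \<noteq> 1" for q using x(2) K(2) that by auto
      have "(\<exists>q\<in>{0..1}. q \<le> 1 \<and> x + q *\<^sub>R v \<in> \<tau>) = (\<exists>q\<in>{0..1}. x + q *\<^sub>R v \<in> \<tau>)"
        "(\<exists>q\<in>{0..1}. q < 1 \<and> x + q *\<^sub>R v \<in> \<tau>) = (\<exists>q\<in>{0..1}. x + q *\<^sub>R v \<in> \<tau>)"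
        by (intro bex_cong refl; use ne in \<open>auto simp: less_le\<close>)+
      then show ?thesis unfolding H_def in_prism by (simp only: if_cancel)
    qed
    then have "(\<Sum>\<tau>\<in>F. sgn (N \<tau> \<bullet> v) * of_bool (H \<tau> 1)) = (\<Sum>\<tau>\<in>F. sgn (N \<tau> \<bullet> v) * indicat_real (prism (- v) \<tau>) x)"
      by (intro sum.cong) (simp_all add: indicator_def)
    then show ?thesis by (simp add: g_def)
  qed
  ultimately show ?thesis by simp
qed

section \<open>Faces of cells: dimension, relative boundary and intersections\<close>

lemma negligible_finite_UN:
  assumes "finite I" "\<And>i. i \<in> I \<Longrightarrow> negligible (A i)" shows "negligible (\<Union>i\<in>I. A i)"
  by (rule negligible_Union) (use assms in auto)

text \<open>A quadrangular face may be nonconvex, hence no polytope. Finite unions of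
  full-dimensional polytopes within one hyperplane cover every type of face and still have a
  relative boundary of dimension at most \<open>d - 2\<close>.\<close>

definition facial :: "(real^'d) set \<Rightarrow> bool" where
  "facial \<sigma> \<longleftrightarrow> aff_dim \<sigma> = int CARD('d) - 1 \<and>
     (\<exists>\<P>. finite \<P> \<and> \<P> \<noteq> {} \<and> (\<forall>P\<in>\<P>. polytope P \<and> aff_dim P = int CARD('d) - 1) \<and> \<sigma> = \<Union>\<P>)"

lemma facial_compact: "facial \<sigma> \<Longrightarrow> compact \<sigma>"
  unfolding facial_def by (metis compact_Union polytope_imp_compact)

text \<open>By equality of dimensions \<open>P\<close> and \<open>\<sigma>\<close> have the same
  affine hull, and within a fixed hull relative interiors are monotone.\<close>

lemma facial_polytope_rel_interior:
  assumes \<sigma>: "aff_dim \<sigma> = int CARD('d) - 1" and P: "P \<subseteq> \<sigma>" "aff_dim P = int CARD('d) - 1" "P \<noteq> {}"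
  shows "rel_interior P \<subseteq> rel_interior (\<sigma> :: (real^'d) set)"
proof (rule subset_rel_interior)
  show "affine hull P = affine hull \<sigma>"
    by (rule affine_dim_equal) (use assms in \<open>auto intro: hull_mono simp: hull_mono\<close>)
qed (rule P(1))

lemma facial_rel_interior_nonempty:
  assumes "facial (\<sigma> :: (real^'d) set)" shows "rel_interior \<sigma> \<noteq> {}"
proof -
  obtain P where P: "polytope P" "aff_dim P = int CARD('d) - 1" "P \<subseteq> \<sigma>"
    using assms unfolding facial_def by blast
  have ne: "P \<noteq> {}" using P(2) by auto
  then have "rel_interior P \<noteq> {}"
    using P(1) by (simp add: polytope_imp_convex rel_interior_eq_empty)
  moreover have "rel_interior P \<subseteq> rel_interior \<sigma>"
    by (rule facial_polytope_rel_interior) (use assms P ne in \<open>auto simp: facial_def\<close>)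
  ultimately show ?thesis by blast
qed

text \<open>A point of \<open>\<sigma>\<close> outside its relative interior lies on a facet of one
  of the polytopes composing \<open>\<sigma>\<close>, and facets have codimension two.\<close>

lemma negligible_prism_rel_boundary:
  assumes "facial (\<sigma> :: (real^'d) set)" shows "negligible (prism v (\<sigma> - rel_interior \<sigma>))"
proof -
  obtain \<P> where P: "finite \<P>" "\<And>P. P \<in> \<P> \<Longrightarrow> polytope P" "\<And>P. P \<in> \<P> \<Longrightarrow> aff_dim P = int CARD('d) - 1"
    "\<sigma> = \<Union>\<P>" and dim: "aff_dim \<sigma> = int CARD('d) - 1"
    using assms unfolding facial_def by blast
  have ne: "P \<noteq> {}" if "P \<in> \<P>" for P using P(3)[OF that] by auto
  have "rel_interior P \<subseteq> rel_interior \<sigma>" if "P \<in> \<P>" for P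
    by (rule facial_polytope_rel_interior) (use that P ne dim in auto)
  then have 1: "\<sigma> - rel_interior \<sigma> \<subseteq> (\<Union>P\<in>\<P>. P - rel_interior P)"
    using P(4) by blast
  have 2: "P - rel_interior P \<subseteq> \<Union>{F. F facet_of P}" if "P \<in> \<P>" for P
    using rel_frontier_of_polyhedron[OF polytope_imp_polyhedron[OF P(2)[OF that]]]
      closure_subset[of P] unfolding rel_frontier_def by blast
  have "prism v (\<sigma> - rel_interior \<sigma>) \<subseteq> (\<Union>P\<in>\<P>. \<Union>F\<in>{F. F facet_of P}. prism v F)"
  proof
    fix x assume "x \<in> prism v (\<sigma> - rel_interior \<sigma>)"
    then obtain y s where y: "y \<in> \<sigma> - rel_interior \<sigma>" "x = y + s *\<^sub>R v" "0 \<le> s" "s \<le> 1"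
      unfolding prism_def by blast
    then obtain P F where "P \<in> \<P>" "F facet_of P" "y \<in> F" using 1 2 by blast
    moreover from this have "x \<in> prism v F" unfolding prism_def using y by blast
    ultimately show "x \<in> (\<Union>P\<in>\<P>. \<Union>F\<in>{F. F facet_of P}. prism v F)" by blast
  qed
  moreover have "negligible (prism v F)" if "P \<in> \<P>" "F facet_of P" for P F
    by (rule negligible_prism_lowdim) (use that P(3) in \<open>auto simp: facet_of_def\<close>)
  then have "negligible (\<Union>P\<in>\<P>. \<Union>F\<in>{F. F facet_of P}. prism v F)"
    using P(1,2) by (intro negligible_finite_UN finite_polytope_facets) auto
  ultimately show ?thesis using negligible_subset by blast
qed

lemma aff_dim_triangle:
  fixes a b c :: "'a::euclidean_space"
  assumes "\<not> collinear {a, b, c}" shows "aff_dim {a, b, c} = 2"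
proof -
  have "aff_dim {a, b, c} \<le> int (card {a, b, c}) - 1" by (rule aff_dim_le_card) simp
  moreover have "card {a, b, c} \<le> 3" by (simp add: card_insert_if)
  moreover have "\<not> aff_dim {a, b, c} \<le> 1" using assms by (simp add: collinear_aff_dim)
  ultimately show ?thesis by linarith
qed

lemma facial_two_triangles:
  fixes a b c d :: "real^'d"
  assumes "CARD('d) = 3" "\<not> collinear {a, b, c}" "\<not> collinear {a, c, d}" "aff_dim {a, b, c, d} = 2"
  shows "facial (convex hull {a, b, c} \<union> convex hull {a, c, d})" (is "facial (?A \<union> ?B)")
proof -
  have A: "aff_dim ?A = 2" "aff_dim ?B = 2" using assms by (simp_all add: aff_dim_convex_hull aff_dim_triangle)
  have "?A \<union> ?B \<subseteq> convex hull {a, b, c, d}" by (intro Un_least hull_mono) auto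
  then have "aff_dim (?A \<union> ?B) \<le> 2" using aff_dim_subset assms(4) by (metis aff_dim_convex_hull)
  moreover have "aff_dim ?A \<le> aff_dim (?A \<union> ?B)" by (intro aff_dim_subset) auto
  ultimately have "aff_dim (?A \<union> ?B) = 2" using A by linarith
  then show ?thesis unfolding facial_def using A assms(1)
    by (intro conjI exI[of _ "{?A, ?B}"]) (auto intro: polytope_convex_hull)
qed

lemma facial_flat_face:
  assumes "flat_face vs (\<sigma> :: (real^'d) set)"
    and "length vs = CARD('d) \<or> CARD('d) = 3 \<and> length vs = 4" and d: "CARD('d) \<in> {2, 3}"
  shows "facial \<sigma>"
proof -
  consider (2) a b where "CARD('d) = 2" "vs = [a, b]" | (3) a b c where "CARD('d) = 3" "vs = [a, b, c]"
    | (4) a b c e where "CARD('d) = 3" "vs = [a, b, c, e]"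
    using assms(2) d by (auto simp: length_Suc_conv numeral_eq_Suc)
  then show ?thesis
  proof cases
    case 2
    then have *: "a \<noteq> b" "\<sigma> = convex hull {a, b}" using assms(1) by (auto simp: segment_convex_hull)
    then show ?thesis unfolding facial_def using 2
      by (intro conjI exI[of _ "{convex hull {a, b}}"]) (auto intro: polytope_convex_hull simp: aff_dim_convex_hull)
  next
    case 3
    then have *: "\<not> collinear {a, b, c}" "\<sigma> = convex hull {a, b, c}" using assms(1) by auto
    then show ?thesis unfolding facial_def using 3
      by (intro conjI exI[of _ "{convex hull {a, b, c}}"])
        (auto intro: polytope_convex_hull simp: aff_dim_convex_hull aff_dim_triangle)
  next
    case 4
    then have q: "quadrangle a b c e \<sigma>" using assms(1) by simp
    \<comment> \<open>Brings the vertex triples of the two diagonal splittings into the order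
      expected by \<open>facial_two_triangles\<close>.\<close>
    have perm: "{c, e, a} = {a, c, e}" "{e, a, b} = {b, e, a}" "{b, a, c, e} = {a, b, c, e}" by auto
    show ?thesis
      using q facial_two_triangles[OF 4(1), of a b c e] facial_two_triangles[OF 4(1), of b c e a]
      unfolding quadrangle_def split_quadrangle_def perm by blast
  qed
qed

lemma cell_types_faces:
  assumes d: "d \<in> {2, 3}" and fs: "fs \<in> cell_types d" and f: "f \<in> set fs"
  shows "length f = d \<or> d = 3 \<and> length f = 4"
  using d fs f by (auto simp: cell_types_def triangle_type_def quadrangle_type_def tetrahedron_type_def
      hexahedron_type_def prism_type_def pyramid_type_def)

text \<open>Inspection of the six types. It keeps the affine dimension of the intersection of two
  faces at or below \<open>d - 2\<close>.\<close>

lemma cell_types_common_vertices: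
  assumes d: "d \<in> {2, 3}" and fs: "fs \<in> cell_types d" and f: "f \<in> set fs" "g \<in> set fs" "f \<noteq> g"
  shows "card (set f \<inter> set g) < d"
proof -
  have "\<forall>f\<in>set fs. \<forall>g\<in>set fs. f \<noteq> g \<longrightarrow> card (set f \<inter> set g) < d"
  proof -
    have [simp]: "card {a, b} \<le> 2" "card {a} < 2" "card {a} < 3" "card {a, b} < 3" for a b :: nat
      by (auto simp: card_insert_if)
    have "fs \<in> {triangle_type, quadrangle_type} \<and> d = 2 \<or>
        fs \<in> {tetrahedron_type, hexahedron_type, prism_type, pyramid_type} \<and> d = 3"
      using d fs by (auto simp: cell_types_def)
    then show ?thesis
      by (elim disjE conjE insertE emptyE; simp add: triangle_type_def quadrangle_type_def
        tetrahedron_type_def hexahedron_type_def prism_type_def pyramid_type_def)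
  qed
  then show ?thesis using f by blast
qed

text \<open>This is all that later arguments use of the combinatorial type of a cell.\<close>

lemma is_cell_faces:
  assumes d: "CARD('d) \<in> {2, 3}" and K: "is_cell K (F :: (real^'d) set set)"
  shows "finite F" "F \<noteq> {}" "\<And>\<sigma>. \<sigma> \<in> F \<Longrightarrow> facial \<sigma>"
    "\<And>\<sigma> \<tau>. \<sigma> \<in> F \<Longrightarrow> \<tau> \<in> F \<Longrightarrow> \<sigma> \<noteq> \<tau> \<Longrightarrow> aff_dim (\<sigma> \<inter> \<tau>) \<le> int CARD('d) - 2"
proof -
  obtain fs v S where fs: "fs \<in> cell_types CARD('d)"
    and S: "\<And>f. f \<in> set fs \<Longrightarrow> flat_face (map v f) (S f)"
    "\<And>f g. f \<in> set fs \<Longrightarrow> g \<in> set fs \<Longrightarrow> f \<noteq> g \<Longrightarrow> S f \<inter> S g = convex hull (v ` (set f \<inter> set g))"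
    and F: "F = S ` set fs"
  proof -
    have "\<exists>fs\<in>cell_types CARD('d). \<exists>v S.
        inj_on v (\<Union>f\<in>set fs. set f) \<and>
        (\<forall>f\<in>set fs. flat_face (map v f) (S f)) \<and>
        (\<forall>f\<in>set fs. \<forall>g\<in>set fs. f \<noteq> g \<longrightarrow>
            S f \<inter> S g = convex hull (v ` (set f \<inter> set g)) \<and>
            (share_ridge (S f) (S g) \<longrightarrow> aff_dim (S f \<union> S g) = int CARD('d))) \<and>
        F = S ` set fs"
      using K unfolding is_cell_def by (elim conjE)
    then obtain fs v S where "fs \<in> cell_types CARD('d)"
        and *: "\<forall>f\<in>set fs. flat_face (map v f) (S f)"
        "\<forall>f\<in>set fs. \<forall>g\<in>set fs. f \<noteq> g \<longrightarrow>
            S f \<inter> S g = convex hull (v ` (set f \<inter> set g)) \<and>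
            (share_ridge (S f) (S g) \<longrightarrow> aff_dim (S f \<union> S g) = int CARD('d))"
        "F = S ` set fs"
      by (elim bexE exE conjE)
    then show thesis
      by (intro that[of fs v S]) (simp_all only: *(3) *(1)[rule_format], use *(2) in metis)
  qed
  show "finite F" using F by simp
  have "set fs \<noteq> {}" using d fs by (auto simp: cell_types_def triangle_type_def quadrangle_type_def tetrahedron_type_def
      hexahedron_type_def prism_type_def pyramid_type_def)
  then show "F \<noteq> {}" using F by simp
  show "facial \<sigma>" if "\<sigma> \<in> F" for \<sigma>
    using that facial_flat_face[OF S(1) _ d] cell_types_faces[OF d fs] F by auto
  show "aff_dim (\<sigma> \<inter> \<tau>) \<le> int CARD('d) - 2" if st: "\<sigma> \<in> F" "\<tau> \<in> F" "\<sigma> \<noteq> \<tau>" for \<sigma> \<tau>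
  proof -
    obtain f g where fg: "f \<in> set fs" "g \<in> set fs" "\<sigma> = S f" "\<tau> = S g" using st F by auto
    then have ne: "f \<noteq> g" using st by auto
    have "aff_dim (\<sigma> \<inter> \<tau>) = aff_dim (v ` (set f \<inter> set g))"
      using S(2)[OF fg(1,2) ne] fg by (simp add: aff_dim_convex_hull)
    also have "\<dots> \<le> int (card (v ` (set f \<inter> set g))) - 1" by (rule aff_dim_le_card) simp
    also have "\<dots> \<le> int (card (set f \<inter> set g)) - 1" using card_image_le[of "set f \<inter> set g" v] by simp
    also have "\<dots> \<le> int CARD('d) - 2" using cell_types_common_vertices[OF d fs fg(1,2) ne] by simp
    finally show ?thesis .
  qed
qed

lemma integral_translate_set:
  fixes g :: "real^'d \<Rightarrow> real"
  assumes "open K" "bounded K" "continuous_on UNIV g"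
  shows "integrable lborel (\<lambda>x. g x * indicat_real K (x + v))"
    and "(LINT x|lborel. g x * indicat_real K (x + v)) = (LINT x|lborel. indicat_real K x * g (x - v))"
proof -
  let ?h = "\<lambda>x. indicat_real K x * g (x - v)"
  have c: "continuous_on UNIV (\<lambda>x. g (x - v))"
    by (rule continuous_on_compose2[OF assms(3)]) (auto intro!: continuous_intros)
  have "set_integrable lborel (closure K) (\<lambda>x. g (x - v))"
    unfolding set_integrable_def
    by (rule borel_integrable_compact) (use assms c in \<open>auto intro: continuous_on_subset\<close>)
  then have "set_integrable lborel K (\<lambda>x. g (x - v))"
    by (rule set_integrable_subset) (use assms closure_subset in auto)
  then have h: "integrable lborel ?h" by (simp add: set_integrable_def)
  have hm: "?h \<in> borel_measurable borel" using borel_measurable_integrable[OF h] by simp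
  have d: "distr lborel borel ((+) v) = (lborel :: (real^'d) measure)" by (rule lborel_distr_plus)
  have eq: "(\<lambda>x. g x * indicat_real K (x + v)) = (\<lambda>x. ?h (v + x))"
    by (auto simp: add.commute mult.commute)
  show "integrable lborel (\<lambda>x. g x * indicat_real K (x + v))"
    unfolding eq using h hm integrable_distr_eq[of "(+) v" lborel borel ?h] unfolding d by simp
  show "(LINT x|lborel. g x * indicat_real K (x + v)) = (LINT x|lborel. ?h x)"
    unfolding eq using hm integral_distr[of "(+) v" lborel borel ?h] unfolding d by simp
qed

text \<open>A divergence theorem for the translation by \<open>v\<close>, in which the flux through a face is the integral over
  the prism that the face sweeps; it needs neither surface integrals nor convexity of the cell.\<close>

lemma cell_divergence:
  fixes K :: "(real^'d) set" and g :: "real^'d \<Rightarrow> real"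
  assumes d: "CARD('d) \<in> {2, 3}" and K: "is_cell K F"
    and N: "\<And>\<tau>. \<tau> \<in> F \<Longrightarrow> outward_unit_normal K \<tau> (N \<tau>)" and g: "continuous_on UNIV g"
  shows "(LINT x:K|lborel. g (x - v)) - (LINT x:K|lborel. g x)
    = - (\<Sum>\<tau>\<in>F. sgn (N \<tau> \<bullet> v) * (LINT x:prism (- v) \<tau>|lborel. g x))"
proof -
  have oK: "open K" "bounded K" "frontier K = \<Union>F" using K by (auto simp: is_cell_def)
  note F = is_cell_faces[OF d K]
  have cl: "closed \<tau>" if "\<tau> \<in> F" for \<tau> using F(3)[OF that] by (simp add: facial_compact compact_imp_closed)
  have flat: "N \<tau> \<bullet> (x - y) = 0" if "\<tau> \<in> F" "x \<in> \<tau>" "y \<in> \<tau>" for \<tau> x y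
    using N[OF that(1)] that(2,3) by (simp add: outward_unit_normal_def)
  have n1: "norm (N \<tau>) = 1" if "\<tau> \<in> F" for \<tau> using N[OF that] by (simp add: outward_unit_normal_def)
  have cp: "compact (prism w \<tau>)" if "\<tau> \<in> F" for \<tau> w by (intro compact_prism facial_compact F that)
  have fr: "negligible (frontier K)"
    unfolding oK(3)
  proof (rule negligible_Union)
    show "finite F" by (rule F)
    show "negligible \<tau>" if "\<tau> \<in> F" for \<tau>
      by (rule negligible_aff_lowdim) (use F(3)[OF that] in \<open>simp add: facial_def\<close>)
  qed
  \<comment> \<open>The exceptional starting points, in turn: an end of the segment on the frontier,
    a crossing of a face parallel to \<open>v\<close>, a crossing of two faces at once, a crossing
    through the relative boundary of a face.\<close>
  let ?N1 = "frontier K \<union> (+) (- v) ` frontier K"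
  let ?N2 = "\<Union>\<tau>\<in>{\<tau>\<in>F. N \<tau> \<bullet> v = 0}. prism (- v) \<tau>"
  let ?N3 = "\<Union>\<tau>\<in>F. \<Union>\<tau>'\<in>F - {\<tau>}. prism (- v) (\<tau> \<inter> \<tau>')"
  let ?N4 = "\<Union>\<tau>\<in>F. prism (- v) (\<tau> - rel_interior \<tau>)"
  have "negligible ?N1" by (intro negligible_Un negligible_translation fr)
  moreover have "negligible ?N2"
  proof (intro negligible_finite_UN)
    show "negligible (prism (- v) \<tau>)" if "\<tau> \<in> {\<tau>\<in>F. N \<tau> \<bullet> v = 0}" for \<tau>
    proof -
      have "measure lebesgue (prism (- v) \<tau>) = 0"
      proof -
        have t: "\<tau> \<in> F" "N \<tau> \<bullet> v = 0" using that by auto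
        show ?thesis
          using measure_prism[OF d n1[OF t(1)] facial_compact[OF F(3)[OF t(1)]] flat[OF t(1)]] t(2) by simp
      qed
      then show ?thesis using cp[of \<tau> "- v"] that by (simp add: negligible_iff_measure0 lmeasurable_compact)
    qed
  qed (use F(1) in auto)
  moreover have "negligible ?N3"
    by (intro negligible_finite_UN negligible_prism_lowdim) (use F in auto)
  moreover have "negligible ?N4"
    by (intro negligible_finite_UN negligible_prism_rel_boundary) (use F in auto)
  ultimately have "negligible (?N1 \<union> ?N2 \<union> ?N3 \<union> ?N4)" by (intro negligible_Un[of "_ \<union> _ \<union> _"] negligible_Un[of ?N1] negligible_Un[of "?N1 \<union> _"])
  then have "AE x in lebesgue. x \<notin> ?N1 \<union> ?N2 \<union> ?N3 \<union> ?N4"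
    by (intro AE_not_in) (simp only: negligible_iff_null_sets)
  then have "AE x in lborel. x \<notin> ?N1 \<union> ?N2 \<union> ?N3 \<union> ?N4" by (simp only: AE_completion_iff)
  then have ae: "AE x in lborel. g x * indicat_real K (x + v) - g x * indicat_real K x
      = - (\<Sum>\<tau>\<in>F. sgn (N \<tau> \<bullet> v) * (indicat_real (prism (- v) \<tau>) x * g x))"
  proof eventually_elim
    case (elim x)
    have "x + v \<notin> frontier K"
    proof
      assume "x + v \<in> frontier K"
      then have "- v + (x + v) \<in> (+) (- v) ` frontier K" by (rule imageI)
      then show False using elim by simp
    qed
    then have "indicat_real K (x + v) - indicat_real K x
        = - (\<Sum>\<tau>\<in>F. sgn (N \<tau> \<bullet> v) * indicat_real (prism (- v) \<tau>) x)"
      by (intro crossing_identity[OF oK(1,3) F(1) cl N]) (use elim in auto)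
    then have "g x * (indicat_real K (x + v) - indicat_real K x)
        = g x * (- (\<Sum>\<tau>\<in>F. sgn (N \<tau> \<bullet> v) * indicat_real (prism (- v) \<tau>) x))" by (rule arg_cong)
    then show ?case by (simp add: right_diff_distrib sum_distrib_left mult_ac)
  qed
  have intp: "integrable lborel (\<lambda>x. indicat_real (prism (- v) \<tau>) x * g x)" if "\<tau> \<in> F" for \<tau>
    using borel_integrable_compact[OF cp[OF that] continuous_on_subset[OF g subset_UNIV]] by simp
  note t = integral_translate_set[OF oK(1,2) g]
  have i0: "integrable lborel (\<lambda>x. g x * indicat_real K x)"
    "(LINT x|lborel. g x * indicat_real K x) = (LINT x|lborel. indicat_real K x * g x)"
    using t[of 0] by simp_all
  have "(LINT x:K|lborel. g (x - v)) - (LINT x:K|lborel. g x)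
    = (LINT x|lborel. g x * indicat_real K (x + v) - g x * indicat_real K x)"
    unfolding Bochner_Integration.integral_diff[OF t(1) i0(1)] t(2) i0(2) by (simp add: set_lebesgue_integral_def)
  also have "\<dots> = (LINT x|lborel. - (\<Sum>\<tau>\<in>F. sgn (N \<tau> \<bullet> v) * (indicat_real (prism (- v) \<tau>) x * g x)))"
  proof (rule integral_cong_AE[OF _ _ ae])
    show "(\<lambda>x. g x * indicat_real K (x + v) - g x * indicat_real K x) \<in> borel_measurable lborel"
      using t(1) i0(1) by (intro borel_measurable_integrable Bochner_Integration.integrable_diff)
    show "(\<lambda>x. - (\<Sum>\<tau>\<in>F. sgn (N \<tau> \<bullet> v) * (indicat_real (prism (- v) \<tau>) x * g x))) \<in> borel_measurable lborel"
      by (intro borel_measurable_uminus borel_measurable_sum borel_measurable_times borel_measurable_const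
          borel_measurable_integrable[OF intp])
  qed
  also have "\<dots> = - (\<Sum>\<tau>\<in>F. sgn (N \<tau> \<bullet> v) * (LINT x|lborel. indicat_real (prism (- v) \<tau>) x * g x))"
    using intp by simp
  finally show ?thesis by (simp add: set_lebesgue_integral_def)
qed

section \<open>Meshes and their dual cells\<close>

definition cells_of :: "('d::finite) mesh \<Rightarrow> (real^'d) set \<Rightarrow> (real^'d) set set" where
  "cells_of M \<sigma> = {K \<in> cells M. \<sigma> \<in> faces M K}"

text \<open>A surrounding cube in place of the ball keeps constants elementary. The powers
  \<open>2 ^ d\<close> and \<open>4 ^ d\<close> in later constants come from here.\<close>

lemma measure_le_cube:
  fixes S :: "(real^'d) set"
  assumes "S \<in> lmeasurable" "S \<subseteq> cball x r" "r \<ge> 0"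
  shows "measure lebesgue S \<le> (2 * r) ^ CARD('d)"
proof -
  let ?B = "cbox (x - (\<chi> i. r)) (x + (\<chi> i. r))"
  have "S \<subseteq> ?B"
  proof
    fix y assume "y \<in> S"
    then have "norm (y - x) \<le> r" using assms(2) by (auto simp: dist_norm norm_minus_commute)
    then have "\<bar>y $ i - x $ i\<bar> \<le> r" for i using component_le_norm_cart[of "y - x" i] by simp
    then show "y \<in> ?B" by (simp add: mem_box_cart abs_le_iff) (smt (verit))
  qed
  then have "measure lebesgue S \<le> measure lebesgue ?B"
    using assms(1) by (intro measure_mono_fmeasurable) auto
  also have "measure lebesgue ?B = (2 * r) ^ CARD('d)"
    using assms(3) by (subst measure_completion) (auto simp: content_cbox_cart interval_eq_empty_cart)
  finally show ?thesis .
qed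

text \<open>By dimension, the affine hull of \<open>\<sigma>\<close> is the full hyperplane through
  \<open>a\<close> with normal \<open>m\<close>, and equally the one with normal
  \<open>n\<close>.\<close>

lemma parallel_unit_vectors:
  fixes m n :: "real^'d"
  assumes "facial \<sigma>" "norm m = 1" "norm n = 1"
    "\<And>x y. x \<in> \<sigma> \<Longrightarrow> y \<in> \<sigma> \<Longrightarrow> m \<bullet> (x - y) = 0" "\<And>x y. x \<in> \<sigma> \<Longrightarrow> y \<in> \<sigma> \<Longrightarrow> n \<bullet> (x - y) = 0"
  shows "m = n \<or> m = - n"
proof -
  have dim: "aff_dim \<sigma> = int CARD('d) - 1" using assms(1) by (simp add: facial_def)
  obtain a where a: "a \<in> \<sigma>" using facial_rel_interior_nonempty[OF assms(1)] rel_interior_subset by blast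
  have hyp: "affine hull \<sigma> = {x. k \<bullet> x = k \<bullet> a}" if k: "norm k = 1" "\<And>x y. x \<in> \<sigma> \<Longrightarrow> y \<in> \<sigma> \<Longrightarrow> k \<bullet> (x - y) = 0" for k
  proof (rule affine_dim_equal)
    have "\<sigma> \<subseteq> {x. k \<bullet> x = k \<bullet> a}" using k(2)[OF _ a] by (auto simp: inner_diff_right)
    then show "affine hull \<sigma> \<subseteq> {x. k \<bullet> x = k \<bullet> a}" by (rule hull_minimal) (rule affine_hyperplane)
    show "aff_dim (affine hull \<sigma>) = aff_dim {x. k \<bullet> x = k \<bullet> a}"
      using k(1) dim by (subst aff_dim_hyperplane) auto
  qed (use a in \<open>auto simp: affine_hyperplane\<close>)
  \<comment> \<open>The part of \<open>m\<close> orthogonal to \<open>n\<close> is a direction of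
    the hyperplane, hence orthogonal to \<open>m\<close> as well; this forces
    \<open>m \<bullet> n\<close> to be 1 or -1.\<close>
  have "n \<bullet> (m - (m \<bullet> n) *\<^sub>R n) = 0" using assms(3) by (simp add: inner_diff_right norm_eq_1 inner_commute)
  then have "a + (m - (m \<bullet> n) *\<^sub>R n) \<in> affine hull \<sigma>"
    by (subst hyp[OF assms(3,5)]) (simp_all add: inner_add_right)
  then have "a + (m - (m \<bullet> n) *\<^sub>R n) \<in> {x. m \<bullet> x = m \<bullet> a}"
    by (subst (asm) hyp[OF assms(2,4)])
  then have "m \<bullet> (m - (m \<bullet> n) *\<^sub>R n) = 0" by (simp add: inner_add_right)
  then have "(m \<bullet> n)\<^sup>2 = 1" using assms(2) by (simp add: inner_diff_right norm_eq_1 power2_eq_square)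
  then consider "m \<bullet> n = 1" | "m \<bullet> n = -1" using power2_eq_1_iff by blast
  then show ?thesis
  proof cases
    case 1
    then have "(m - n) \<bullet> (m - n) = 0" using assms(2,3) by (simp add: inner_simps norm_eq_1 inner_commute)
    then show ?thesis by simp
  next
    case 2
    then have "(m + n) \<bullet> (m + n) = 0" using assms(2,3) by (simp add: inner_simps norm_eq_1 inner_commute)
    then have "m + n = 0" by simp
    then show ?thesis by (simp add: eq_neg_iff_add_eq_0)
  qed
qed

locale adm_mesh =
  fixes \<Omega> :: "(real^'d) set" and M :: "'d mesh"
  assumes d: "CARD('d) \<in> {2, 3}" and adm: "admissible_mesh \<Omega> M"
    and open_\<Omega>: "open \<Omega>" and bounded_\<Omega>: "bounded \<Omega>"
begin

abbreviation vol :: "(real^'d) set \<Rightarrow> real" where "vol \<equiv> measure lebesgue"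

abbreviation area :: "(real^'d) set \<Rightarrow> (real^'d) set \<Rightarrow> real" where
  "area K \<sigma> \<equiv> face_measure (normal M K \<sigma>) \<sigma>"

lemma pm: "primal_mesh \<Omega> M" and dm: "dual_mesh M"
  using adm by (auto simp: admissible_mesh_def)

lemma finite_cells: "finite (cells M)" using pm by (simp add: primal_mesh_def)

lemma disjoint_cells: "K \<in> cells M \<Longrightarrow> L \<in> cells M \<Longrightarrow> K \<noteq> L \<Longrightarrow> K \<inter> L = {}"
  using pm unfolding primal_mesh_def pairwise_def disjnt_def by blast

lemma cell:
  assumes "K \<in> cells M"
  shows "K \<subseteq> \<Omega>" "is_cell K (faces M K)" "open K" "bounded K" "frontier K = \<Union>(faces M K)"
    "finite (faces M K)" "faces M K \<noteq> {}"
proof -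
  show 1: "K \<subseteq> \<Omega>" "is_cell K (faces M K)" using assms pm by (auto simp: primal_mesh_def)
  show "open K" "bounded K" "frontier K = \<Union>(faces M K)" using 1(2) by (simp_all only: is_cell_def)
  show "finite (faces M K)" "faces M K \<noteq> {}" using is_cell_faces[OF d 1(2)] by auto
qed

lemma outward: "K \<in> cells M \<Longrightarrow> \<sigma> \<in> faces M K \<Longrightarrow> outward_unit_normal K \<sigma> (normal M K \<sigma>)"
  using pm by (auto simp: primal_mesh_def)

lemma facial: "K \<in> cells M \<Longrightarrow> \<sigma> \<in> faces M K \<Longrightarrow> facial \<sigma>"
  using is_cell_faces(3)[OF d cell(2)] by blast

lemma norm_normal: "K \<in> cells M \<Longrightarrow> \<sigma> \<in> faces M K \<Longrightarrow> norm (normal M K \<sigma>) = 1"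
  using outward by (auto simp: outward_unit_normal_def)

lemma normal_flat: "K \<in> cells M \<Longrightarrow> \<sigma> \<in> faces M K \<Longrightarrow> x \<in> \<sigma> \<Longrightarrow> y \<in> \<sigma> \<Longrightarrow> normal M K \<sigma> \<bullet> (x - y) = 0"
  using outward unfolding outward_unit_normal_def by blast

lemma face_nonempty: "K \<in> cells M \<Longrightarrow> \<sigma> \<in> faces M K \<Longrightarrow> \<sigma> \<noteq> {}"
  using facial_rel_interior_nonempty[OF facial] rel_interior_subset by blast

lemma face_subset: "K \<in> cells M \<Longrightarrow> \<sigma> \<in> faces M K \<Longrightarrow> \<sigma> \<subseteq> closure K"
  using cell(5) by (fastforce simp: frontier_def)

lemma measure_prism_face:
  assumes "K \<in> cells M" "\<sigma> \<in> faces M K"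
  shows "vol (prism v \<sigma>) = \<bar>normal M K \<sigma> \<bullet> v\<bar> * area K \<sigma>"
  by (rule measure_prism[OF d norm_normal[OF assms] facial_compact[OF facial[OF assms]] normal_flat[OF assms]])

lemma area_nonneg: "area K \<sigma> \<ge> 0"
  by (simp add: face_measure_def)

lemma normal_inside:
  assumes "K \<in> cells M" "\<sigma> \<in> faces M K" "x \<in> rel_interior \<sigma>"
  shows "\<forall>\<^sub>F s in at_right 0. x - s *\<^sub>R normal M K \<sigma> \<in> K"
  using outward[OF assms(1,2)] assms(3) unfolding outward_unit_normal_def by (auto elim: eventually_mono)

lemma cell_nonempty: assumes "K \<in> cells M" shows "K \<noteq> {}"
  using cell(5,7)[OF assms] face_nonempty[OF assms] by (metis Union_empty_conv frontier_empty ex_in_conv)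

lemma cell_lmeasurable: "K \<in> cells M \<Longrightarrow> K \<in> lmeasurable"
  using cell by (intro lmeasurable_open) auto

lemma vol_pos: assumes "K \<in> cells M" shows "vol K > 0"
proof -
  have "\<not> negligible K" by (rule open_not_negligible[OF cell(3)[OF assms] cell_nonempty[OF assms]])
  then have "vol K \<noteq> 0" using cell_lmeasurable[OF assms] negligible_iff_measure0 by blast
  then show ?thesis by (simp add: zero_less_measure_iff)
qed

text \<open>The normals are parallel unit vectors. If they were equal, points slightly behind the
  face would lie in both of two disjoint cells.\<close>

lemma normal_opposite:
  assumes K: "K \<in> cells M" "\<sigma> \<in> faces M K" and L: "L \<in> cells M" "\<sigma> \<in> faces M L" and "K \<noteq> L"
  shows "normal M L \<sigma> = - normal M K \<sigma>"
proof -
  obtain x where x: "x \<in> rel_interior \<sigma>" using facial_rel_interior_nonempty[OF facial[OF K]] by blast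
  have "normal M L \<sigma> \<noteq> normal M K \<sigma>"
  proof
    assume eq: "normal M L \<sigma> = normal M K \<sigma>"
    have "\<forall>\<^sub>F s in at_right 0. x - s *\<^sub>R normal M K \<sigma> \<in> K \<and> x - s *\<^sub>R normal M K \<sigma> \<in> L"
      using normal_inside[OF K x] normal_inside[OF L x] unfolding eq by (rule eventually_conj)
    then obtain s :: real where "x - s *\<^sub>R normal M K \<sigma> \<in> K \<inter> L"
      by (metis (mono_tags, lifting) IntI eventually_happens trivial_limit_at_right_real)
    then show False using disjoint_cells[OF K(1) L(1)] assms(5) by blast
  qed
  then show ?thesis
    using parallel_unit_vectors[OF facial[OF K] norm_normal[OF L] norm_normal[OF K] normal_flat[OF L] normal_flat[OF K]]
    by blast
qed

text \<open>Three unit vectors cannot be pairwise opposite. The definition of an internal face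
  supplies one pair of cells; this excludes any further cell, so that cancellation in pairs is
  possible.\<close>

lemma three_cells:
  assumes "K \<in> cells M" "\<sigma> \<in> faces M K" "L \<in> cells M" "\<sigma> \<in> faces M L" "P \<in> cells M" "\<sigma> \<in> faces M P"
  shows "K = L \<or> L = P \<or> K = P"
proof (rule ccontr)
  assume "\<not> ?thesis"
  then have "normal M L \<sigma> = - normal M K \<sigma>" "normal M P \<sigma> = - normal M L \<sigma>" "normal M P \<sigma> = - normal M K \<sigma>"
    using normal_opposite assms by metis+
  then have "normal M K \<sigma> = - normal M K \<sigma>" by simp
  then have "normal M K \<sigma> = 0" by (simp add: vec_eq_iff)
  then show False using norm_normal[OF assms(1,2)] by simp
qed

lemma internal_face:
  assumes "\<sigma> \<in> internal_faces M"
  obtains K L where "cells_of M \<sigma> = {K, L}" "interface M K L \<sigma>" "K \<noteq> L"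
proof -
  obtain K L where KL: "interface M K L \<sigma>" using assms by (auto simp: internal_faces_def)
  then have "cells_of M \<sigma> = {K, L}"
    using three_cells[of K \<sigma> L] unfolding cells_of_def interface_def by blast
  then show thesis using that KL by (auto simp: interface_def)
qed

lemma internal_interface:
  assumes "\<sigma> \<in> internal_faces M" "K \<in> cells_of M \<sigma>" "L \<in> cells_of M \<sigma>" "K \<noteq> L"
  shows "interface M K L \<sigma>"
proof -
  obtain P Q where "cells_of M \<sigma> = {P, Q}" "interface M P Q \<sigma>" using internal_face[OF assms(1)] .
  then show ?thesis using assms unfolding interface_def by auto
qed

lemma not_internal_face: "\<sigma> \<in> all_faces M \<Longrightarrow> \<sigma> \<notin> internal_faces M \<Longrightarrow> \<sigma> \<subseteq> frontier \<Omega>"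
  using pm by (auto simp: primal_mesh_def external_faces_def)

lemma finite_all_faces: "finite (all_faces M)"
  using finite_cells cell(6) by (auto simp: all_faces_def)

lemma finite_cells_of: "finite (cells_of M \<sigma>)" using finite_cells by (simp add: cells_of_def)

lemma dist_cell_closure: 
  assumes "K \<in> cells M" "x \<in> closure K" "y \<in> closure K" shows "dist x y \<le> diameter K"
  using diameter_bounded_bound[OF bounded_closure[OF cell(4)[OF assms(1)]] assms(2,3)]
  by (simp add: diameter_closure[OF cell(4)[OF assms(1)]])

lemma diameter_pos: assumes "K \<in> cells M" shows "diameter K > 0"
proof (rule ccontr)
  assume "\<not> diameter K > 0"
  then have "diameter K = 0" using diameter_ge_0[OF cell(4)[OF assms]] by linarith
  obtain x where x: "x \<in> K" using cell_nonempty[OF assms] by blast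
  have "K \<subseteq> {x}" using dist_cell_closure[OF assms] x closure_subset[of K] \<open>diameter K = 0\<close>
    by (metis dist_le_zero_iff singletonI subset_iff)
  then have "vol K = 0" using negligible_imp_measure0 negligible_sing negligible_subset by metis
  then show False using vol_pos[OF assms] by simp
qed

lemma diameter_le_mesh_size: "K \<in> cells M \<Longrightarrow> diameter K \<le> mesh_size M"
  using finite_cells by (simp add: mesh_size_def)

lemma vol_le: assumes "K \<in> cells M" shows "vol K \<le> (2 * diameter K) ^ CARD('d)"
proof -
  obtain x where x: "x \<in> K" using cell_nonempty[OF assms] by blast
  show ?thesis
    by (rule measure_le_cube[OF cell_lmeasurable[OF assms], of x])
      (use x dist_cell_closure[OF assms subsetD[OF closure_subset] subsetD[OF closure_subset], of x]
        diameter_pos[OF assms] in \<open>auto simp: less_imp_le\<close>)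
qed

text \<open>The prism over the face whose height is the diameter fits into a ball of twice that
  radius; its volume divided by its height is the area.\<close>

lemma area_le: assumes K: "K \<in> cells M" "\<sigma> \<in> faces M K"
  shows "area K \<sigma> \<le> 4 ^ CARD('d) * diameter K ^ (CARD('d) - 1)"
proof -
  let ?h = "diameter K" and ?n = "normal M K \<sigma>"
  have h: "?h > 0" by (rule diameter_pos[OF K(1)])
  obtain p where p: "p \<in> \<sigma>" using face_nonempty[OF K] by blast
  have "prism (?h *\<^sub>R ?n) \<sigma> \<subseteq> cball p (2 * ?h)"
  proof
    fix z assume "z \<in> prism (?h *\<^sub>R ?n) \<sigma>"
    then obtain y s where y: "y \<in> \<sigma>" "0 \<le> s" "s \<le> 1" "z = y + s *\<^sub>R ?h *\<^sub>R ?n" unfolding prism_def by blast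
    have "dist p y \<le> ?h" using dist_cell_closure[OF K(1)] face_subset[OF K] p y(1) by blast
    moreover have "dist y z \<le> ?h" using y h norm_normal[OF K] by (simp add: dist_norm mult_left_le_one_le)
    ultimately show "z \<in> cball p (2 * ?h)" using dist_triangle[of p z y] by simp
  qed
  then have "vol (prism (?h *\<^sub>R ?n) \<sigma>) \<le> (2 * (2 * ?h)) ^ CARD('d)"
    using h facial_compact[OF facial[OF K]] by (intro measure_le_cube lmeasurable_compact compact_prism) auto
  moreover have "vol (prism (?h *\<^sub>R ?n) \<sigma>) = ?h * area K \<sigma>"
    using measure_prism_face[OF K, of "?h *\<^sub>R ?n"] norm_normal[OF K] h by (simp add: norm_eq_1)
  moreover have "(2 * (2 * ?h)) ^ CARD('d) = ?h * (4 ^ CARD('d) * ?h ^ (CARD('d) - 1))"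
    using d by (auto simp: power_mult_distrib power2_eq_square power3_eq_cube)
  ultimately show ?thesis using h by simp
qed

lemma area_uminus: assumes "K \<in> cells M" "\<sigma> \<in> faces M K" "L \<in> cells M" "\<sigma> \<in> faces M L"
  shows "area L \<sigma> = area K \<sigma>"
  using normal_opposite[OF assms] face_measure_uminus[OF d norm_normal[OF assms(1,2)] facial_compact[OF facial[OF assms(1,2)]]
    normal_flat[OF assms(1,2)]] by (cases "K = L") auto

lemma half_diamond:
  assumes "K \<in> cells M" "\<sigma> \<in> faces M K"
  shows "half_diamond M K \<sigma> \<in> lmeasurable" "half_diamond M K \<sigma> \<subseteq> K"
    "vol (half_diamond M K \<sigma>) = vol K / real (card (faces M K))" "vol (half_diamond M K \<sigma>) > 0"
proof -
  show sub: "half_diamond M K \<sigma> \<subseteq> K" and m: "vol (half_diamond M K \<sigma>) = vol K / real (card (faces M K))"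
    and "half_diamond M K \<sigma> \<in> lmeasurable"
    using dm assms cell_lmeasurable[OF assms(1)] unfolding dual_mesh_def
    by (auto intro: fmeasurableI2)
  show "vol (half_diamond M K \<sigma>) > 0"
    unfolding m using vol_pos[OF assms(1)] cell(6,7)[OF assms(1)] by (simp add: card_gt_0_iff)
qed

lemma half_diamond_disjoint:
  assumes "K \<in> cells M" "\<sigma> \<in> faces M K" "L \<in> cells M" "\<tau> \<in> faces M L" "(K, \<sigma>) \<noteq> (L, \<tau>)"
  shows "half_diamond M K \<sigma> \<inter> half_diamond M L \<tau> = {}"
proof (cases "K = L")
  case True
  then show ?thesis using dm assms unfolding dual_mesh_def disjoint_family_on_def by blast
next
  case False
  then show ?thesis using disjoint_cells half_diamond(2) assms by blast
qed

lemma sum_half_diamond: assumes "K \<in> cells M" shows "(\<Sum>\<sigma>\<in>faces M K. vol (half_diamond M K \<sigma>)) = vol K"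
  using half_diamond(3)[OF assms] cell(6,7)[OF assms] by simp

lemma dual_cell_eq: "dual_cell M \<sigma> = (\<Union>K\<in>cells_of M \<sigma>. half_diamond M K \<sigma>)"
  by (simp add: dual_cell_def cells_of_def)

lemma dual_cell_lmeasurable: "dual_cell M \<sigma> \<in> lmeasurable"
  unfolding dual_cell_eq using finite_cells_of half_diamond(1)
  by (intro fmeasurable.finite_UN) (auto simp: cells_of_def)

lemma vol_dual_cell: "vol (dual_cell M \<sigma>) = (\<Sum>K\<in>cells_of M \<sigma>. vol (half_diamond M K \<sigma>))"
  unfolding dual_cell_eq
proof (rule measure_finite_Union[OF finite_cells_of])
  show "(\<lambda>K. half_diamond M K \<sigma>) ` cells_of M \<sigma> \<subseteq> sets lebesgue"
    using half_diamond(1) by (auto simp: cells_of_def fmeasurable_def)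
  show "disjoint_family_on (\<lambda>K. half_diamond M K \<sigma>) (cells_of M \<sigma>)"
    using half_diamond_disjoint unfolding disjoint_family_on_def cells_of_def by blast
  show "emeasure lebesgue (half_diamond M K \<sigma>) \<noteq> \<infinity>" if "K \<in> cells_of M \<sigma>" for K
    using half_diamond(1)[of K \<sigma>] that unfolding cells_of_def by (auto simp: fmeasurable_def less_top[symmetric])
qed

lemma cells_of_nonempty: "\<sigma> \<in> all_faces M \<Longrightarrow> cells_of M \<sigma> \<noteq> {}"
  by (auto simp: all_faces_def cells_of_def)

lemma vol_dual_cell_pos: "\<sigma> \<in> all_faces M \<Longrightarrow> vol (dual_cell M \<sigma>) > 0"
  unfolding vol_dual_cell using half_diamond(4) cells_of_nonempty finite_cells_of
  by (intro sum_pos) (auto simp: cells_of_def)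

lemma dual_cell_disjoint: "\<sigma> \<noteq> \<tau> \<Longrightarrow> dual_cell M \<sigma> \<inter> dual_cell M \<tau> = {}"
  unfolding dual_cell_eq cells_of_def using half_diamond_disjoint[of _ \<sigma> _ \<tau>] by blast

lemma dual_cell_subset: "dual_cell M \<sigma> \<subseteq> \<Omega>"
  unfolding dual_cell_eq cells_of_def using half_diamond(2) cell(1) by blast

text \<open>A point of \<open>\<sigma>\<close> belongs to the closures of all cells at
  \<open>\<sigma>\<close> and links \<open>x\<close> to \<open>y\<close>. Only diameters enter,
  since the shape of the half-diamonds is unknown.\<close>

lemma dist_dual_cell:
  assumes "K \<in> cells_of M \<sigma>" "x \<in> closure K" "y \<in> dual_cell M \<sigma>"
  obtains L where "L \<in> cells_of M \<sigma>" "dist x y \<le> diameter K + diameter L"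
proof -
  obtain L where L: "L \<in> cells_of M \<sigma>" "y \<in> L"
    using assms(3) half_diamond(2) unfolding dual_cell_eq cells_of_def by blast
  have KL: "K \<in> cells M" "\<sigma> \<in> faces M K" "L \<in> cells M" "\<sigma> \<in> faces M L" using assms(1) L by (auto simp: cells_of_def)
  obtain p where p: "p \<in> \<sigma>" using face_nonempty KL by blast
  have "dist x p \<le> diameter K" "dist p y \<le> diameter L"
    using dist_cell_closure KL assms(2) face_subset p L(2) closure_subset by blast+
  then show thesis using that[OF L(1)] dist_triangle[of x y p] by linarith
qed

text \<open>The passage between the dual mesh, where the operator is defined, and the cells, where
  (H1) and the divergence theorem hold.\<close>

lemma sum_all_faces:
  fixes f :: "(real^'d) set \<Rightarrow> (real^'d) set \<Rightarrow> real"
  shows "(\<Sum>\<sigma>\<in>all_faces M. \<Sum>K\<in>cells_of M \<sigma>. f K \<sigma>) = (\<Sum>K\<in>cells M. \<Sum>\<sigma>\<in>faces M K. f K \<sigma>)"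
proof -
  have "(\<Sum>\<sigma>\<in>all_faces M. \<Sum>K\<in>cells_of M \<sigma>. f K \<sigma>) = (\<Sum>K\<in>cells M. \<Sum>\<sigma>\<in>{\<sigma>\<in>all_faces M. \<sigma> \<in> faces M K}. f K \<sigma>)"
    unfolding cells_of_def by (rule sum.swap_restrict[OF finite_all_faces finite_cells])
  also have "\<dots> = (\<Sum>K\<in>cells M. \<Sum>\<sigma>\<in>faces M K. f K \<sigma>)"
    by (intro sum.cong) (auto simp: all_faces_def)
  finally show ?thesis .
qed

lemma dual_faces_eq:
  assumes "K \<in> cells M" "\<sigma> \<in> faces M K"
  shows "{\<epsilon>\<in>dual_faces M \<sigma>. fst \<epsilon> = K} = (\<lambda>\<tau>. (K, {\<sigma>, \<tau>})) ` {\<tau>\<in>faces M K. \<sigma> \<noteq> \<tau> \<and> share_ridge \<sigma> \<tau>}"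
  using assms by (auto simp: dual_faces_def)

text \<open>The dual faces of \<open>\<sigma>\<close> in \<open>K\<close> are indexed by the second
  face. Summed over \<open>\<sigma>\<close> this becomes a sum over ordered pairs of faces, in which
  (H2) reads as antisymmetry.\<close>

lemma sum_dual_faces_cell:
  fixes f :: "'d dual_face \<Rightarrow> real"
  assumes "K \<in> cells M" "\<sigma> \<in> faces M K"
  shows "(\<Sum>\<epsilon>\<in>{\<epsilon>\<in>dual_faces M \<sigma>. fst \<epsilon> = K}. f \<epsilon>)
    = (\<Sum>\<tau>\<in>faces M K. if \<sigma> \<noteq> \<tau> \<and> share_ridge \<sigma> \<tau> then f (K, {\<sigma>, \<tau>}) else 0)"
proof -
  have "inj_on (\<lambda>\<tau>. (K, {\<sigma>, \<tau>})) {\<tau>\<in>faces M K. \<sigma> \<noteq> \<tau> \<and> share_ridge \<sigma> \<tau>}"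
    by (auto simp: inj_on_def doubleton_eq_iff)
  then show ?thesis unfolding dual_faces_eq[OF assms]
    by (simp add: sum.reindex sum.inter_filter cell(6)[OF assms(1)])
qed

lemma sum_dual_faces:
  fixes f :: "'d dual_face \<Rightarrow> real"
  shows "(\<Sum>\<epsilon>\<in>dual_faces M \<sigma>. f \<epsilon>) = (\<Sum>K\<in>cells_of M \<sigma>. \<Sum>\<epsilon>\<in>{\<epsilon>\<in>dual_faces M \<sigma>. fst \<epsilon> = K}. f \<epsilon>)"
proof -
  have un: "dual_faces M \<sigma> = (\<Union>K\<in>cells_of M \<sigma>. {\<epsilon>\<in>dual_faces M \<sigma>. fst \<epsilon> = K})"
    by (auto simp: dual_faces_def cells_of_def)
  have fin: "finite {\<epsilon>\<in>dual_faces M \<sigma>. fst \<epsilon> = K}" if "K \<in> cells_of M \<sigma>" for K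
    using that cell(6) by (subst dual_faces_eq) (auto simp: cells_of_def)
  show ?thesis
    by (subst un, subst sum.UNION_disjoint) (use fin finite_cells_of in auto)
qed

end

section \<open>Consistency of the convection fluxes at one time level\<close>

lemma set_integrable_continuous:
  fixes f :: "'a::euclidean_space \<Rightarrow> real"
  assumes "S \<in> sets lebesgue" "bounded S" "continuous_on UNIV f"
  shows "set_integrable lebesgue S f"
proof -
  have "set_integrable lborel (closure S) f"
    unfolding set_integrable_def
    by (rule borel_integrable_compact) (use assms continuous_on_subset in auto)
  then have "set_integrable lebesgue (closure S) f"
    unfolding set_integrable_def by (subst integrable_completion) auto
  then show ?thesis by (rule set_integrable_subset) (use assms closure_subset in auto)
qed

lemma set_integral_lebesgue_lborel:
  fixes f :: "'a::euclidean_space \<Rightarrow> real"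
  assumes "S \<in> sets borel" "continuous_on UNIV f"
  shows "(LINT x:S|lebesgue. f x) = (LINT x:S|lborel. f x)"
proof -
  have [measurable]: "f \<in> borel_measurable borel" "S \<in> sets borel"
    using assms borel_measurable_continuous_onI by auto
  show ?thesis unfolding set_lebesgue_integral_def by (rule integral_completion) measurable
qed

lemma set_integral_close:
  fixes f :: "'a::euclidean_space \<Rightarrow> real"
  assumes "S \<in> lmeasurable" "set_integrable lebesgue S f" "\<And>y. y \<in> S \<Longrightarrow> \<bar>f y - c\<bar> \<le> \<delta>"
  shows "\<bar>(LINT y:S|lebesgue. f y) - c * measure lebesgue S\<bar> \<le> \<delta> * measure lebesgue S"
proof -
  have c: "set_integrable lebesgue S (\<lambda>_. k)" "(LINT y:S|lebesgue. k) = k * measure lebesgue S" for k :: real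
    using assms(1) by (auto simp: set_integrable_def set_lebesgue_integral_def fmeasurable_def mult.commute)
  have "(LINT y:S|lebesgue. f y) - c * measure lebesgue S = (LINT y:S|lebesgue. f y - c)"
    using set_integral_diff(2)[OF assms(2) c(1)[of c]] c(2) by simp
  also have "\<bar>\<dots>\<bar> \<le> (LINT y:S|lebesgue. \<bar>f y - c\<bar>)"
    using set_integral_norm_bound[OF set_integral_diff(1)[OF assms(2) c(1)[of c]]] by simp
  also have "\<dots> \<le> (LINT y:S|lebesgue. \<delta>)"
    by (rule set_integral_mono) (use assms c set_integrable_abs[OF set_integral_diff(1)[OF assms(2) c(1)[of c]]] in auto)
  finally show ?thesis using c(2) by simp
qed

lemma sum_antisymmetric_eq_0:
  fixes g :: "'a \<Rightarrow> 'a \<Rightarrow> real"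
  assumes "\<And>x y. x \<in> A \<Longrightarrow> y \<in> A \<Longrightarrow> g x y = - g y x"
  shows "(\<Sum>x\<in>A. \<Sum>y\<in>A. g x y) = 0"
proof -
  have "(\<Sum>x\<in>A. \<Sum>y\<in>A. g x y) = (\<Sum>y\<in>A. \<Sum>x\<in>A. g x y)" by (rule sum.swap)
  also have "\<dots> = (\<Sum>y\<in>A. \<Sum>x\<in>A. - g y x)" by (intro sum.cong refl assms)
  finally show ?thesis by (simp add: sum_negf)
qed

lemma closed_segment_dist_le:
  fixes a b c w :: real
  assumes "w \<in> closed_segment a b" shows "\<bar>w - c\<bar> \<le> \<bar>a - c\<bar> + \<bar>b - c\<bar>"
  using assms by (auto simp: closed_segment_eq_real_ivl split: if_splits)

section \<open>Averages over dual cells, and closedness of the boundary of a cell\<close>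

context adm_mesh
begin

definition mean :: "((real^'d) \<Rightarrow> real) \<Rightarrow> (real^'d) set \<Rightarrow> real" where
  "mean f \<sigma> = (1 / vol (dual_cell M \<sigma>)) * (LINT y:dual_cell M \<sigma>|lebesgue. f y)"

lemma mean_close:
  assumes "\<sigma> \<in> all_faces M" "continuous_on UNIV f" "\<And>y. y \<in> dual_cell M \<sigma> \<Longrightarrow> \<bar>f y - c\<bar> \<le> \<delta>"
  shows "\<bar>mean f \<sigma> - c\<bar> \<le> \<delta>"
proof -
  let ?V = "vol (dual_cell M \<sigma>)"
  have V: "?V > 0" by (rule vol_dual_cell_pos[OF assms(1)])
  have "set_integrable lebesgue (dual_cell M \<sigma>) f"
    by (rule set_integrable_continuous)
      (use assms(2) dual_cell_lmeasurable bounded_subset[OF bounded_\<Omega> dual_cell_subset] in \<open>auto simp: fmeasurable_def\<close>)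
  then have "\<bar>(LINT y:dual_cell M \<sigma>|lebesgue. f y) - c * ?V\<bar> \<le> \<delta> * ?V"
    by (rule set_integral_close[OF dual_cell_lmeasurable]) (rule assms(3))
  moreover have "(LINT y:dual_cell M \<sigma>|lebesgue. f y) = mean f \<sigma> * ?V" using V by (simp add: mean_def)
  ultimately have "\<bar>(mean f \<sigma> - c) * ?V\<bar> \<le> \<delta> * ?V" by (simp add: left_diff_distrib)
  then show ?thesis using V by (simp add: abs_mult)
qed

text \<open>The divergence theorem for the constant function 1: a translation does not change its
  integral, and each prism contributes area times the component of the normal.\<close>

lemma sum_area_normal:
  assumes "K \<in> cells M" shows "(\<Sum>\<sigma>\<in>faces M K. area K \<sigma> * normal M K \<sigma> $ j) = 0"
proof -
  have p: "(LINT x:prism (- axis j 1) \<sigma>|lborel. 1) = \<bar>normal M K \<sigma> $ j\<bar> * area K \<sigma>" if "\<sigma> \<in> faces M K" for \<sigma>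
  proof -
    have c: "compact (prism (- axis j 1) \<sigma>)" by (intro compact_prism facial_compact facial[OF assms that])
    have "(LINT x:prism (- axis j 1) \<sigma>|lborel. 1) = measure lborel (prism (- axis j 1) \<sigma>)"
      using c by (simp add: set_lebesgue_integral_def)
    also have "\<dots> = vol (prism (- axis j 1) \<sigma>)" using c by (simp add: borel_compact)
    finally show ?thesis using measure_prism_face[OF assms that] by (simp add: inner_axis)
  qed
  have "0 = - (\<Sum>\<sigma>\<in>faces M K. sgn (normal M K \<sigma> \<bullet> axis j 1) * (LINT x:prism (- axis j 1) \<sigma>|lborel. 1))"
    using cell_divergence[OF d cell(2)[OF assms] outward[OF assms], of "\<lambda>_. 1" "axis j 1"] by simp
  also have "\<dots> = - (\<Sum>\<sigma>\<in>faces M K. area K \<sigma> * normal M K \<sigma> $ j)"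
  proof -
    have "sgn (normal M K \<sigma> \<bullet> axis j 1) * (LINT x:prism (- axis j 1) \<sigma>|lborel. 1) = area K \<sigma> * normal M K \<sigma> $ j"
      if "\<sigma> \<in> faces M K" for \<sigma>
      using sgn_mult_abs[of "normal M K \<sigma> $ j"] by (simp add: p[OF that] inner_axis mult.commute mult.assoc flip: mult.left_commute)
    then show ?thesis by simp
  qed
  finally show ?thesis by simp
qed

end

text \<open>The data at one time level. \<open>r\<close> and \<open>U\<close> stand for the
  continuous approximations, \<open>xc\<close> samples one point in each cell, \<open>G\<close> is
  the gradient of \<open>\<phi>\<close>, and \<open>\<omega>\<close> is the accuracy in
  \<open>grad\<close> and \<open>modulus\<close>. The gradient is only seen through difference
  quotients of the common length \<open>s\<close>, matching the translation in
  \<open>cell_divergence\<close>. The distance \<open>2 * mesh_size M\<close> in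
  \<open>vanish\<close> reaches across two cells at a common face, or across a cell and a shift by
  \<open>s\<close>.\<close>

locale level = adm_mesh \<Omega> M for \<Omega> :: "(real^'d) set" and M :: "'d mesh" +
  fixes S :: "'d scheme" and n :: nat and i :: 'd and B \<theta> C \<omega> \<Lambda> s N :: real
    and \<phi> :: "real^'d \<Rightarrow> real" and G :: "real^'d \<Rightarrow> real^'d"
    and r :: "real^'d \<Rightarrow> real" and U :: "real^'d \<Rightarrow> real^'d" and xc :: "(real^'d) set \<Rightarrow> real^'d"
  assumes n: "n \<le> steps S" and pf: "primal_fluxes M S" and H1: "H1 M S" and H2: "H2 M S"
    and H3: "H3 C M S" and dv: "dual_velocities M S"
    and nonneg: "B \<ge> 0" "C \<ge> 0" "\<omega> \<ge> 0" "\<Lambda> \<ge> 0" and \<theta>: "\<theta> \<ge> 1" and N: "N \<ge> 0" and s: "s > 0"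
    and density_le: "\<And>K. K \<in> cells M \<Longrightarrow> \<bar>density S n K\<bar> \<le> B"
    and velocity_le: "\<And>\<sigma>. \<sigma> \<in> all_faces M \<Longrightarrow> norm (velocity S n \<sigma>) \<le> B"
    and r_le: "\<And>x. \<bar>r x\<bar> \<le> B" and U_le: "\<And>x. norm (U x) \<le> B"
    and theta1: "\<And>K. K \<in> cells M \<Longrightarrow> diameter K ^ CARD('d) \<le> \<theta> * measure lebesgue K"
    and theta2: "\<And>K L \<sigma>. interface M K L \<sigma> \<Longrightarrow> measure lebesgue K \<le> \<theta> * measure lebesgue L"
    and card_le: "\<And>K. K \<in> cells M \<Longrightarrow> real (card (faces M K)) \<le> N"
    and s_le: "\<And>K. K \<in> cells M \<Longrightarrow> s \<le> diameter K"
    and xc: "\<And>K. K \<in> cells M \<Longrightarrow> xc K \<in> K"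
    and lip: "\<And>x y. \<bar>\<phi> x - \<phi> y\<bar> \<le> \<Lambda> * dist x y"
    and grad: "\<And>K x j. K \<in> cells M \<Longrightarrow> x \<in> K \<Longrightarrow> \<bar>\<phi> x - \<phi> (x - s *\<^sub>R axis j 1) - s * G (xc K) $ j\<bar> \<le> s * \<omega>"
    and vanish: "\<And>z q. q \<notin> \<Omega> \<Longrightarrow> dist z q \<le> 2 * mesh_size M \<Longrightarrow> \<phi> z = 0"
      "\<And>z q. q \<notin> \<Omega> \<Longrightarrow> dist z q \<le> 2 * mesh_size M \<Longrightarrow> G z = 0"
    and modulus: "\<And>x y. x \<in> closure \<Omega> \<Longrightarrow> y \<in> closure \<Omega> \<Longrightarrow> dist x y \<le> 2 * mesh_size M \<Longrightarrow> \<bar>r x - r y\<bar> \<le> \<omega>"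
      "\<And>x y. x \<in> closure \<Omega> \<Longrightarrow> y \<in> closure \<Omega> \<Longrightarrow> dist x y \<le> 2 * mesh_size M \<Longrightarrow>
        norm ((r x * U x $ i) *\<^sub>R U x - (r y * U y $ i) *\<^sub>R U y) \<le> \<omega>"
begin

text \<open>It need not be small in a given cell, because \<open>r\<close> and \<open>U\<close>
  approximate the limits only in \<open>L\<^sup>1\<close>; its sum weighted by volumes is
  small.\<close>

definition err :: "(real^'d) set \<Rightarrow> real" where
  "err K = \<bar>density S n K - r (xc K)\<bar> + (\<Sum>\<sigma>\<in>faces M K. norm (velocity S n \<sigma> - U (xc K)))"

text \<open>The flux of the \<open>i\<close>-th momentum component, computed from the continuous
  approximations.\<close>

definition W :: "real^'d \<Rightarrow> real^'d" where "W x = (r x * U x $ i) *\<^sub>R U x"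

text \<open>The factor bounds, in units of \<open>diameter K\<close>, the distance from a point of
  \<open>K\<close> to a point of the dual cell of an internal face of \<open>K\<close>; see
  \<open>diameter_neighbour\<close>.\<close>

definition \<Lambda>' :: real where "\<Lambda>' = \<Lambda> * (1 + \<theta> * \<theta> * 2 ^ CARD('d))"

text \<open>The constant in the scaling of area times diameter against volume,
  \<open>area_diameter_le\<close>.\<close>

definition A :: real where "A = 4 ^ CARD('d) * \<theta>"

text \<open>The field \<open>W\<close> varies little between neighbouring cells, whereas \<open>Z\<close>, the error made in replacing
  the exact flux of \<open>\<phi>\<close> through \<open>\<sigma>\<close> by the one of its mean over the dual cell, is only of the order of
  the volume of the cell. It is antisymmetric in the two cells sharing \<open>\<sigma>\<close>, so that it disappears in the
  sum over the cells when \<open>W\<close> is frozen at a point of \<open>\<sigma>\<close>.\<close>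

definition Z :: "(real^'d) set \<Rightarrow> (real^'d) set \<Rightarrow> 'd \<Rightarrow> real" where
  "Z K \<sigma> j = area K \<sigma> * normal M K \<sigma> $ j * mean \<phi> \<sigma>
     - (1 / s) * (sgn (normal M K \<sigma> $ j) * (LINT x:prism (- (s *\<^sub>R axis j 1)) \<sigma>|lborel. \<phi> x))"

text \<open>The share of the dual faces included in \<open>K\<close> in the tested convection sum.
  These shares add up to the whole, since each dual face lies in one cell.\<close>

definition X :: "(real^'d) set \<Rightarrow> real" where
  "X K = (\<Sum>\<sigma>\<in>faces M K. mean \<phi> \<sigma> *
      (\<Sum>\<epsilon>\<in>{\<epsilon>\<in>dual_faces M \<sigma>. fst \<epsilon> = K}. dual_flux S n \<sigma> \<epsilon> * dual_velocity S n \<epsilon> $ i))"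

abbreviation interior_cell :: "(real^'d) set \<Rightarrow> bool" where
  "interior_cell K \<equiv> faces M K \<subseteq> internal_faces M"

lemma cont: "continuous_on UNIV \<phi>"
proof -
  have "\<Lambda>-lipschitz_on UNIV \<phi>" using lip nonneg by (auto simp: lipschitz_on_def dist_real_def)
  then show ?thesis by (rule lipschitz_on_continuous_on)
qed

lemma A_nonneg: "A \<ge> 0" and \<Lambda>'_nonneg: "\<Lambda>' \<ge> 0" and \<Lambda>_le: "2 * \<Lambda> \<le> \<Lambda>'"
proof -
  show "A \<ge> 0" using \<theta> by (simp add: A_def)
  have "1 * 1 \<le> \<theta> * \<theta> * 2 ^ CARD('d)" using \<theta> by (intro mult_mono) (auto simp: mult_ge1_I)
  then show "2 * \<Lambda> \<le> \<Lambda>'" using nonneg(4) mult_left_mono[of 2 "1 + \<theta> * \<theta> * 2 ^ CARD('d)" \<Lambda>]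
    by (simp add: \<Lambda>'_def mult.commute)
  then show "\<Lambda>' \<ge> 0" using nonneg(4) by linarith
qed

lemma err_nonneg: "err K \<ge> 0" unfolding err_def by (intro add_nonneg_nonneg sum_nonneg) auto

lemma face_all: "K \<in> cells M \<Longrightarrow> \<sigma> \<in> faces M K \<Longrightarrow> \<sigma> \<in> all_faces M"
  by (auto simp: all_faces_def)

lemma xc_closure: "K \<in> cells M \<Longrightarrow> xc K \<in> closure K" using xc closure_subset by blast

lemma area_diameter_le: assumes "K \<in> cells M" "\<sigma> \<in> faces M K"
  shows "area K \<sigma> * diameter K \<le> A * vol K"
proof -
  have "area K \<sigma> * diameter K \<le> 4 ^ CARD('d) * diameter K ^ (CARD('d) - 1) * diameter K"
    using area_le[OF assms] diameter_pos[OF assms(1)] by (intro mult_right_mono) auto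
  also have "\<dots> = 4 ^ CARD('d) * diameter K ^ CARD('d)"
    using d by (auto simp: power2_eq_square power3_eq_cube)
  also have "\<dots> \<le> 4 ^ CARD('d) * (\<theta> * vol K)" using theta1[OF assms(1)] by (intro mult_left_mono) auto
  finally show ?thesis by (simp add: A_def mult_ac)
qed

text \<open>Diameters are compared through volumes: \<open>theta1\<close> for \<open>L\<close>,
  \<open>theta2\<close> across the face, and the cube bound for \<open>K\<close>.\<close>

lemma diameter_neighbour:
  assumes "\<sigma> \<in> internal_faces M" "K \<in> cells_of M \<sigma>" "L \<in> cells_of M \<sigma>"
  shows "diameter L \<le> \<theta> * \<theta> * 2 ^ CARD('d) * diameter K"
proof -
  let ?c = "\<theta> * \<theta> * 2 ^ CARD('d)"
  have KL: "K \<in> cells M" "L \<in> cells M" using assms by (auto simp: cells_of_def)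
  have c: "?c \<ge> 1" using \<theta> by (intro mult_ge1_I) auto
  have "vol L \<le> \<theta> * vol K"
  proof (cases "K = L")
    case True then show ?thesis using \<theta> vol_pos[OF KL(1)] by simp
  next
    case False then show ?thesis using theta2 internal_interface[OF assms(1,3,2)] by blast
  qed
  then have "diameter L ^ CARD('d) \<le> \<theta> * (\<theta> * vol K)"
    using theta1[OF KL(2)] \<theta> mult_left_mono[of "vol L" "\<theta> * vol K" \<theta>] by linarith
  also have "\<dots> \<le> \<theta> * (\<theta> * (2 * diameter K) ^ CARD('d))"
    using vol_le[OF KL(1)] \<theta> by (intro mult_left_mono) auto
  also have "\<dots> = ?c * diameter K ^ CARD('d)" by (simp add: power_mult_distrib)
  \<comment> \<open>As \<open>?c \<ge> 1\<close>, the constant may be raised to the power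
    \<open>d\<close>, after which the \<open>d\<close>-th root can be taken.\<close>
  also have "\<dots> \<le> ?c ^ CARD('d) * diameter K ^ CARD('d)"
    using self_le_power[OF c, of "CARD('d)"] diameter_pos[OF KL(1)] by (intro mult_right_mono) auto
  finally have "diameter L ^ CARD('d) \<le> (?c * diameter K) ^ CARD('d)" by (simp add: power_mult_distrib)
  then show ?thesis
    by (rule power_le_imp_le_base[where n="CARD('d) - 1", unfolded Suc_diff_1[OF zero_less_card_finite]])
      (use c diameter_pos[OF KL(1)] in simp)
qed

lemma phi_close:
  assumes K: "K \<in> cells M" "\<sigma> \<in> faces M K" "\<sigma> \<in> internal_faces M"
  shows "\<bar>mean \<phi> \<sigma> - \<phi> (xc K)\<bar> \<le> \<Lambda>' * diameter K"
proof (rule mean_close[OF face_all[OF K(1,2)] cont])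
  fix y assume y: "y \<in> dual_cell M \<sigma>"
  have K': "K \<in> cells_of M \<sigma>" using K by (simp add: cells_of_def)
  obtain L where L: "L \<in> cells_of M \<sigma>" "dist (xc K) y \<le> diameter K + diameter L"
    using dist_dual_cell[OF K' xc_closure[OF K(1)] y] .
  have "dist y (xc K) \<le> (1 + \<theta> * \<theta> * 2 ^ CARD('d)) * diameter K"
    using L(2) diameter_neighbour[OF K(3) K' L(1)] by (simp add: dist_commute algebra_simps)
  then have "\<Lambda> * dist y (xc K) \<le> \<Lambda> * ((1 + \<theta> * \<theta> * 2 ^ CARD('d)) * diameter K)"
    using nonneg by (intro mult_left_mono)
  then show "\<bar>\<phi> y - \<phi> (xc K)\<bar> \<le> \<Lambda>' * diameter K" using lip[of y "xc K"] by (simp add: \<Lambda>'_def mult.assoc)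
qed

text \<open>The closure of such a cell contains a boundary point \<open>q\<close>, and all points
  that occur are within \<open>2 * mesh_size M\<close> of \<open>q\<close>. Boundary cells, where
  fluxes are arbitrary, thus contribute exactly zero.\<close>

lemma near_boundary:
  assumes K: "K \<in> cells M" "\<not> interior_cell K"
  shows "x \<in> K \<Longrightarrow> \<phi> x = 0" "x \<in> K \<Longrightarrow> \<phi> (x - s *\<^sub>R axis j 1) = 0" "x \<in> K \<Longrightarrow> G x = 0"
    "\<sigma> \<in> faces M K \<Longrightarrow> mean \<phi> \<sigma> = 0"
    "\<sigma> \<in> faces M K \<Longrightarrow> x \<in> prism (- (s *\<^sub>R axis j 1)) \<sigma> \<Longrightarrow> \<phi> x = 0"
proof -
  let ?h = "mesh_size M"
  obtain \<sigma>0 where \<sigma>0: "\<sigma>0 \<in> faces M K" "\<sigma>0 \<notin> internal_faces M" using K by blast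
  obtain q where q: "q \<in> \<sigma>0" using face_nonempty[OF K(1) \<sigma>0(1)] by blast
  then have "q \<in> frontier \<Omega>" using not_internal_face[OF face_all[OF K(1) \<sigma>0(1)] \<sigma>0(2)] by blast
  then have q\<Omega>: "q \<notin> \<Omega>" using open_\<Omega> by (simp add: frontier_def interior_open)
  have qK: "q \<in> closure K" using face_subset[OF K(1) \<sigma>0(1)] q by blast
  have dq: "dist y q \<le> ?h" if "y \<in> closure K" for y
    using dist_cell_closure[OF K(1) that qK] diameter_le_mesh_size[OF K(1)] by linarith
  have h0: "?h > 0" using diameter_pos[OF K(1)] diameter_le_mesh_size[OF K(1)] by linarith
  have sh: "s \<le> ?h" using s_le[OF K(1)] diameter_le_mesh_size[OF K(1)] by linarith
  note v = vanish[OF q\<Omega>]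
  show "\<phi> x = 0" "G x = 0" if "x \<in> K"
    using v[of x] dq[of x] that closure_subset[of K] h0 by auto
  show "\<phi> (x - s *\<^sub>R axis j 1) = 0" if x: "x \<in> K"
  proof (rule v(1))
    have "dist (x - s *\<^sub>R axis j 1) x \<le> s" using s by (simp add: dist_norm)
    then show "dist (x - s *\<^sub>R axis j 1) q \<le> 2 * ?h"
      using dist_triangle[of "x - s *\<^sub>R axis j 1" q x] dq[of x] x closure_subset[of K] sh by auto
  qed
  show "mean \<phi> \<sigma> = 0" if \<sigma>: "\<sigma> \<in> faces M K"
  proof -
    have "\<bar>mean \<phi> \<sigma> - 0\<bar> \<le> 0"
    proof (rule mean_close[OF face_all[OF K(1) \<sigma>] cont])
      fix y assume "y \<in> dual_cell M \<sigma>"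
      moreover have "K \<in> cells_of M \<sigma>" using \<sigma> K by (simp add: cells_of_def)
      ultimately obtain L where L: "L \<in> cells_of M \<sigma>" "dist q y \<le> diameter K + diameter L"
        using dist_dual_cell[OF _ qK] by metis
      have "diameter L \<le> ?h" using L(1) diameter_le_mesh_size by (auto simp: cells_of_def)
      then have "\<phi> y = 0" using L(2) diameter_le_mesh_size[OF K(1)] by (intro v(1)) (simp add: dist_commute)
      then show "\<bar>\<phi> y - 0\<bar> \<le> 0" by simp
    qed
    then show ?thesis by simp
  qed
  show "\<phi> x = 0" if \<sigma>: "\<sigma> \<in> faces M K" and x: "x \<in> prism (- (s *\<^sub>R axis j 1)) \<sigma>"
  proof (rule v(1))
    obtain y t where y: "y \<in> \<sigma>" "0 \<le> t" "t \<le> 1" "x = y + t *\<^sub>R (- (s *\<^sub>R axis j 1))" using x unfolding prism_def by blast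
    have "dist x y \<le> s" using y s by (simp add: dist_norm mult_left_le_one_le)
    moreover have "dist y q \<le> ?h" using dq y(1) face_subset[OF K(1) \<sigma>] by blast
    ultimately show "dist x q \<le> 2 * ?h" using dist_triangle[of x q y] sh by linarith
  qed
qed

lemma Z_boundary:
  assumes "K \<in> cells M" "\<not> interior_cell K" "\<sigma> \<in> faces M K" shows "Z K \<sigma> j = 0"
proof -
  have "(LINT x:prism (- (s *\<^sub>R axis j 1)) \<sigma>|lborel. \<phi> x) = (LINT x:prism (- (s *\<^sub>R axis j 1)) \<sigma>|lborel. 0)"
    unfolding set_lebesgue_integral_def
    by (intro Bochner_Integration.integral_cong refl) (use near_boundary(5)[OF assms] in \<open>auto simp: indicator_def\<close>)
  then show ?thesis unfolding Z_def using near_boundary(4)[OF assms] by simp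
qed

lemma vol_prism_axis:
  assumes "K \<in> cells M" "\<sigma> \<in> faces M K"
  shows "vol (prism (- (s *\<^sub>R axis j 1)) \<sigma>) = s * \<bar>normal M K \<sigma> $ j\<bar> * area K \<sigma>"
  using measure_prism_face[OF assms, of "- (s *\<^sub>R axis j 1)"] s by (simp add: inner_axis abs_mult)

text \<open>On the prism, and in the mean over the dual cell, \<open>\<phi>\<close> differs from
  \<open>\<phi> (xc K)\<close> by the order of the diameter. The volume of the prism supplies the
  area and a factor \<open>s\<close> that cancels \<open>1 / s\<close>.\<close>

lemma Z_le:
  assumes K: "K \<in> cells M" "\<sigma> \<in> faces M K" "\<sigma> \<in> internal_faces M"
  shows "\<bar>Z K \<sigma> j\<bar> \<le> 2 * \<Lambda>' * A * vol K"
proof -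
  let ?P = "prism (- (s *\<^sub>R axis j 1)) \<sigma>" and ?n = "normal M K \<sigma> $ j" and ?h = "diameter K"
  have c: "compact ?P" by (intro compact_prism facial_compact facial[OF K(1,2)])
  have i: "(LINT x:?P|lborel. \<phi> x) = (LINT x:?P|lebesgue. \<phi> x)"
    by (rule set_integral_lebesgue_lborel[symmetric]) (use c cont borel_compact in auto)
  have "\<bar>\<phi> y - mean \<phi> \<sigma>\<bar> \<le> 2 * \<Lambda>' * ?h" if y: "y \<in> ?P" for y
  proof -
    obtain x t where x: "x \<in> \<sigma>" "0 \<le> t" "t \<le> 1" "y = x + t *\<^sub>R (- (s *\<^sub>R axis j 1))" using y unfolding prism_def by blast
    have "dist y x \<le> s" using x s by (simp add: dist_norm mult_left_le_one_le)
    moreover have "dist x (xc K) \<le> ?h"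
      using dist_cell_closure[OF K(1)] x(1) face_subset[OF K(1,2)] xc_closure[OF K(1)] by blast
    ultimately have "dist y (xc K) \<le> 2 * ?h" using dist_triangle[of y "xc K" x] s_le[OF K(1)] by linarith
    then have "\<Lambda> * dist y (xc K) \<le> \<Lambda> * (2 * ?h)" using nonneg by (intro mult_left_mono)
    moreover have "2 * \<Lambda> * ?h \<le> \<Lambda>' * ?h" using \<Lambda>_le diameter_pos[OF K(1)] by (intro mult_right_mono) auto
    ultimately show ?thesis using lip[of y "xc K"] phi_close[OF K] by (simp add: algebra_simps abs_le_iff)
  qed
  then have "\<bar>(LINT x:?P|lebesgue. \<phi> x) - mean \<phi> \<sigma> * vol ?P\<bar> \<le> 2 * \<Lambda>' * ?h * vol ?P"
    by (intro set_integral_close lmeasurable_compact c set_integrable_continuous cont)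
      (use c in \<open>auto simp: compact_imp_bounded borel_compact\<close>)
  then have le: "\<bar>(LINT x:?P|lebesgue. \<phi> x) - mean \<phi> \<sigma> * (s * \<bar>?n\<bar> * area K \<sigma>)\<bar> \<le> 2 * \<Lambda>' * ?h * (s * \<bar>?n\<bar> * area K \<sigma>)"
    unfolding vol_prism_axis[OF K(1,2)] .
  have "sgn ?n * \<bar>?n\<bar> = ?n" by (rule sgn_mult_abs)
  \<comment> \<open>The area term is rewritten as the mean times the volume of the prism, so that
    \<open>Z\<close> becomes an integral of \<open>\<phi>\<close> minus its mean.\<close>
  then have "Z K \<sigma> j = - (1 / s) * (sgn ?n * ((LINT x:?P|lebesgue. \<phi> x) - mean \<phi> \<sigma> * (s * \<bar>?n\<bar> * area K \<sigma>)))"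
    unfolding Z_def i using s by (simp add: field_simps)
  also have "\<bar>\<dots>\<bar> \<le> (1 / s) * (1 * (2 * \<Lambda>' * ?h * (s * \<bar>?n\<bar> * area K \<sigma>)))"
    unfolding abs_mult using s by (intro mult_mono le) (auto simp: abs_sgn_eq)
  also have "\<dots> = 2 * \<Lambda>' * (\<bar>?n\<bar> * (area K \<sigma> * ?h))" using s by simp
  also have "\<dots> \<le> 2 * \<Lambda>' * (1 * (A * vol K))"
  proof -
    have "\<bar>?n\<bar> \<le> 1" using component_le_norm_cart[of "normal M K \<sigma>" j] norm_normal[OF K(1,2)] by simp
    then show ?thesis using \<Lambda>'_nonneg area_nonneg diameter_pos[OF K(1)]
      by (intro mult_left_mono mult_mono area_diameter_le K) auto
  qed
  finally show ?thesis by (simp add: mult_ac)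
qed

text \<open>The prism depends on the face, on \<open>s\<close> and on the axis, but not on the cell,
  so only the sign of the normal changes. This is why one \<open>s\<close> serves the whole
  mesh.\<close>

lemma Z_opposite:
  assumes "K \<in> cells M" "\<sigma> \<in> faces M K" "L \<in> cells M" "\<sigma> \<in> faces M L" "K \<noteq> L"
  shows "Z L \<sigma> j = - Z K \<sigma> j"
  unfolding Z_def area_uminus[OF assms(1-4)] unfolding normal_opposite[OF assms] by (simp add: sgn_minus)

text \<open>The prism integrals add up by \<open>cell_divergence\<close> for the shift of length
  \<open>s\<close> along the \<open>j\<close>-th axis.\<close>

lemma sum_Z:
  assumes K: "K \<in> cells M"
  shows "(\<Sum>\<sigma>\<in>faces M K. Z K \<sigma> j) = (\<Sum>\<sigma>\<in>faces M K. area K \<sigma> * normal M K \<sigma> $ j * mean \<phi> \<sigma>)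
    - (1 / s) * (LINT x:K|lebesgue. \<phi> x - \<phi> (x - s *\<^sub>R axis j 1))"
proof -
  have c': "continuous_on UNIV (\<lambda>x. \<phi> (x - s *\<^sub>R axis j 1))"
    by (rule continuous_on_compose2[OF cont]) (auto intro!: continuous_intros)
  have Km: "K \<in> sets lebesgue" "bounded K" using cell(3,4)[OF K] by (auto intro: borel_open)
  have leb: "(LINT x:K|lebesgue. f x) = (LINT x:K|lborel. f x)" if "continuous_on UNIV f" for f :: "real^'d \<Rightarrow> real"
    by (rule set_integral_lebesgue_lborel) (use cell(3)[OF K] that in auto)
  have "(LINT x:K|lebesgue. \<phi> x - \<phi> (x - s *\<^sub>R axis j 1))
     = (LINT x:K|lborel. \<phi> x) - (LINT x:K|lborel. \<phi> (x - s *\<^sub>R axis j 1))"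
    using set_integral_diff(2)[OF set_integrable_continuous[OF Km cont] set_integrable_continuous[OF Km c']]
    by (simp add: leb cont c')
  also have "\<dots> = (\<Sum>\<sigma>\<in>faces M K. sgn (normal M K \<sigma> \<bullet> (s *\<^sub>R axis j 1)) * (LINT x:prism (- (s *\<^sub>R axis j 1)) \<sigma>|lborel. \<phi> x))"
    using cell_divergence[OF d cell(2)[OF K] outward[OF K] cont, of "s *\<^sub>R axis j 1"] by linarith
  also have "\<dots> = (\<Sum>\<sigma>\<in>faces M K. sgn (normal M K \<sigma> $ j) * (LINT x:prism (- (s *\<^sub>R axis j 1)) \<sigma>|lborel. \<phi> x))"
    using s by (simp add: inner_axis sgn_mult)
  finally show ?thesis unfolding Z_def sum_subtractf sum_distrib_left by (simp add: sum_divide_distrib)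
qed

text \<open>A face density mixes the densities on both sides, so an estimate in \<open>K\<close>
  also involves the errors of its neighbours. The term \<open>\<omega>\<close> pays for moving
  between the sample points of the two cells.\<close>

definition near_err :: "(real^'d) set \<Rightarrow> real" where
  "near_err K = (\<Sum>\<sigma>\<in>{\<sigma>\<in>faces M K. \<sigma> \<in> internal_faces M}. \<Sum>L\<in>cells_of M \<sigma>. err L + \<omega>)"

lemma near_err_nonneg: "near_err K \<ge> 0"
  unfolding near_err_def using err_nonneg nonneg by (intro sum_nonneg) auto

section \<open>Fluxes and their errors in one cell\<close>

lemma norm_W_le: "\<bar>W x $ j\<bar> \<le> B ^ 3"
proof -
  have "\<bar>U x $ k\<bar> \<le> B" for k using component_le_norm_cart[of "U x" k] U_le[of x] by linarith
  then have "\<bar>r x\<bar> * \<bar>U x $ i\<bar> * \<bar>U x $ j\<bar> \<le> B * B * B"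
    using r_le nonneg by (intro mult_mono) auto
  then show ?thesis by (simp add: W_def abs_mult power3_eq_cube)
qed

lemma cell_velocity_err: "K \<in> cells M \<Longrightarrow> \<sigma> \<in> faces M K \<Longrightarrow> norm (velocity S n \<sigma> - U (xc K)) \<le> err K"
  unfolding err_def using member_le_sum[of \<sigma> "faces M K" "\<lambda>\<sigma>. norm (velocity S n \<sigma> - U (xc K))"] cell(6)[of K] by simp

lemma cell_density_err: "\<bar>density S n K - r (xc K)\<bar> \<le> err K"
  unfolding err_def by (simp add: sum_nonneg)

lemma internal_flux:
  assumes "\<sigma> \<in> internal_faces M" "K \<in> cells_of M \<sigma>"
  shows "flux S n K \<sigma> = area K \<sigma> * face_density S n \<sigma> * (velocity S n \<sigma> \<bullet> normal M K \<sigma>)"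
    and "\<bar>face_density S n \<sigma> - c\<bar> \<le> (\<Sum>L\<in>cells_of M \<sigma>. \<bar>density S n L - c\<bar>)"
    and "\<bar>face_density S n \<sigma>\<bar> \<le> B"
proof -
  obtain P Q where PQ: "cells_of M \<sigma> = {P, Q}" "interface M P Q \<sigma>" "P \<noteq> Q" using internal_face[OF assms(1)] .
  have seg: "face_density S n \<sigma> \<in> closed_segment (density S n P) (density S n Q)"
    using pf n PQ(2) unfolding primal_fluxes_def by blast
  then show "\<bar>face_density S n \<sigma> - c\<bar> \<le> (\<Sum>L\<in>cells_of M \<sigma>. \<bar>density S n L - c\<bar>)"
    using closed_segment_dist_le[OF seg, of c] PQ by simp
  have "\<bar>density S n P\<bar> \<le> B" "\<bar>density S n Q\<bar> \<le> B" using PQ(2) density_le by (auto simp: interface_def)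
  then show "\<bar>face_density S n \<sigma>\<bar> \<le> B" using seg by (auto simp: closed_segment_eq_real_ivl split: if_splits)
  obtain L where "interface M K L \<sigma>"
    using PQ assms(2) internal_interface[OF assms] by blast
  then show "flux S n K \<sigma> = area K \<sigma> * face_density S n \<sigma> * (velocity S n \<sigma> \<bullet> normal M K \<sigma>)"
    using pf n unfolding primal_fluxes_def by blast
qed

lemma velocity_normal_le: "K \<in> cells M \<Longrightarrow> \<sigma> \<in> faces M K \<Longrightarrow> \<bar>v \<bullet> normal M K \<sigma>\<bar> \<le> norm v"
  using Cauchy_Schwarz_ineq2[of v "normal M K \<sigma>"] norm_normal by simp

lemma flux_diameter_le:
  assumes "K \<in> cells M" "\<sigma> \<in> faces M K" "\<sigma> \<in> internal_faces M"
  shows "\<bar>flux S n K \<sigma>\<bar> * diameter K \<le> A * B\<^sup>2 * vol K"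
proof -
  have \<sigma>: "K \<in> cells_of M \<sigma>" using assms by (simp add: cells_of_def)
  have "\<bar>velocity S n \<sigma> \<bullet> normal M K \<sigma>\<bar> \<le> B"
    using velocity_normal_le[OF assms(1,2)] velocity_le[OF face_all[OF assms(1,2)]] order_trans by blast
  then have "\<bar>face_density S n \<sigma>\<bar> * \<bar>velocity S n \<sigma> \<bullet> normal M K \<sigma>\<bar> \<le> B * B"
    using internal_flux(3)[OF assms(3) \<sigma>] nonneg by (intro mult_mono) auto
  then have "(area K \<sigma> * diameter K) * (\<bar>face_density S n \<sigma>\<bar> * \<bar>velocity S n \<sigma> \<bullet> normal M K \<sigma>\<bar>) \<le> (A * vol K) * (B * B)"
    by (rule mult_mono[OF area_diameter_le[OF assms(1,2)]]) (use A_nonneg in auto)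
  then show ?thesis
    by (simp add: internal_flux(1)[OF assms(3) \<sigma>] abs_mult area_nonneg power2_eq_square mult_ac)
qed

text \<open>(H3) transfers the scaling of the primal fluxes to the dual ones. Its maximum runs over
  all faces of \<open>K\<close>, hence the restriction to cells without external faces.\<close>

lemma dual_flux_diameter_le:
  assumes K: "K \<in> cells M" "interior_cell K" and \<sigma>: "\<sigma> \<in> faces M K" "\<epsilon> \<in> dual_faces M \<sigma>" "fst \<epsilon> = K"
  shows "\<bar>dual_flux S n \<sigma> \<epsilon>\<bar> * diameter K \<le> C * A * B\<^sup>2 * vol K"
proof -
  let ?F = "(\<lambda>\<tau>. \<bar>flux S n K \<tau>\<bar>) ` faces M K"
  have "\<bar>dual_flux S n \<sigma> \<epsilon>\<bar> \<le> C * Max ?F"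
    using H3 n K \<sigma> unfolding H3_def by blast
  moreover have "Max ?F \<in> ?F" using cell(6,7)[OF K(1)] by (intro Max_in) auto
  then obtain \<tau> where \<tau>: "\<tau> \<in> faces M K" "Max ?F = \<bar>flux S n K \<tau>\<bar>" by auto
  ultimately have "\<bar>dual_flux S n \<sigma> \<epsilon>\<bar> * diameter K \<le> C * \<bar>flux S n K \<tau>\<bar> * diameter K"
    using diameter_pos[OF K(1)] by (intro mult_right_mono) auto
  also have "\<dots> \<le> C * (A * B\<^sup>2 * vol K)"
    using flux_diameter_le[OF K(1) \<tau>(1)] K(2) \<tau>(1) nonneg by (auto simp: mult.assoc intro!: mult_left_mono)
  finally show ?thesis by (simp add: mult_ac)
qed

text \<open>The arithmetic mean is subtracted because the right side of (H1) is the same for all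
  faces of a cell: against values that sum to zero it drops out. What remains of
  \<open>\<phi>\<close> is of the order of the diameter.\<close>

lemma mean_phi_diff:
  assumes "K \<in> cells M" "interior_cell K"
  defines "c \<equiv> (\<Sum>\<sigma>\<in>faces M K. mean \<phi> \<sigma>) / real (card (faces M K))"
  shows "(\<Sum>\<sigma>\<in>faces M K. mean \<phi> \<sigma> - c) = 0"
    and "\<sigma> \<in> faces M K \<Longrightarrow> \<bar>mean \<phi> \<sigma> - c\<bar> \<le> 2 * \<Lambda>' * diameter K"
proof -
  let ?k = "real (card (faces M K))"
  have k: "?k > 0" using cell(6,7)[OF assms(1)] by (simp add: card_gt_0_iff)
  then show "(\<Sum>\<sigma>\<in>faces M K. mean \<phi> \<sigma> - c) = 0" by (simp add: sum_subtractf c_def)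
  have cl: "\<bar>mean \<phi> \<sigma> - \<phi> (xc K)\<bar> \<le> \<Lambda>' * diameter K" if "\<sigma> \<in> faces M K" for \<sigma>
    using phi_close assms that by blast
  have "\<bar>c - \<phi> (xc K)\<bar> \<le> \<Lambda>' * diameter K"
  proof -
    have "\<bar>(\<Sum>\<sigma>\<in>faces M K. mean \<phi> \<sigma> - \<phi> (xc K))\<bar> \<le> (\<Sum>\<sigma>\<in>faces M K. \<Lambda>' * diameter K)"
      by (rule order_trans[OF sum_abs sum_mono[OF cl]])
    moreover have "(c - \<phi> (xc K)) * ?k = (\<Sum>\<sigma>\<in>faces M K. mean \<phi> \<sigma> - \<phi> (xc K))"
      using k by (simp add: c_def left_diff_distrib sum_subtractf)
    ultimately have "\<bar>(c - \<phi> (xc K)) * ?k\<bar> \<le> (\<Lambda>' * diameter K) * ?k"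
      by (simp add: mult.commute)
    then show ?thesis using k by (simp add: abs_mult)
  qed
  then show "\<bar>mean \<phi> \<sigma> - c\<bar> \<le> 2 * \<Lambda>' * diameter K" if "\<sigma> \<in> faces M K"
    using cl[OF that] by linarith
qed

lemma grad_integral:
  assumes K: "K \<in> cells M"
  shows "\<bar>(1 / s) * (LINT x:K|lebesgue. \<phi> x - \<phi> (x - s *\<^sub>R axis j 1)) - G (xc K) $ j * vol K\<bar> \<le> \<omega> * vol K"
proof -
  have c': "continuous_on UNIV (\<lambda>x. \<phi> (x - s *\<^sub>R axis j 1))"
    by (rule continuous_on_compose2[OF cont]) (auto intro!: continuous_intros)
  have "\<bar>(LINT x:K|lebesgue. \<phi> x - \<phi> (x - s *\<^sub>R axis j 1)) - (s * G (xc K) $ j) * vol K\<bar> \<le> s * \<omega> * vol K"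
    by (intro set_integral_close cell_lmeasurable K set_integrable_continuous continuous_on_diff cont c' grad)
      (use cell[OF K] in auto)
  moreover define Y where "Y = (LINT x:K|lebesgue. \<phi> x - \<phi> (x - s *\<^sub>R axis j 1))"
  ultimately have "\<bar>Y - s * (G (xc K) $ j * vol K)\<bar> \<le> s * (\<omega> * vol K)" by (simp add: mult.assoc)
  moreover have "(1 / s) * Y - G (xc K) $ j * vol K = (Y - s * (G (xc K) $ j * vol K)) / s"
    using s by (simp add: diff_divide_distrib)
  ultimately show ?thesis using s by (simp add: abs_divide divide_le_eq mult.commute flip: Y_def)
qed

text \<open>\<open>k1\<close> collects the coefficients of \<open>err K\<close>, and
  \<open>k2\<close> that of \<open>near_err K\<close>, in the bounds for \<open>E1\<close> and
  \<open>E2\<close> in \<open>cell_estimate\<close>.\<close>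

definition k1 :: real where "k1 = 4 * \<Lambda>' * C * A * B\<^sup>2 * N\<^sup>2 + 2 * \<Lambda>' * A * B\<^sup>2 * N"
definition k2 :: real where "k2 = 2 * \<Lambda>' * A * B\<^sup>2"

lemma k_nonneg: "k1 \<ge> 0" "k2 \<ge> 0"
  unfolding k1_def k2_def using \<Lambda>'_nonneg A_nonneg nonneg N by auto

lemma dual_velocity_err:
  assumes "K \<in> cells M" "\<sigma> \<in> faces M K" "\<tau> \<in> faces M K" "\<sigma> \<noteq> \<tau>" "share_ridge \<sigma> \<tau>"
  shows "\<bar>dual_velocity S n (K, {\<sigma>, \<tau>}) $ i - U (xc K) $ i\<bar> \<le> 2 * err K"
proof -
  have "(K, {\<sigma>, \<tau>}) \<in> dual_faces M \<sigma>" using assms by (auto simp: dual_faces_def)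
  then have "dual_velocity S n (K, {\<sigma>, \<tau>}) $ i \<in> closed_segment (velocity S n \<sigma> $ i) (velocity S n \<tau> $ i)"
    using dv n unfolding dual_velocities_def by blast
  note seg = closed_segment_dist_le[OF this, of "U (xc K) $ i"]
  have *: "\<bar>velocity S n \<tau> $ i - U (xc K) $ i\<bar> \<le> err K" if "\<tau> \<in> faces M K" for \<tau>
    using component_le_norm_cart[of "velocity S n \<tau> - U (xc K)" i] cell_velocity_err[OF assms(1) that] by simp
  show ?thesis using seg *[OF assms(2)] *[OF assms(3)] by linarith
qed

lemma flux_err:
  assumes K: "K \<in> cells M" and \<sigma>: "\<sigma> \<in> faces M K" "\<sigma> \<in> internal_faces M"
  shows "\<bar>face_density S n \<sigma> * (velocity S n \<sigma> \<bullet> normal M K \<sigma>) - r (xc K) * (U (xc K) \<bullet> normal M K \<sigma>)\<bar>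
    \<le> B * ((\<Sum>L\<in>cells_of M \<sigma>. err L + \<omega>) + err K)"
proof -
  let ?n = "normal M K \<sigma>" and ?u = "velocity S n \<sigma>" and ?U = "U (xc K)" and ?r = "face_density S n \<sigma>" and ?R = "r (xc K)"
  have K': "K \<in> cells_of M \<sigma>" using K \<sigma> by (simp add: cells_of_def)
  have le: "\<bar>density S n L - ?R\<bar> \<le> err L + \<omega>" if L: "L \<in> cells_of M \<sigma>" for L
  proof -
    have L': "L \<in> cells M" "\<sigma> \<in> faces M L" using L by (auto simp: cells_of_def)
    \<comment> \<open>A point of the common face links the two sample points, so that
      \<open>modulus\<close> applies to them.\<close>
    obtain p where p: "p \<in> \<sigma>" using face_nonempty[OF K \<sigma>(1)] by blast
    have "dist (xc L) p \<le> mesh_size M" "dist p (xc K) \<le> mesh_size M"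
      using dist_cell_closure[OF L'(1) xc_closure[OF L'(1)]] dist_cell_closure[OF K _ xc_closure[OF K]]
        face_subset[OF L'] face_subset[OF K \<sigma>(1)] p diameter_le_mesh_size[OF K] diameter_le_mesh_size[OF L'(1)]
      by (meson order_trans subsetD)+
    then have "dist (xc L) (xc K) \<le> 2 * mesh_size M" using dist_triangle[of "xc L" "xc K" p] by linarith
    moreover have "xc L \<in> closure \<Omega>" "xc K \<in> closure \<Omega>" using xc cell(1) K L'(1) closure_subset by blast+
    ultimately have "\<bar>r (xc L) - ?R\<bar> \<le> \<omega>" by (intro modulus(1))
    then show ?thesis using cell_density_err[of L] by linarith
  qed
  have 1: "\<bar>?r - ?R\<bar> \<le> (\<Sum>L\<in>cells_of M \<sigma>. err L + \<omega>)"
    by (rule order_trans[OF internal_flux(2)[OF \<sigma>(2) K'] sum_mono[OF le]])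
  have "?r * (?u \<bullet> ?n) - ?R * (?U \<bullet> ?n) = (?r - ?R) * (?u \<bullet> ?n) + ?R * ((?u - ?U) \<bullet> ?n)"
    by (simp add: algebra_simps inner_diff_left)
  also have "\<bar>\<dots>\<bar> \<le> \<bar>?r - ?R\<bar> * \<bar>?u \<bullet> ?n\<bar> + \<bar>?R\<bar> * \<bar>(?u - ?U) \<bullet> ?n\<bar>"
    by (rule order_trans[OF abs_triangle_ineq]) (simp add: abs_mult)
  also have "\<dots> \<le> (\<Sum>L\<in>cells_of M \<sigma>. err L + \<omega>) * B + B * err K"
  proof (intro add_mono mult_mono 1 r_le)
    show "\<bar>?u \<bullet> ?n\<bar> \<le> B" using velocity_normal_le[OF K \<sigma>(1), of ?u] velocity_le[OF face_all[OF K \<sigma>(1)]] by linarith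
    show "\<bar>(?u - ?U) \<bullet> ?n\<bar> \<le> err K"
      using velocity_normal_le[OF K \<sigma>(1), of "?u - ?U"] cell_velocity_err[OF K \<sigma>(1)] by linarith
    show "0 \<le> (\<Sum>L\<in>cells_of M \<sigma>. err L + \<omega>)" using err_nonneg nonneg by (intro sum_nonneg) auto
  qed (use nonneg in auto)
  finally show ?thesis by (simp add: algebra_simps)
qed

text \<open>By (H2) a constant can be subtracted from the dual velocities and from the means of \<open>\<phi>\<close>; by (H1) the
  dual fluxes then recombine into primal ones, and since the areas times normals sum to zero, only the
  flux of \<open>\<phi>\<close> against the constant field \<open>W (xc K)\<close> is left.\<close>

lemma cell_estimate:
  assumes K: "K \<in> cells M"
  shows "\<bar>X K + vol K * (W (xc K) \<bullet> G (xc K)) + (\<Sum>j\<in>UNIV. W (xc K) $ j * (\<Sum>\<sigma>\<in>faces M K. Z K \<sigma> j))\<bar>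
    \<le> vol K * (k1 * err K + k2 * near_err K + CARD('d) * B ^ 3 * \<omega>)"
proof (cases "interior_cell K")
  case False
  have "X K = 0" unfolding X_def using near_boundary(4)[OF K False] by simp
  moreover have "G (xc K) = 0" by (rule near_boundary(3)[OF K False xc[OF K]])
  moreover have "Z K \<sigma> j = 0" if "\<sigma> \<in> faces M K" for \<sigma> j using Z_boundary[OF K False that] .
  ultimately show ?thesis using vol_pos[OF K] k_nonneg err_nonneg[of K] near_err_nonneg[of K] nonneg by simp
next
  case True
  let ?E = "faces M K" and ?h = "diameter K" and ?n = "normal M K" and ?a = "area K"
  let ?x = "xc K"
  define k where "k = real (card ?E)"
  define c where "c = (\<Sum>\<sigma>\<in>?E. mean \<phi> \<sigma>) / k"
  define q where "q \<sigma> = mean \<phi> \<sigma> - c" for \<sigma>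
  define F where "F \<sigma> = flux S n K \<sigma>" for \<sigma>
  define f where "f \<sigma> \<tau> = (if \<sigma> \<noteq> \<tau> \<and> share_ridge \<sigma> \<tau> then dual_flux S n \<sigma> (K, {\<sigma>, \<tau>}) else 0)" for \<sigma> \<tau>
  define w where "w \<sigma> \<tau> = dual_velocity S n (K, {\<sigma>, \<tau>}) $ i" for \<sigma> \<tau>
  define u where "u = U ?x $ i"
  have k: "k > 0" "k \<le> N" using cell(6,7)[OF K] card_le[OF K] by (auto simp: k_def card_gt_0_iff)
  have h: "?h > 0" by (rule diameter_pos[OF K])
  have q0: "(\<Sum>\<sigma>\<in>?E. q \<sigma>) = 0" and q: "\<And>\<sigma>. \<sigma> \<in> ?E \<Longrightarrow> \<bar>q \<sigma>\<bar> \<le> 2 * \<Lambda>' * ?h"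
    using mean_phi_diff[OF K True] by (auto simp: q_def c_def k_def)
  have anti: "f \<sigma> \<tau> = - f \<tau> \<sigma>" if "\<sigma> \<in> ?E" "\<tau> \<in> ?E" for \<sigma> \<tau>
  proof (cases "\<sigma> \<noteq> \<tau> \<and> share_ridge \<sigma> \<tau>")
    case True
    then have "(K, {\<sigma>, \<tau>}) \<in> dual_faces M \<sigma>" using K that by (auto simp: dual_faces_def)
    then have "dual_flux S n \<sigma> (K, {\<sigma>, \<tau>}) = - dual_flux S n \<tau> (K, {\<sigma>, \<tau>})"
      using H2 n unfolding H2_def by blast
    then show ?thesis using True by (auto simp: f_def share_ridge_def Int_commute insert_commute)
  next
    case False
    then show ?thesis by (auto simp: f_def share_ridge_def Int_commute)
  qed
  have w_sym: "w \<sigma> \<tau> = w \<tau> \<sigma>" for \<sigma> \<tau> by (simp add: w_def insert_commute)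
  have sum_f: "(\<Sum>\<tau>\<in>?E. f \<sigma> \<tau>) = (1 / k) * (\<Sum>\<tau>\<in>?E. F \<tau>) - F \<sigma>" if "\<sigma> \<in> ?E" for \<sigma>
  proof -
    have "F \<sigma> + (\<Sum>\<epsilon>\<in>{\<epsilon>\<in>dual_faces M \<sigma>. fst \<epsilon> = K}. dual_flux S n \<sigma> \<epsilon>) = (1 / k) * (\<Sum>\<tau>\<in>?E. F \<tau>)"
      using H1 n K that unfolding H1_def F_def k_def by blast
    then show ?thesis using sum_dual_faces_cell[OF K that, of "dual_flux S n \<sigma>"] by (simp add: f_def cong: if_cong)
  qed
  have X: "X K = (\<Sum>\<sigma>\<in>?E. mean \<phi> \<sigma> * (\<Sum>\<tau>\<in>?E. f \<sigma> \<tau> * w \<sigma> \<tau>))"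
    unfolding X_def
    by (intro sum.cong refl arg_cong2[where f="(*)"], subst sum_dual_faces_cell[OF K])
      (auto simp: f_def w_def intro!: sum.cong)
  \<comment> \<open>Three sources of error: \<open>E1\<close> from the dual velocities,
    \<open>E2\<close> from the primal fluxes, \<open>E3\<close> from the difference quotients of
    \<open>\<phi>\<close>.\<close>
  define E1 where "E1 = (\<Sum>\<sigma>\<in>?E. q \<sigma> * (\<Sum>\<tau>\<in>?E. f \<sigma> \<tau> * (w \<sigma> \<tau> - u)))"
  define D where "D \<sigma> = face_density S n \<sigma> * (velocity S n \<sigma> \<bullet> ?n \<sigma>) - r ?x * (U ?x \<bullet> ?n \<sigma>)" for \<sigma>
  define E2 where "E2 = u * (\<Sum>\<sigma>\<in>?E. q \<sigma> * (?a \<sigma> * D \<sigma>))"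
  define I where "I j = (1 / s) * (LINT x:K|lebesgue. \<phi> x - \<phi> (x - s *\<^sub>R axis j 1)) - G ?x $ j * vol K" for j
  define E3 where "E3 = (\<Sum>j\<in>UNIV. W ?x $ j * I j)"
  have "X K = E1 - u * (\<Sum>\<sigma>\<in>?E. q \<sigma> * F \<sigma>)"
  proof -
    \<comment> \<open>\<open>f\<close> is antisymmetric by (H2) and \<open>w\<close> is
      symmetric.\<close>
    have z: "(\<Sum>\<sigma>\<in>?E. \<Sum>\<tau>\<in>?E. f \<sigma> \<tau> * (w \<sigma> \<tau> - u)) = 0"
      by (rule sum_antisymmetric_eq_0) (use anti w_sym in \<open>metis mult_minus_left\<close>)
    \<comment> \<open>The mean is split as \<open>q \<sigma> + c\<close>, and the dual velocity as
      \<open>(w \<sigma> \<tau> - u) + u\<close>.\<close>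
    have "mean \<phi> \<sigma> * (\<Sum>\<tau>\<in>?E. f \<sigma> \<tau> * w \<sigma> \<tau>)
       = q \<sigma> * (\<Sum>\<tau>\<in>?E. f \<sigma> \<tau> * (w \<sigma> \<tau> - u)) + c * (\<Sum>\<tau>\<in>?E. f \<sigma> \<tau> * (w \<sigma> \<tau> - u)) + u * (mean \<phi> \<sigma> * (\<Sum>\<tau>\<in>?E. f \<sigma> \<tau>))" for \<sigma>
      by (simp add: q_def right_diff_distrib sum_subtractf sum_distrib_left[symmetric] sum_distrib_right[symmetric] algebra_simps)
    then have "X K = E1 + c * (\<Sum>\<sigma>\<in>?E. \<Sum>\<tau>\<in>?E. f \<sigma> \<tau> * (w \<sigma> \<tau> - u)) + u * (\<Sum>\<sigma>\<in>?E. mean \<phi> \<sigma> * (\<Sum>\<tau>\<in>?E. f \<sigma> \<tau>))"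
      unfolding X E1_def by (simp add: sum.distrib sum_distrib_left)
    \<comment> \<open>(H1) replaces the dual fluxes by primal ones; its averaged right side turns
      the mean of \<open>\<phi>\<close> into \<open>q\<close>.\<close>
    also have "(\<Sum>\<sigma>\<in>?E. mean \<phi> \<sigma> * (\<Sum>\<tau>\<in>?E. f \<sigma> \<tau>)) = (\<Sum>\<sigma>\<in>?E. mean \<phi> \<sigma> * ((1 / k) * (\<Sum>\<tau>\<in>?E. F \<tau>) - F \<sigma>))"
      by (intro sum.cong refl) (simp add: sum_f)
    also have "\<dots> = (\<Sum>\<sigma>\<in>?E. mean \<phi> \<sigma>) * ((1 / k) * (\<Sum>\<tau>\<in>?E. F \<tau>)) - (\<Sum>\<sigma>\<in>?E. mean \<phi> \<sigma> * F \<sigma>)"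
      unfolding right_diff_distrib sum_subtractf sum_distrib_right ..
    also have "\<dots> = c * (\<Sum>\<tau>\<in>?E. F \<tau>) - (\<Sum>\<sigma>\<in>?E. mean \<phi> \<sigma> * F \<sigma>)"
      by (simp add: c_def)
    also have "\<dots> = - (\<Sum>\<sigma>\<in>?E. q \<sigma> * F \<sigma>)"
      by (simp add: q_def left_diff_distrib sum_subtractf sum_distrib_left)
    finally show ?thesis unfolding z by simp
  qed
  moreover have "(\<Sum>\<sigma>\<in>?E. q \<sigma> * F \<sigma>) = (\<Sum>\<sigma>\<in>?E. q \<sigma> * (?a \<sigma> * D \<sigma>)) + (\<Sum>\<sigma>\<in>?E. q \<sigma> * (?a \<sigma> * (r ?x * (U ?x \<bullet> ?n \<sigma>))))"
  proof -
    have "F \<sigma> = ?a \<sigma> * D \<sigma> + ?a \<sigma> * (r ?x * (U ?x \<bullet> ?n \<sigma>))" if "\<sigma> \<in> ?E" for \<sigma>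
      using internal_flux(1)[of \<sigma> K] that True K unfolding F_def D_def by (auto simp: cells_of_def algebra_simps)
    then show ?thesis by (simp add: sum.distrib[symmetric] distrib_left)
  qed
  moreover have "u * (\<Sum>\<sigma>\<in>?E. q \<sigma> * (?a \<sigma> * (r ?x * (U ?x \<bullet> ?n \<sigma>))))
      = (\<Sum>j\<in>UNIV. W ?x $ j * (\<Sum>\<sigma>\<in>?E. ?a \<sigma> * ?n \<sigma> $ j * mean \<phi> \<sigma>))"
  proof -
    have "(\<Sum>\<sigma>\<in>?E. ?a \<sigma> * ?n \<sigma> $ j * mean \<phi> \<sigma>) = (\<Sum>\<sigma>\<in>?E. q \<sigma> * (?a \<sigma> * ?n \<sigma> $ j))" for j
    proof -
      have "(\<Sum>\<sigma>\<in>?E. q \<sigma> * (?a \<sigma> * ?n \<sigma> $ j)) = (\<Sum>\<sigma>\<in>?E. ?a \<sigma> * ?n \<sigma> $ j * mean \<phi> \<sigma>) - c * (\<Sum>\<sigma>\<in>?E. ?a \<sigma> * ?n \<sigma> $ j)"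
        by (simp add: q_def algebra_simps sum_subtractf sum_distrib_left)
      then show ?thesis using sum_area_normal[OF K, of j] by simp
    qed
    then have "(\<Sum>j\<in>UNIV. W ?x $ j * (\<Sum>\<sigma>\<in>?E. ?a \<sigma> * ?n \<sigma> $ j * mean \<phi> \<sigma>))
      = (\<Sum>j\<in>UNIV. \<Sum>\<sigma>\<in>?E. W ?x $ j * (q \<sigma> * (?a \<sigma> * ?n \<sigma> $ j)))" by (simp add: sum_distrib_left)
    also have "\<dots> = (\<Sum>\<sigma>\<in>?E. \<Sum>j\<in>UNIV. W ?x $ j * (q \<sigma> * (?a \<sigma> * ?n \<sigma> $ j)))" by (rule sum.swap)
    also have "\<dots> = (\<Sum>\<sigma>\<in>?E. u * (q \<sigma> * (?a \<sigma> * (r ?x * (U ?x \<bullet> ?n \<sigma>)))))"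
      by (intro sum.cong refl) (simp add: W_def u_def inner_vec_def sum_distrib_left mult_ac)
    finally show ?thesis by (simp add: sum_distrib_left)
  qed
  moreover have "(\<Sum>j\<in>UNIV. W ?x $ j * (\<Sum>\<sigma>\<in>?E. ?a \<sigma> * ?n \<sigma> $ j * mean \<phi> \<sigma>))
      = (\<Sum>j\<in>UNIV. W ?x $ j * (\<Sum>\<sigma>\<in>?E. Z K \<sigma> j)) + (E3 + vol K * (W ?x \<bullet> G ?x))"
  proof -
    have "(\<Sum>\<sigma>\<in>?E. ?a \<sigma> * ?n \<sigma> $ j * mean \<phi> \<sigma>) = (\<Sum>\<sigma>\<in>?E. Z K \<sigma> j) + (I j + G ?x $ j * vol K)" for j
      unfolding sum_Z[OF K] I_def by simp
    then show ?thesis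
      by (simp add: E3_def distrib_left sum.distrib inner_vec_def sum_distrib_left mult_ac)
  qed
  ultimately have "X K + vol K * (W ?x \<bullet> G ?x) + (\<Sum>j\<in>UNIV. W ?x $ j * (\<Sum>\<sigma>\<in>?E. Z K \<sigma> j)) = E1 - E2 - E3"
    unfolding E2_def by (simp add: distrib_left)
  moreover have "\<bar>E1\<bar> \<le> 4 * \<Lambda>' * C * A * B\<^sup>2 * N\<^sup>2 * vol K * err K"
  proof -
    have t: "\<bar>q \<sigma> * (f \<sigma> \<tau> * (w \<sigma> \<tau> - u))\<bar> \<le> 4 * \<Lambda>' * (C * A * B\<^sup>2 * vol K) * err K" if "\<sigma> \<in> ?E" "\<tau> \<in> ?E" for \<sigma> \<tau>
    proof (cases "\<sigma> \<noteq> \<tau> \<and> share_ridge \<sigma> \<tau>")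
      case False
      then show ?thesis using \<Lambda>'_nonneg nonneg A_nonneg err_nonneg[of K] vol_pos[OF K] by (auto simp: f_def)
    next
      case sr: True
      have "(K, {\<sigma>, \<tau>}) \<in> dual_faces M \<sigma>" using sr K that by (auto simp: dual_faces_def)
      then have f: "\<bar>f \<sigma> \<tau>\<bar> * ?h \<le> C * A * B\<^sup>2 * vol K"
        using dual_flux_diameter_le[OF K True that(1)] sr by (simp add: f_def)
      have w: "\<bar>w \<sigma> \<tau> - u\<bar> \<le> 2 * err K" unfolding w_def u_def using dual_velocity_err[OF K that] sr by blast
      \<comment> \<open>The diameter from the bound for \<open>q\<close> is paired with the dual
        flux, and together they yield the volume.\<close>
      have "(\<bar>f \<sigma> \<tau>\<bar> * ?h) * \<bar>w \<sigma> \<tau> - u\<bar> \<le> (C * A * B\<^sup>2 * vol K) * (2 * err K)"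
        by (rule mult_mono[OF f w]) (use nonneg A_nonneg in auto)
      then have "2 * \<Lambda>' * ((\<bar>f \<sigma> \<tau>\<bar> * ?h) * \<bar>w \<sigma> \<tau> - u\<bar>) \<le> 2 * \<Lambda>' * ((C * A * B\<^sup>2 * vol K) * (2 * err K))"
        using \<Lambda>'_nonneg by (intro mult_left_mono) auto
      moreover have "\<bar>q \<sigma>\<bar> * (\<bar>f \<sigma> \<tau>\<bar> * \<bar>w \<sigma> \<tau> - u\<bar>) \<le> (2 * \<Lambda>' * ?h) * (\<bar>f \<sigma> \<tau>\<bar> * \<bar>w \<sigma> \<tau> - u\<bar>)"
        using q[OF that(1)] by (intro mult_right_mono) auto
      ultimately show ?thesis by (simp add: abs_mult mult_ac)
    qed
    have "\<bar>E1\<bar> \<le> (\<Sum>\<sigma>\<in>?E. \<Sum>\<tau>\<in>?E. 4 * \<Lambda>' * (C * A * B\<^sup>2 * vol K) * err K)"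
      unfolding E1_def sum_distrib_left
      by (rule order_trans[OF sum_abs sum_mono], rule order_trans[OF sum_abs sum_mono]) (rule t)
    also have "\<dots> = k * k * (4 * \<Lambda>' * (C * A * B\<^sup>2 * vol K) * err K)" by (simp add: k_def)
    also have "\<dots> \<le> N * N * (4 * \<Lambda>' * (C * A * B\<^sup>2 * vol K) * err K)"
      using k \<Lambda>'_nonneg nonneg A_nonneg err_nonneg[of K] vol_pos[OF K] by (intro mult_right_mono mult_mono) auto
    finally show ?thesis by (simp add: power2_eq_square mult_ac)
  qed
  moreover have "\<bar>E2\<bar> \<le> 2 * \<Lambda>' * A * B\<^sup>2 * vol K * (near_err K + N * err K)"
  proof -
    let ?T = "\<lambda>\<sigma>. (\<Sum>L\<in>cells_of M \<sigma>. err L + \<omega>)"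
    have T: "?T \<sigma> \<ge> 0" for \<sigma> using err_nonneg nonneg by (intro sum_nonneg) auto
    have t: "\<bar>q \<sigma> * (?a \<sigma> * D \<sigma>)\<bar> \<le> 2 * \<Lambda>' * ((A * vol K) * (B * (?T \<sigma> + err K)))" if "\<sigma> \<in> ?E" for \<sigma>
    proof -
      have D: "\<bar>D \<sigma>\<bar> \<le> B * (?T \<sigma> + err K)" unfolding D_def using flux_err[OF K that] True that by blast
      have "(?a \<sigma> * ?h) * \<bar>D \<sigma>\<bar> \<le> (A * vol K) * (B * (?T \<sigma> + err K))"
        by (rule mult_mono[OF area_diameter_le[OF K that] D]) (use A_nonneg in auto)
      then have "2 * \<Lambda>' * ((?a \<sigma> * ?h) * \<bar>D \<sigma>\<bar>) \<le> 2 * \<Lambda>' * ((A * vol K) * (B * (?T \<sigma> + err K)))"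
        using \<Lambda>'_nonneg by (intro mult_left_mono) auto
      moreover have "\<bar>q \<sigma>\<bar> * (?a \<sigma> * \<bar>D \<sigma>\<bar>) \<le> (2 * \<Lambda>' * ?h) * (?a \<sigma> * \<bar>D \<sigma>\<bar>)"
        using q[OF that] area_nonneg by (intro mult_right_mono) auto
      ultimately show ?thesis by (simp add: abs_mult area_nonneg mult_ac)
    qed
    have "\<bar>u\<bar> \<le> B" using component_le_norm_cart[of "U ?x" i] U_le[of ?x] unfolding u_def by linarith
    then have "\<bar>E2\<bar> \<le> B * (\<Sum>\<sigma>\<in>?E. 2 * \<Lambda>' * ((A * vol K) * (B * (?T \<sigma> + err K))))"
      unfolding E2_def abs_mult using nonneg
      by (intro mult_mono order_trans[OF sum_abs sum_mono] t) auto
    also have "\<dots> = 2 * \<Lambda>' * A * B\<^sup>2 * vol K * ((\<Sum>\<sigma>\<in>?E. ?T \<sigma>) + k * err K)"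
      by (simp add: sum_distrib_left[symmetric] sum.distrib k_def power2_eq_square mult_ac)
    also have "(\<Sum>\<sigma>\<in>?E. ?T \<sigma>) = near_err K"
      unfolding near_err_def by (intro sum.cong) (use True in auto)
    also have "2 * \<Lambda>' * A * B\<^sup>2 * vol K * (near_err K + k * err K) \<le> 2 * \<Lambda>' * A * B\<^sup>2 * vol K * (near_err K + N * err K)"
      using k(2) err_nonneg[of K] \<Lambda>'_nonneg A_nonneg vol_pos[OF K]
      by (intro mult_left_mono add_left_mono mult_right_mono) auto
    finally show ?thesis .
  qed
  moreover have "\<bar>E3\<bar> \<le> CARD('d) * (B ^ 3 * (\<omega> * vol K))"
  proof -
    have "\<bar>E3\<bar> \<le> (\<Sum>j\<in>(UNIV :: 'd set). B ^ 3 * (\<omega> * vol K))"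
      unfolding E3_def
    proof (rule order_trans[OF sum_abs sum_mono])
      show "\<bar>W ?x $ j * I j\<bar> \<le> B ^ 3 * (\<omega> * vol K)" for j
        unfolding abs_mult I_def by (intro mult_mono norm_W_le grad_integral K) (use nonneg in auto)
    qed
    then show ?thesis by simp
  qed
  ultimately have "\<bar>X K + vol K * (W ?x \<bullet> G ?x) + (\<Sum>j\<in>UNIV. W ?x $ j * (\<Sum>\<sigma>\<in>?E. Z K \<sigma> j))\<bar>
    \<le> 4 * \<Lambda>' * C * A * B\<^sup>2 * N\<^sup>2 * vol K * err K + 2 * \<Lambda>' * A * B\<^sup>2 * vol K * (near_err K + N * err K) + CARD('d) * (B ^ 3 * (\<omega> * vol K))"
    by linarith
  then show ?thesis by (simp add: k1_def k2_def algebra_simps)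
qed

section \<open>Summation of the cell estimates over the mesh\<close>

lemma sum_vol_cells_of:
  assumes "\<sigma> \<in> internal_faces M" "L \<in> cells_of M \<sigma>"
  shows "(\<Sum>K\<in>cells_of M \<sigma>. vol K) \<le> 2 * \<theta> * vol L"
proof -
  obtain P Q where PQ: "cells_of M \<sigma> = {P, Q}" "P \<noteq> Q" using internal_face[OF assms(1)] by metis
  have "vol K \<le> \<theta> * vol L" if "K \<in> cells_of M \<sigma>" for K
  proof (cases "K = L")
    case True
    then show ?thesis using \<theta> measure_nonneg[of lebesgue L] mult_right_mono[of 1 \<theta> "vol L"] by simp
  next
    case False
    then show ?thesis using theta2 internal_interface[OF assms(1) that assms(2)] by blast
  qed
  from this[of P] this[of Q] show ?thesis using PQ by simp
qed

text \<open>In the sum over cells and their neighbours the two roles are exchanged: each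
  \<open>L\<close> is met through at most \<open>N\<close> faces, and the volumes around such a face
  are comparable to that of \<open>L\<close> by \<open>theta2\<close>.\<close>

lemma sum_near_err:
  "(\<Sum>K\<in>cells M. vol K * near_err K) \<le> 2 * \<theta> * N * (\<Sum>L\<in>cells M. vol L * (err L + \<omega>))"
proof -
  define g where "g \<sigma> K L = (if \<sigma> \<in> internal_faces M then vol K * (err L + \<omega>) else 0)" for \<sigma> and K L :: "(real^'d) set"
  have e: "err L + \<omega> \<ge> 0" for L using err_nonneg[of L] nonneg by linarith
  have "vol K * near_err K = (\<Sum>\<sigma>\<in>faces M K. \<Sum>L\<in>cells_of M \<sigma>. g \<sigma> K L)" if "K \<in> cells M" for K
  proof -
    have "(\<Sum>\<sigma>\<in>faces M K. \<Sum>L\<in>cells_of M \<sigma>. g \<sigma> K L) = (\<Sum>\<sigma>\<in>faces M K. if \<sigma> \<in> internal_faces M then vol K * (\<Sum>L\<in>cells_of M \<sigma>. err L + \<omega>) else 0)"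
      by (intro sum.cong refl) (simp add: g_def sum_distrib_left)
    then show ?thesis
      unfolding near_err_def by (simp add: sum.inter_filter[OF cell(6)[OF that]] sum_distrib_left if_distrib cong: if_cong)
  qed
  then have "(\<Sum>K\<in>cells M. vol K * near_err K) = (\<Sum>K\<in>cells M. \<Sum>\<sigma>\<in>faces M K. \<Sum>L\<in>cells_of M \<sigma>. g \<sigma> K L)"
    by (rule sum.cong[OF refl])
  also have "\<dots> = (\<Sum>\<sigma>\<in>all_faces M. \<Sum>K\<in>cells_of M \<sigma>. \<Sum>L\<in>cells_of M \<sigma>. g \<sigma> K L)"
    by (rule sum_all_faces[symmetric])
  also have "\<dots> = (\<Sum>\<sigma>\<in>all_faces M. \<Sum>L\<in>cells_of M \<sigma>. \<Sum>K\<in>cells_of M \<sigma>. g \<sigma> K L)"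
    by (rule sum.cong[OF refl]) (rule sum.swap)
  also have "\<dots> \<le> (\<Sum>\<sigma>\<in>all_faces M. \<Sum>L\<in>cells_of M \<sigma>. 2 * \<theta> * vol L * (err L + \<omega>))"
  proof (intro sum_mono)
    fix \<sigma> L assume L: "L \<in> cells_of M \<sigma>"
    show "(\<Sum>K\<in>cells_of M \<sigma>. g \<sigma> K L) \<le> 2 * \<theta> * vol L * (err L + \<omega>)"
    proof (cases "\<sigma> \<in> internal_faces M")
      case True
      then show ?thesis using mult_right_mono[OF sum_vol_cells_of[OF True L] e[of L]] by (simp add: g_def sum_distrib_right)
    next
      case False
      then show ?thesis using \<theta> e by (simp add: g_def)
    qed
  qed
  also have "\<dots> = (\<Sum>L\<in>cells M. \<Sum>\<sigma>\<in>faces M L. 2 * \<theta> * vol L * (err L + \<omega>))"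
    by (rule sum_all_faces)
  also have "\<dots> \<le> (\<Sum>L\<in>cells M. N * (2 * \<theta> * vol L * (err L + \<omega>)))"
    using card_le \<theta> e by (intro sum_mono) (auto intro!: mult_right_mono)
  also have "\<dots> = 2 * \<theta> * N * (\<Sum>L\<in>cells M. vol L * (err L + \<omega>))"
    unfolding sum_distrib_left by (intro sum.cong refl) (simp only: ac_simps)
  finally show ?thesis .
qed

text \<open>At an internal face the two contributions cancel by \<open>Z_opposite\<close>, as
  \<open>V \<sigma>\<close> is the same from both sides; at any other face \<open>Z\<close>
  vanishes.\<close>

lemma sum_Z_faces:
  "(\<Sum>K\<in>cells M. \<Sum>\<sigma>\<in>faces M K. \<Sum>j\<in>UNIV. V \<sigma> $ j * Z K \<sigma> j) = 0"
proof -
  have "(\<Sum>K\<in>cells_of M \<sigma>. \<Sum>j\<in>UNIV. V \<sigma> $ j * Z K \<sigma> j) = 0" for \<sigma>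
  proof (cases "\<sigma> \<in> internal_faces M")
    case True
    obtain P Q where PQ: "cells_of M \<sigma> = {P, Q}" "P \<noteq> Q" using internal_face[OF True] by metis
    then have "P \<in> cells_of M \<sigma>" "Q \<in> cells_of M \<sigma>" by auto
    then have "Z Q \<sigma> j = - Z P \<sigma> j" for j using PQ(2) by (intro Z_opposite) (auto simp: cells_of_def)
    then show ?thesis using PQ by (simp add: sum_negf)
  next
    case False
    have "Z K \<sigma> j = 0" if "K \<in> cells_of M \<sigma>" for K j
      using False that by (intro Z_boundary) (auto simp: cells_of_def)
    then show ?thesis by simp
  qed
  then show ?thesis using sum_all_faces[of "\<lambda>K \<sigma>. \<Sum>j\<in>UNIV. V \<sigma> $ j * Z K \<sigma> j"] by simp
qed

text \<open>By \<open>sum_Z_faces\<close> the value of \<open>W\<close> at a point of the face may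
  be subtracted. A difference of \<open>W\<close> of size at most \<open>\<omega>\<close> times a
  term of the order of the volume remains.\<close>

lemma sum_Z_cells:
  "\<bar>\<Sum>K\<in>cells M. \<Sum>j\<in>UNIV. W (xc K) $ j * (\<Sum>\<sigma>\<in>faces M K. Z K \<sigma> j)\<bar>
    \<le> N * CARD('d) * (2 * \<Lambda>' * A) * (\<Sum>K\<in>cells M. vol K * \<omega>)"
proof -
  \<comment> \<open>The point must depend on the face alone, so that both cells use the same
    one.\<close>
  define y where "y \<sigma> = (SOME p. p \<in> \<sigma>)" for \<sigma> :: "(real^'d) set"
  have y: "y \<sigma> \<in> \<sigma>" if "K \<in> cells M" "\<sigma> \<in> faces M K" for K \<sigma>
    unfolding y_def using face_nonempty[OF that] by (simp add: some_in_eq)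
  have t: "\<bar>(W (xc K) - W (y \<sigma>)) $ j * Z K \<sigma> j\<bar> \<le> 2 * \<Lambda>' * A * (vol K * \<omega>)"
    if K: "K \<in> cells M" "\<sigma> \<in> faces M K" for K \<sigma> j
  proof -
    have "y \<sigma> \<in> closure K" using y[OF K] face_subset[OF K] by blast
    moreover have "closure K \<subseteq> closure \<Omega>" using cell(1)[OF K(1)] by (rule closure_mono)
    moreover note xc_closure[OF K(1)]
    moreover have "dist (xc K) (y \<sigma>) \<le> 2 * mesh_size M"
      using dist_cell_closure[OF K(1) xc_closure[OF K(1)] calculation(1)] diameter_le_mesh_size[OF K(1)] diameter_pos[OF K(1)] by linarith
    ultimately have "norm (W (xc K) - W (y \<sigma>)) \<le> \<omega>" unfolding W_def by (intro modulus(2)) auto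
    then have w: "\<bar>(W (xc K) - W (y \<sigma>)) $ j\<bar> \<le> \<omega>" using component_le_norm_cart order_trans by blast
    show ?thesis
    proof (cases "interior_cell K")
      case True
      then have "\<bar>Z K \<sigma> j\<bar> \<le> 2 * \<Lambda>' * A * vol K" using Z_le K by blast
      then have "\<bar>(W (xc K) - W (y \<sigma>)) $ j\<bar> * \<bar>Z K \<sigma> j\<bar> \<le> \<omega> * (2 * \<Lambda>' * A * vol K)"
        using w nonneg by (intro mult_mono) auto
      then show ?thesis by (simp add: abs_mult mult_ac)
    next
      case False
      then show ?thesis using Z_boundary[OF K(1) False K(2)] nonneg \<Lambda>'_nonneg A_nonneg by simp
    qed
  qed
  have "(\<Sum>K\<in>cells M. \<Sum>j\<in>UNIV. W (xc K) $ j * (\<Sum>\<sigma>\<in>faces M K. Z K \<sigma> j))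
     = (\<Sum>K\<in>cells M. \<Sum>\<sigma>\<in>faces M K. \<Sum>j\<in>UNIV. W (xc K) $ j * Z K \<sigma> j)"
    unfolding sum_distrib_left by (intro sum.cong refl) (rule sum.swap)
  also have "\<dots> = (\<Sum>K\<in>cells M. \<Sum>\<sigma>\<in>faces M K. \<Sum>j\<in>UNIV. W (xc K) $ j * Z K \<sigma> j)
      - (\<Sum>K\<in>cells M. \<Sum>\<sigma>\<in>faces M K. \<Sum>j\<in>UNIV. W (y \<sigma>) $ j * Z K \<sigma> j)"
    using sum_Z_faces[of "\<lambda>\<sigma>. W (y \<sigma>)"] by simp
  also have "\<dots> = (\<Sum>K\<in>cells M. \<Sum>\<sigma>\<in>faces M K. \<Sum>j\<in>UNIV. (W (xc K) - W (y \<sigma>)) $ j * Z K \<sigma> j)"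
    by (simp add: sum_subtractf left_diff_distrib)
  also have "\<bar>\<dots>\<bar> \<le> (\<Sum>K\<in>cells M. \<Sum>\<sigma>\<in>faces M K. \<Sum>j\<in>(UNIV :: 'd set). 2 * \<Lambda>' * A * (vol K * \<omega>))"
    by (rule order_trans[OF sum_abs sum_mono], rule order_trans[OF sum_abs sum_mono], rule order_trans[OF sum_abs sum_mono]) (rule t)
  also have "\<dots> \<le> (\<Sum>K\<in>cells M. N * (CARD('d) * (2 * \<Lambda>' * A * (vol K * \<omega>))))"
    using card_le \<Lambda>'_nonneg A_nonneg nonneg by (intro sum_mono) (auto intro!: mult_right_mono)
  also have "\<dots> = N * CARD('d) * (2 * \<Lambda>' * A) * (\<Sum>K\<in>cells M. vol K * \<omega>)"
    unfolding sum_distrib_left by (intro sum.cong refl) (simp only: ac_simps)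
  finally show ?thesis .
qed

definition \<kappa> :: real where
  "\<kappa> = k1 + k2 * (2 * \<theta> * N) + CARD('d) * B ^ 3 + N * CARD('d) * (2 * \<Lambda>' * A)"

text \<open>The \<open>Z\<close> terms are added and subtracted: together with them each cell obeys
  \<open>cell_estimate\<close>, and their total is bounded by \<open>sum_Z_cells\<close>.\<close>

theorem space_estimate:
  "\<bar>(\<Sum>\<sigma>\<in>all_faces M. mean \<phi> \<sigma> * (\<Sum>\<epsilon>\<in>dual_faces M \<sigma>. dual_flux S n \<sigma> \<epsilon> * dual_velocity S n \<epsilon> $ i))
     + (\<Sum>K\<in>cells M. vol K * (W (xc K) \<bullet> G (xc K)))\<bar>
   \<le> \<kappa> * (\<Sum>K\<in>cells M. vol K * (err K + \<omega>))"
proof -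
  let ?Z = "\<lambda>K. \<Sum>j\<in>UNIV. W (xc K) $ j * (\<Sum>\<sigma>\<in>faces M K. Z K \<sigma> j)"
  let ?E = "\<Sum>K\<in>cells M. vol K * err K" and ?V = "\<Sum>K\<in>cells M. vol K * \<omega>" and ?S = "\<Sum>K\<in>cells M. vol K * (err K + \<omega>)"
  have ES: "?E + ?V = ?S" "?E \<ge> 0" "?V \<ge> 0" using err_nonneg nonneg
    by (auto simp: sum.distrib distrib_left intro!: sum_nonneg)
  have "(\<Sum>\<sigma>\<in>all_faces M. mean \<phi> \<sigma> * (\<Sum>\<epsilon>\<in>dual_faces M \<sigma>. dual_flux S n \<sigma> \<epsilon> * dual_velocity S n \<epsilon> $ i)) = (\<Sum>K\<in>cells M. X K)"
  proof -
    let ?f = "\<lambda>K \<sigma>. mean \<phi> \<sigma> * (\<Sum>\<epsilon>\<in>{\<epsilon>\<in>dual_faces M \<sigma>. fst \<epsilon> = K}. dual_flux S n \<sigma> \<epsilon> * dual_velocity S n \<epsilon> $ i)"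
    have "mean \<phi> \<sigma> * (\<Sum>\<epsilon>\<in>dual_faces M \<sigma>. dual_flux S n \<sigma> \<epsilon> * dual_velocity S n \<epsilon> $ i) = (\<Sum>K\<in>cells_of M \<sigma>. ?f K \<sigma>)" for \<sigma>
      by (subst sum_dual_faces) (rule sum_distrib_left)
    then have "(\<Sum>\<sigma>\<in>all_faces M. mean \<phi> \<sigma> * (\<Sum>\<epsilon>\<in>dual_faces M \<sigma>. dual_flux S n \<sigma> \<epsilon> * dual_velocity S n \<epsilon> $ i))
      = (\<Sum>\<sigma>\<in>all_faces M. \<Sum>K\<in>cells_of M \<sigma>. ?f K \<sigma>)" by (rule sum.cong[OF refl])
    also have "\<dots> = (\<Sum>K\<in>cells M. \<Sum>\<sigma>\<in>faces M K. ?f K \<sigma>)" by (rule sum_all_faces)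
    finally show ?thesis unfolding X_def .
  qed
  then have eq: "(\<Sum>\<sigma>\<in>all_faces M. mean \<phi> \<sigma> * (\<Sum>\<epsilon>\<in>dual_faces M \<sigma>. dual_flux S n \<sigma> \<epsilon> * dual_velocity S n \<epsilon> $ i))
     + (\<Sum>K\<in>cells M. vol K * (W (xc K) \<bullet> G (xc K)))
     = (\<Sum>K\<in>cells M. X K + vol K * (W (xc K) \<bullet> G (xc K)) + ?Z K) - (\<Sum>K\<in>cells M. ?Z K)"
    by (simp add: sum.distrib)
  have 1: "\<bar>\<Sum>K\<in>cells M. X K + vol K * (W (xc K) \<bullet> G (xc K)) + ?Z K\<bar>
       \<le> (\<Sum>K\<in>cells M. vol K * (k1 * err K + k2 * near_err K + CARD('d) * B ^ 3 * \<omega>))"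
    by (rule order_trans[OF sum_abs]) (intro sum_mono cell_estimate)
  have "vol K * (k1 * err K + k2 * near_err K + CARD('d) * B ^ 3 * \<omega>)
     = k1 * (vol K * err K) + k2 * (vol K * near_err K) + CARD('d) * B ^ 3 * (vol K * \<omega>)" for K
    by (simp only: distrib_left ac_simps)
  then have 2: "(\<Sum>K\<in>cells M. vol K * (k1 * err K + k2 * near_err K + CARD('d) * B ^ 3 * \<omega>))
     = k1 * ?E + k2 * (\<Sum>K\<in>cells M. vol K * near_err K) + CARD('d) * B ^ 3 * ?V"
    unfolding sum_distrib_left sum.distrib[symmetric] by simp
  have 3: "k1 * ?E \<le> k1 * ?S" "CARD('d) * B ^ 3 * ?V \<le> CARD('d) * B ^ 3 * ?S"
     "N * CARD('d) * (2 * \<Lambda>' * A) * ?V \<le> N * CARD('d) * (2 * \<Lambda>' * A) * ?S"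
    using ES k_nonneg N \<Lambda>'_nonneg A_nonneg nonneg by (intro mult_left_mono; simp)+
  have 4: "k2 * (\<Sum>K\<in>cells M. vol K * near_err K) \<le> k2 * (2 * \<theta> * N * ?S)"
    by (intro mult_left_mono sum_near_err k_nonneg)
  have "\<kappa> * ?S = k1 * ?S + k2 * (2 * \<theta> * N * ?S) + CARD('d) * B ^ 3 * ?S + N * CARD('d) * (2 * \<Lambda>' * A) * ?S"
    unfolding \<kappa>_def by (simp only: distrib_right mult.assoc)
  then show ?thesis unfolding eq using 1 2 3 4 sum_Z_cells by linarith
qed

end

section \<open>Integration and test functions\<close>

text \<open>Fubini for the completed measure. A Borel function \<open>g\<close> equal to
  \<open>f\<close> almost everywhere obeys Fubini on the product, and for almost every
  \<open>t\<close> the sections of \<open>f\<close> and \<open>g\<close> agree almost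
  everywhere.\<close>

lemma iterated_lebesgue_integral:
  fixes f :: "'a::euclidean_space \<times> 'b::euclidean_space \<Rightarrow> real"
  assumes f: "integrable lebesgue f"
  shows "(LINT t|lebesgue. (LINT x|lebesgue. f (x, t))) = (LINT z|lebesgue. f z)"
proof -
  obtain g where g: "g \<in> borel_measurable lborel" and ae: "AE z in lborel. f z = g z"
    using completion_ex_borel_measurable_real[OF borel_measurable_integrable[OF f]] by blast
  have ae': "AE z in lebesgue. f z = g z" using ae by (rule AE_completion)
  have gb[measurable]: "g \<in> borel_measurable borel" using g by simp
  have gl: "g \<in> borel_measurable lebesgue" using g by (rule measurable_completion)
  have "integrable lebesgue g"
    using f integrable_cong_AE[OF borel_measurable_integrable[OF f] gl ae'] by blast
  then have ig: "integrable lborel g" by (simp add: integrable_completion g)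
  have sp: "lborel \<Otimes>\<^sub>M lborel = (lborel :: ('a \<times> 'b) measure)" by (rule lborel_prod)
  have gp[measurable]: "g \<in> borel_measurable (lborel \<Otimes>\<^sub>M lborel)" unfolding sp using g .
  \<comment> \<open>The set where \<open>f\<close> and \<open>g\<close> differ need not be Borel; a
    Borel null set containing it has null sections almost everywhere.\<close>
  obtain N where N: "N \<in> null_sets lborel" "{z \<in> space lborel. f z \<noteq> g z} \<subseteq> N"
    using ae unfolding eventually_ae_filter by blast
  have Np: "N \<in> sets (lborel \<Otimes>\<^sub>M lborel)" unfolding sp using N(1) by auto
  have "AE z in lborel \<Otimes>\<^sub>M lborel. z \<notin> N" unfolding sp using N(1) by (rule AE_not_in)
  then have "AE x in lborel. AE t in lborel. (x, t) \<notin> N" by (rule lborel_pair.AE_pair)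
  moreover have "{z \<in> space (lborel \<Otimes>\<^sub>M lborel). (fst z, snd z) \<notin> N} \<in> sets (lborel \<Otimes>\<^sub>M lborel)"
  proof -
    have "{z \<in> space (lborel \<Otimes>\<^sub>M lborel). (fst z, snd z) \<notin> N} = space (lborel \<Otimes>\<^sub>M lborel) - N" by auto
    then show ?thesis using sets.compl_sets[OF Np] by simp
  qed
  ultimately have "AE t in lborel. AE x in lborel. (x, t) \<notin> N"
    by (subst (asm) lborel_pair.AE_commute)
  then have sec: "AE t in lborel. AE x in lborel. f (x, t) = g (x, t)"
    by (rule eventually_mono) (erule eventually_mono, use N(2) in auto)
  have inner: "(LINT x|lebesgue. f (x, t)) = (LINT x|lborel. g (x, t))"
    if t: "AE x in lborel. f (x, t) = g (x, t)" for t
  proof -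
    have gt: "(\<lambda>x. g (x, t)) \<in> borel_measurable lborel" by measurable
    then have gt': "(\<lambda>x. g (x, t)) \<in> borel_measurable lebesgue" by (rule measurable_completion)
    have ae_t: "AE x in lebesgue. f (x, t) = g (x, t)" using t by (rule AE_completion)
    then have "AE x in lebesgue. g (x, t) = f (x, t)" by eventually_elim simp
    then have "(\<lambda>x. f (x, t)) \<in> borel_measurable lebesgue"
      by (rule borel_measurable_AE[OF gt'])
    then have "(LINT x|lebesgue. f (x, t)) = (LINT x|lebesgue. g (x, t))"
      using ae_t gt' by (intro integral_cong_AE)
    also have "\<dots> = (LINT x|lborel. g (x, t))" using gt by (rule integral_completion)
    finally show ?thesis .
  qed
  have k: "(\<lambda>t. LINT x|lborel. g (x, t)) \<in> borel_measurable lborel" by measurable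
  then have k': "(\<lambda>t. LINT x|lborel. g (x, t)) \<in> borel_measurable lebesgue" by (rule measurable_completion)
  have ae_k: "AE t in lebesgue. (LINT x|lborel. g (x, t)) = (LINT x|lebesgue. f (x, t))"
    by (rule AE_completion) (use sec in \<open>eventually_elim, use inner in simp\<close>)
  have "(LINT t|lebesgue. (LINT x|lebesgue. f (x, t))) = (LINT t|lebesgue. (LINT x|lborel. g (x, t)))"
    by (rule integral_cong_AE[OF borel_measurable_AE[OF k' ae_k] k']) (use ae_k in \<open>eventually_elim, simp\<close>)
  also have "\<dots> = (LINT t|lborel. (LINT x|lborel. g (x, t)))" using k by (rule integral_completion)
  also have "\<dots> = (LINT z|(lborel \<Otimes>\<^sub>M lborel). g z)"
    using lborel_pair.integral_snd[of "\<lambda>x t. g (x, t)"] ig unfolding sp by simp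
  also have "\<dots> = (LINT z|lebesgue. g z)" unfolding sp using g by (rule integral_completion[symmetric])
  also have "\<dots> = (LINT z|lebesgue. f z)"
    by (rule integral_cong_AE[OF gl borel_measurable_integrable[OF f]]) (use ae' in \<open>auto elim: eventually_mono\<close>)
  finally show ?thesis .
qed

text \<open>\<open>A\<close> is a Borel set up to part of a Borel null set, and the product of a
  null set with an interval is null. The product formula for Borel sets therefore passes to the
  completion.\<close>

lemma lmeasurable_Times_interval:
  fixes A :: "'a::euclidean_space set" and a b :: real
  assumes A: "A \<in> lmeasurable" and ab: "a \<le> b"
  shows "A \<times> {a<..<b} \<in> lmeasurable" "measure lebesgue (A \<times> {a<..<b}) = measure lebesgue A * (b - a)"
proof -
  obtain B N N' where B: "A = B \<union> N" "N \<subseteq> N'" "N' \<in> null_sets lborel" "B \<in> sets lborel"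
    using A by (auto simp: fmeasurable_def elim: sets_completionE)
  have sp: "lborel \<Otimes>\<^sub>M lborel = (lborel :: ('a \<times> real) measure)" by (rule lborel_prod)
  have I: "{a<..<b} \<in> sets (lborel :: real measure)" by simp
  have null: "N' \<times> {a<..<b} \<in> null_sets lborel"
  proof (rule null_setsI)
    show "N' \<times> {a<..<b} \<in> sets (lborel :: ('a \<times> real) measure)" unfolding sp[symmetric] using B(3) I by (intro pair_measureI) auto
    show "emeasure lborel (N' \<times> {a<..<b}) = 0"
      unfolding sp[symmetric] using B(3) I by (subst lborel.emeasure_pair_measure_Times) auto
  qed
  have Bm: "B \<times> {a<..<b} \<in> sets (lborel :: ('a \<times> real) measure)" unfolding sp[symmetric] using B(4) I by (intro pair_measureI) auto
  have m: "A \<times> {a<..<b} \<in> sets lebesgue"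
  proof (rule sets_completionI)
    show "A \<times> {a<..<b} = (B \<times> {a<..<b}) \<union> (N \<times> {a<..<b})" using B(1) by auto
    show "N \<times> {a<..<b} \<subseteq> N' \<times> {a<..<b}" using B(2) by auto
  qed (use null Bm in auto)
  have nA: "AE x in lborel. x \<notin> N'" using B(3) by (rule AE_not_in)
  have nP: "AE z in lborel. z \<notin> N' \<times> {a<..<b}" using null by (rule AE_not_in)
  have eA: "emeasure lebesgue A = emeasure lborel B"
  proof -
    have "emeasure lebesgue A = emeasure lebesgue B"
      by (rule emeasure_eq_AE[OF AE_completion]) (use nA B A in \<open>auto elim: eventually_mono simp: fmeasurable_def\<close>)
    then show ?thesis using B(4) by simp
  qed
  have "emeasure lebesgue (A \<times> {a<..<b}) = emeasure lebesgue (B \<times> {a<..<b})"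
    by (rule emeasure_eq_AE[OF AE_completion]) (use nP B m Bm in \<open>auto elim: eventually_mono\<close>)
  also have "\<dots> = emeasure (lborel \<Otimes>\<^sub>M lborel) (B \<times> {a<..<b})" unfolding sp using Bm by simp
  also have "\<dots> = emeasure lborel B * emeasure lborel {a<..<b}" using B(4) I by (intro lborel.emeasure_pair_measure_Times)
  finally have e: "emeasure lebesgue (A \<times> {a<..<b}) = emeasure lebesgue A * ennreal (b - a)" using ab eA by simp
  then show "A \<times> {a<..<b} \<in> lmeasurable" using m A by (auto simp: fmeasurable_def ennreal_mult_less_top)
  show "measure lebesgue (A \<times> {a<..<b}) = measure lebesgue A * (b - a)"
    using e ab by (simp add: measure_def enn2real_mult)
qed

lemma set_integrable_bounded:
  fixes f :: "'a::euclidean_space \<Rightarrow> 'b::euclidean_space"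
  assumes "S \<in> lmeasurable" "f \<in> borel_measurable (lebesgue_on S)" "AE x in lebesgue_on S. norm (f x) \<le> c"
  shows "integrable (lebesgue_on S) f"
proof -
  interpret finite_measure "lebesgue_on S"
    using assms(1) by (auto intro!: finite_measureI simp: emeasure_restrict_space fmeasurable_def)
  show ?thesis by (rule integrable_const_bound[of _ c]) (use assms in auto)
qed

text \<open>A measurable function is an almost everywhere limit of continuous functions. Truncating
  these at the bound \<open>c\<close> of \<open>f\<close> does not affect the limit and makes
  dominated convergence applicable.\<close>

lemma L1_continuous_approximation:
  fixes f :: "'a::euclidean_space \<Rightarrow> real"
  assumes S: "S \<in> lmeasurable" and f: "f \<in> borel_measurable (lebesgue_on S)"
    and b: "AE x in lebesgue_on S. \<bar>f x\<bar> \<le> c" and c: "c \<ge> 0" and \<eta>: "\<eta> > 0"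
  obtains g where "continuous_on UNIV g" "\<And>x. \<bar>g x\<bar> \<le> c" "(LINT x|lebesgue_on S. \<bar>f x - g x\<bar>) \<le> \<eta>"
proof -
  have Sm: "S \<in> sets lebesgue" using S by (auto simp: fmeasurable_def)
  have "(\<lambda>x. if x \<in> S then f x else 0) \<in> borel_measurable lebesgue" using f Sm by (simp add: borel_measurable_if)
  then have "(\<lambda>x. if x \<in> S then f x else 0) measurable_on S"
    using Sm by (rule lebesgue_measurable_imp_measurable_on)
  then obtain N h where N: "negligible N" and h': "\<forall>n. continuous_on UNIV (h n)"
    and lim': "\<forall>x. x \<notin> N \<longrightarrow> (\<lambda>n. h n x) \<longlonglongrightarrow> (if x \<in> S then (if x \<in> S then f x else 0) else 0)"
    unfolding measurable_on_def by (elim exE conjE)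
  have h: "continuous_on UNIV (h n)" for n using h' by simp
  have lim: "(\<lambda>n. h n x) \<longlonglongrightarrow> f x" if "x \<notin> N" "x \<in> S" for x using lim' that by (auto split: if_splits)
  define g where "g n x = max (- c) (min c (h n x))" for n :: nat and x
  have g_le: "\<bar>g n x\<bar> \<le> c" for n x unfolding g_def using c by auto
  have gc: "continuous_on UNIV (g n)" for n
    unfolding g_def using h by (intro continuous_on_max continuous_on_min continuous_on_const)
  have gm: "g n \<in> borel_measurable (lebesgue_on S)" for n
    using gc[of n] Sm by (intro continuous_imp_measurable_on_sets_lebesgue) (auto intro: continuous_on_subset)
  have "AE x in lebesgue. x \<notin> N" using N by (intro AE_not_in) (simp add: negligible_iff_null_sets)
  then have aeN: "AE x in lebesgue_on S. x \<notin> N" by (auto simp: AE_restrict_space_iff Sm elim: eventually_mono)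
  interpret finite_measure "lebesgue_on S"
    using S by (auto intro!: finite_measureI simp: emeasure_restrict_space fmeasurable_def)
  have "(\<lambda>n. LINT x|lebesgue_on S. \<bar>f x - g n x\<bar>) \<longlonglongrightarrow> (LINT x|lebesgue_on S. 0)"
  proof (rule integral_dominated_convergence[where w="\<lambda>_. 2 * c"])
    show "AE x in lebesgue_on S. (\<lambda>n. \<bar>f x - g n x\<bar>) \<longlonglongrightarrow> 0"
      using aeN b AE_space
    proof eventually_elim
      case (elim x)
      have "(\<lambda>n. max (- c) (min c (h n x))) \<longlonglongrightarrow> max (- c) (min c (f x))"
        using elim lim[of x] Sm by (intro tendsto_max tendsto_min tendsto_const) (auto simp: space_restrict_space)
      moreover have "max (- c) (min c (f x)) = f x" using elim by auto
      ultimately have "(\<lambda>n. g n x) \<longlonglongrightarrow> f x" by (simp add: g_def)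
      then have "(\<lambda>n. \<bar>f x - g n x\<bar>) \<longlonglongrightarrow> \<bar>f x - f x\<bar>" by (intro tendsto_intros)
      then show ?case by simp
    qed
    show "AE x in lebesgue_on S. norm \<bar>f x - g n x\<bar> \<le> 2 * c" for n
      using b 
    proof eventually_elim
      case (elim x)
      have "\<bar>f x - g n x\<bar> \<le> \<bar>f x\<bar> + \<bar>g n x\<bar>" by (rule abs_triangle_ineq4)
      then show ?case using elim g_le[of n x] by simp
    qed
  qed (use f gm in auto)
  then have "(\<lambda>n. LINT x|lebesgue_on S. \<bar>f x - g n x\<bar>) \<longlonglongrightarrow> 0" by simp
  then have "\<forall>\<^sub>F n in sequentially. (LINT x|lebesgue_on S. \<bar>f x - g n x\<bar>) < \<eta>" using \<eta> by (rule order_tendstoD)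
  then obtain n where "(LINT x|lebesgue_on S. \<bar>f x - g n x\<bar>) < \<eta>" by (auto simp: eventually_sequentially)
  then show thesis using that[OF gc g_le, of n] by simp
qed

text \<open>Turns an \<open>L\<^sup>1\<close> distance between a step function and a slowly varying
  one into the weighted sum of errors at sample values: the triangle inequality is integrated over
  each piece.\<close>

lemma step_function_L1:
  fixes g \<psi> :: "'a::euclidean_space \<Rightarrow> 'b::euclidean_space" and c :: "'i \<Rightarrow> 'b"
  assumes I: "finite I" and E: "\<And>a. a \<in> I \<Longrightarrow> E a \<in> lmeasurable" "disjoint_family_on E I" "\<And>a. a \<in> I \<Longrightarrow> E a \<subseteq> X"
    and X: "X \<in> lmeasurable" and \<omega>: "\<omega> \<ge> 0"
    and i: "integrable (lebesgue_on X) (\<lambda>z. norm (g z - \<psi> z))"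
    and g: "\<And>a z. a \<in> I \<Longrightarrow> z \<in> E a \<Longrightarrow> g z = c a"
    and \<psi>: "\<And>a z. a \<in> I \<Longrightarrow> z \<in> E a \<Longrightarrow> norm (\<psi> z - p a) \<le> \<omega>"
  shows "(\<Sum>a\<in>I. measure lebesgue (E a) * norm (c a - p a))
    \<le> (LINT z|lebesgue_on X. norm (g z - \<psi> z)) + \<omega> * measure lebesgue X"
proof -
  have Em: "E a \<in> sets lebesgue" if "a \<in> I" for a using E(1)[OF that] by (auto simp: fmeasurable_def)
  have Xm: "X \<in> sets lebesgue" using X by (auto simp: fmeasurable_def)
  have iX: "set_integrable lebesgue X (\<lambda>z. norm (g z - \<psi> z))"
    using i Xm by (simp add: set_integrable_def integrable_restrict_space)
  have cX: "set_integrable lebesgue S (\<lambda>_. k)" "(LINT y:S|lebesgue. k) = k * measure lebesgue S"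
    if "S \<in> lmeasurable" for S and k :: real
    using that by (auto simp: set_integrable_def set_lebesgue_integral_def fmeasurable_def mult.commute)
  let ?h = "\<lambda>z. norm (g z - \<psi> z) + \<omega>"
  have hX: "set_integrable lebesgue X ?h" by (rule set_integral_add(1)[OF iX cX(1)[OF X]])
  have hE: "set_integrable lebesgue (E a) ?h" if "a \<in> I" for a
    by (rule set_integrable_subset[OF hX]) (use Em E(3) that in auto)
  have "measure lebesgue (E a) * norm (c a - p a) \<le> (LINT z:E a|lebesgue. ?h z)" if a: "a \<in> I" for a
  proof -
    have "(LINT z:E a|lebesgue. norm (c a - p a)) \<le> (LINT z:E a|lebesgue. ?h z)"
    proof (rule set_integral_mono[OF cX(1)[OF E(1)[OF a]] hE[OF a]])
      fix z assume z: "z \<in> E a"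
      have "norm (c a - p a) \<le> norm (g z - \<psi> z) + norm (\<psi> z - p a)"
        unfolding g[OF a z] by (metis diff_add_cancel diff_diff_eq2 norm_triangle_ineq add_diff_eq)
      then show "norm (c a - p a) \<le> ?h z" using \<psi>[OF a z] by linarith
    qed
    then show ?thesis using cX(2)[OF E(1)[OF a]] by (simp add: mult.commute)
  qed
  then have "(\<Sum>a\<in>I. measure lebesgue (E a) * norm (c a - p a)) \<le> (\<Sum>a\<in>I. LINT z:E a|lebesgue. ?h z)"
    by (rule sum_mono)
  also have "\<dots> = (LINT z:(\<Union>a\<in>I. E a)|lebesgue. ?h z)"
    by (rule set_integral_finite_Union[symmetric]) (use I E(2) hE Em in auto)
  also have "\<dots> \<le> (LINT z:X|lebesgue. ?h z)"
    unfolding set_lebesgue_integral_def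
  proof (rule integral_mono)
    have "set_integrable lebesgue (\<Union>a\<in>I. E a) ?h"
      by (rule set_integrable_subset[OF hX]) (use I Em E(3) in auto)
    then show "integrable lebesgue (\<lambda>z. indicat_real (\<Union>a\<in>I. E a) z *\<^sub>R ?h z)" by (simp add: set_integrable_def)
    show "integrable lebesgue (\<lambda>z. indicat_real X z *\<^sub>R ?h z)" using hX by (simp add: set_integrable_def)
    show "indicat_real (\<Union>a\<in>I. E a) z *\<^sub>R ?h z \<le> indicat_real X z *\<^sub>R ?h z" for z
      using \<omega> E(3) by (auto simp: indicator_def)
  qed
  also have "\<dots> = (LINT z|lebesgue_on X. norm (g z - \<psi> z)) + \<omega> * measure lebesgue X"
    using set_integral_add(2)[OF iX cX(1)[OF X, of \<omega>]] cX(2)[OF X, of \<omega>] Xm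
    by (simp add: set_lebesgue_integral_def integral_restrict_space)
  finally show ?thesis .
qed

lemma riemann_sum_close:
  fixes f :: "'a::euclidean_space \<Rightarrow> real"
  assumes I: "finite I" and E: "\<And>a. a \<in> I \<Longrightarrow> E a \<in> lmeasurable" "disjoint_family_on E I" "\<And>a. a \<in> I \<Longrightarrow> E a \<subseteq> X"
    and X: "X \<in> lmeasurable" and cover: "negligible (X - (\<Union>a\<in>I. E a))"
    and i: "set_integrable lebesgue X f" and \<omega>: "\<omega> \<ge> 0"
    and f: "\<And>a z. a \<in> I \<Longrightarrow> z \<in> E a \<Longrightarrow> \<bar>f z - p a\<bar> \<le> \<omega>"
  shows "\<bar>(\<Sum>a\<in>I. measure lebesgue (E a) * p a) - (LINT z:X|lebesgue. f z)\<bar> \<le> \<omega> * measure lebesgue X"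
proof -
  have Em: "E a \<in> sets lebesgue" if "a \<in> I" for a using E(1)[OF that] by (auto simp: fmeasurable_def)
  have iE: "set_integrable lebesgue (E a) f" if "a \<in> I" for a
    by (rule set_integrable_subset[OF i]) (use Em E(3) that in auto)
  have U: "(\<Union>a\<in>I. E a) \<in> sets lebesgue" using I Em by auto
  have ae: "AE z in lebesgue. z \<in> X \<longleftrightarrow> z \<in> (\<Union>a\<in>I. E a)"
    using AE_not_in[OF cover[unfolded negligible_iff_null_sets]] by eventually_elim (use E(3) in blast)
  have mU: "measure lebesgue (\<Union>a\<in>I. E a) = (\<Sum>a\<in>I. measure lebesgue (E a))"
    by (rule measure_finite_Union) (use I E(1,2) Em in \<open>auto simp: fmeasurable_def less_top[symmetric]\<close>)
  have mX: "measure lebesgue (\<Union>a\<in>I. E a) \<le> measure lebesgue X"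
    by (rule measure_mono_fmeasurable) (use E(3) U X in auto)
  have "(LINT z:X|lebesgue. f z) = (LINT z:(\<Union>a\<in>I. E a)|lebesgue. f z)"
  proof (rule set_integral_cong_set)
    have "set_integrable lebesgue (\<Union>a\<in>I. E a) f" by (rule set_integrable_subset[OF i U]) (use E(3) in auto)
    then show "set_borel_measurable lebesgue (\<Union>a\<in>I. E a) f" "set_borel_measurable lebesgue X f"
      using i unfolding set_integrable_def set_borel_measurable_def by (auto intro: borel_measurable_integrable)
  qed (use ae in \<open>auto elim: eventually_mono\<close>)
  also have "\<dots> = (\<Sum>a\<in>I. LINT z:E a|lebesgue. f z)"
    by (rule set_integral_finite_Union) (use I E(2) iE Em in auto)
  finally have "(\<Sum>a\<in>I. measure lebesgue (E a) * p a) - (LINT z:X|lebesgue. f z)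
    = (\<Sum>a\<in>I. - ((LINT z:E a|lebesgue. f z) - p a * measure lebesgue (E a)))"
    by (simp add: sum_subtractf mult.commute)
  also have "\<bar>\<dots>\<bar> \<le> (\<Sum>a\<in>I. \<omega> * measure lebesgue (E a))"
    by (rule order_trans[OF sum_abs], rule sum_mono, unfold abs_minus_cancel, rule set_integral_close)
      (use E(1) iE f in auto)
  also have "\<dots> \<le> \<omega> * measure lebesgue X"
    using mX \<omega> unfolding mU sum_distrib_left[symmetric] by (intro mult_left_mono)
  finally show ?thesis .
qed

section \<open>Test functions: uniform continuity, bounds and increments\<close>

lemma compact_support_uniformly_continuous:
  fixes g :: "'a::euclidean_space \<Rightarrow> real"
  assumes g: "continuous_on UNIV g" and C: "compact C" "\<And>z. z \<notin> C \<Longrightarrow> g z = 0" and \<eta>: "\<eta> > 0"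
  obtains \<delta> where "\<delta> > 0" "\<And>z z'. dist z z' < \<delta> \<Longrightarrow> \<bar>g z - g z'\<bar> < \<eta>"
proof -
  obtain R where "C \<subseteq> ball 0 R" using bounded_subset_ballD[OF compact_imp_bounded[OF C(1)]] by blast
  then have R: "C \<subseteq> cball 0 R" by auto
  \<comment> \<open>The extra 1 in the radius matches the cap \<open>min \<delta> 1\<close> below:
    if one of two close points is in \<open>C\<close>, both are in this ball.\<close>
  have "uniformly_continuous_on (cball 0 (R + 1)) g"
    by (intro compact_uniformly_continuous continuous_on_subset[OF g subset_UNIV] compact_cball)
  then obtain \<delta> where d: "\<delta> > 0"
    "\<And>z z'. z \<in> cball 0 (R + 1) \<Longrightarrow> z' \<in> cball 0 (R + 1) \<Longrightarrow> dist z' z < \<delta> \<Longrightarrow> dist (g z') (g z) < \<eta>"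
    using \<eta> unfolding uniformly_continuous_on_def by metis
  show thesis
  proof (rule that[of "min \<delta> 1"])
    fix z z' :: 'a assume zz: "dist z z' < min \<delta> 1"
    show "\<bar>g z - g z'\<bar> < \<eta>"
    proof (cases "z \<in> C \<or> z' \<in> C")
      case True
      then have "norm z \<le> R \<or> norm z' \<le> R" using R by auto
      then have "z \<in> cball 0 (R + 1)" "z' \<in> cball 0 (R + 1)"
        using zz norm_triangle_ineq2[of z z'] norm_triangle_ineq2[of z' z] by (auto simp: dist_norm norm_minus_commute)
      then show ?thesis using d(2)[of z' z] zz by (simp add: dist_real_def)
    next
      case False
      then show ?thesis using C(2) \<eta> by simp
    qed
  qed (use d in auto)
qed

lemma compact_support_bounded:
  fixes g :: "'a::euclidean_space \<Rightarrow> real"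
  assumes g: "continuous_on UNIV g" and C: "compact C" "\<And>z. z \<notin> C \<Longrightarrow> g z = 0"
  obtains c where "c \<ge> 0" "\<And>z. \<bar>g z\<bar> \<le> c"
proof -
  have "bounded (g ` C)" using g C(1) by (intro compact_imp_bounded compact_continuous_image continuous_on_subset[OF g subset_UNIV])
  then obtain c where "\<And>z. z \<in> C \<Longrightarrow> \<bar>g z\<bar> \<le> c" unfolding bounded_iff by auto
  then have "\<bar>g z\<bar> \<le> max c 0" for z using C(2)[of z] by (cases "z \<in> C") (auto simp: le_max_iff_disj)
  then show thesis using that[of "max c 0"] by simp
qed

locale test_function =
  fixes X :: "'a::euclidean_space set" and \<phi> :: "'a \<Rightarrow> real"
  assumes \<phi>: "\<phi> \<in> test_functions X" and X: "open X"
begin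

definition supp :: "'a set" where "supp = closure {z. \<phi> z \<noteq> 0}"

abbreviation pd :: "'a \<Rightarrow> 'a \<Rightarrow> real" where "pd b z \<equiv> frechet_derivative \<phi> (at z) b"

lemma compact_supp: "compact supp" and supp_subset: "supp \<subseteq> X"
  using \<phi> by (auto simp: test_functions_def supp_def)

lemma differentiable: "\<phi> differentiable (at z)" and pd_continuous: "b \<in> Basis \<Longrightarrow> continuous_on UNIV (pd b)"
proof -
  have "Ck (Suc 0) \<phi>" using \<phi> by (simp add: test_functions_def del: Ck.simps)
  then show "\<phi> differentiable (at z)" "b \<in> Basis \<Longrightarrow> continuous_on UNIV (pd b)" by auto
qed

lemma has_derivative: "(\<phi> has_derivative frechet_derivative \<phi> (at z)) (at z)"
  using differentiable frechet_derivative_works by blast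

lemma continuous: "continuous_on UNIV \<phi>"
  using has_derivative by (intro has_derivative_continuous_on[of UNIV \<phi>]) (auto intro: has_derivative_at_withinI)

lemma zero_outside: "z \<notin> supp \<Longrightarrow> \<phi> z = 0"
  using closure_subset[of "{z. \<phi> z \<noteq> 0}"] unfolding supp_def by blast

lemma pd_zero_outside: assumes "z \<notin> supp" shows "pd b z = 0"
proof -
  have "((\<lambda>_. 0) has_derivative (\<lambda>_. 0)) (at z)" by simp
  then have "(\<phi> has_derivative (\<lambda>_. 0)) (at z)"
  proof (rule has_derivative_transform_within_open)
    show "open (- supp)" unfolding supp_def by (intro open_Compl closed_closure)
    show "0 = \<phi> y" if "y \<in> - supp" for y using zero_outside that by simp
  qed (use assms in simp)
  then have "frechet_derivative \<phi> (at z) = (\<lambda>_. 0)" by (rule frechet_derivative_at[symmetric])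
  then show ?thesis by simp
qed

lemma vanish_near_boundary:
  obtains \<delta> where "\<delta> > 0" "\<And>z q. q \<notin> X \<Longrightarrow> dist z q < \<delta> \<Longrightarrow> z \<notin> supp"
proof -
  obtain \<delta> where d: "\<delta> > 0" "(\<Union>z\<in>supp. ball z \<delta>) \<subseteq> X"
    using compact_subset_open_imp_ball_epsilon_subset[OF compact_supp X supp_subset] by blast
  have "z \<notin> supp" if "q \<notin> X" "dist z q < \<delta>" for z q 
  proof
    assume "z \<in> supp"
    moreover have "q \<in> ball z \<delta>" using \<open>dist z q < \<delta>\<close> by simp
    ultimately have "q \<in> X" using d(2) by blast
    then show False using \<open>q \<notin> X\<close> by blast
  qed
  then show thesis using d(1) that by blast
qed

lemma pd_uniform:
  assumes "\<eta> > 0"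
  obtains \<delta> where "\<delta> > 0" "\<And>z z' b. b \<in> Basis \<Longrightarrow> dist z z' < \<delta> \<Longrightarrow> \<bar>pd b z - pd b z'\<bar> < \<eta>"
proof -
  have "\<exists>\<delta>>0. \<forall>z z'. dist z z' < \<delta> \<longrightarrow> \<bar>pd b z - pd b z'\<bar> < \<eta>" if "b \<in> Basis" for b
    using compact_support_uniformly_continuous[OF pd_continuous[OF that] compact_supp pd_zero_outside assms] by metis
  then obtain D where D: "\<And>b. b \<in> Basis \<Longrightarrow> D b > 0"
    "\<And>b z z'. b \<in> Basis \<Longrightarrow> dist z z' < D b \<Longrightarrow> \<bar>pd b z - pd b z'\<bar> < \<eta>"
    by metis
  show thesis
  proof (rule that[of "Min (D ` Basis)"])
    show "Min (D ` Basis) > 0" using D(1) by (subst Min_gr_iff) auto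
  qed (use D(2) in \<open>auto simp: Min_gr_iff\<close>)
qed

lemma pd_bounded:
  obtains c where "c \<ge> 0" "\<And>z b. b \<in> Basis \<Longrightarrow> \<bar>pd b z\<bar> \<le> c"
proof -
  have "\<exists>c\<ge>0. \<forall>z. \<bar>pd b z\<bar> \<le> c" if "b \<in> Basis" for b
    using compact_support_bounded[OF pd_continuous[OF that] compact_supp pd_zero_outside] by metis
  then obtain c where c: "\<And>b. b \<in> Basis \<Longrightarrow> c b \<ge> 0" "\<And>b z. b \<in> Basis \<Longrightarrow> \<bar>pd b z\<bar> \<le> c b"
    by metis
  show thesis
  proof (rule that[of "sum c Basis"])
    show "sum c Basis \<ge> 0" using c(1) by (rule sum_nonneg)
    show "\<bar>pd b z\<bar> \<le> sum c Basis" if "b \<in> Basis" for b z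
      using c(2)[OF that, of z] member_le_sum[of b Basis c] c(1) that by fastforce
  qed
qed

lemma lipschitz:
  obtains \<Lambda> where "\<Lambda> \<ge> 0" "\<And>z z'. \<bar>\<phi> z - \<phi> z'\<bar> \<le> \<Lambda> * dist z z'"
proof -
  obtain c where c: "c \<ge> 0" "\<And>z b. b \<in> Basis \<Longrightarrow> \<bar>pd b z\<bar> \<le> c" using pd_bounded by blast
  have lin: "linear (frechet_derivative \<phi> (at z))" for z using has_derivative[of z] by (rule has_derivative_linear)
  have "onorm (frechet_derivative \<phi> (at z)) \<le> DIM('a) * c" for z
  proof (rule onorm_bound)
    fix v :: 'a
    have "frechet_derivative \<phi> (at z) v = (\<Sum>b\<in>Basis. (v \<bullet> b) * pd b z)"
      by (subst euclidean_representation[of v, symmetric])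
        (simp only: linear_sum[OF lin] linear_cmul[OF lin] real_scaleR_def)
    also have "\<bar>\<dots>\<bar> \<le> (\<Sum>b\<in>(Basis :: 'a set). norm v * c)"
      by (rule order_trans[OF sum_abs], rule sum_mono, unfold abs_mult, rule mult_mono)
        (use c in \<open>auto simp: Basis_le_norm\<close>)
    finally show "norm (frechet_derivative \<phi> (at z) v) \<le> DIM('a) * c * norm v" by (simp add: mult_ac)
  qed (use c in simp)
  then have "norm (\<phi> z - \<phi> z') \<le> DIM('a) * c * norm (z - z')" for z z'
    by (intro differentiable_bound[of UNIV \<phi>]) (auto intro: has_derivative_at_withinI has_derivative)
  then show thesis using that[of "DIM('a) * c"] c by (simp add: dist_norm)
qed

text \<open>The mean value inequality for the increment minus its linear part \<open>r * p\<close>.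
  The symmetric interval allows negative steps, as used for backward differences in space and
  time.\<close>

lemma increment_close:
  assumes b: "b \<in> Basis" and \<tau>: "\<And>r. \<bar>r\<bar> \<le> \<bar>\<tau>\<bar> \<Longrightarrow> \<bar>pd b (z + r *\<^sub>R b) - p\<bar> \<le> \<eta>"
  shows "\<bar>\<phi> (z + \<tau> *\<^sub>R b) - \<phi> z - \<tau> * p\<bar> \<le> \<bar>\<tau>\<bar> * \<eta>"
proof -
  let ?g = "\<lambda>r. \<phi> (z + r *\<^sub>R b) - r * p"
  have "norm (?g \<tau> - ?g 0) \<le> \<eta> * norm (\<tau> - 0)"
  proof (rule differentiable_bound[of "{- \<bar>\<tau>\<bar>..\<bar>\<tau>\<bar>}" ?g "\<lambda>r h. h * (pd b (z + r *\<^sub>R b) - p)"])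
    fix r assume r: "r \<in> {- \<bar>\<tau>\<bar>..\<bar>\<tau>\<bar>}"
    have lin: "linear (frechet_derivative \<phi> (at (z + r *\<^sub>R b)))" by (rule has_derivative_linear[OF has_derivative])
    have "((\<lambda>r. z + r *\<^sub>R b) has_derivative (\<lambda>h. h *\<^sub>R b)) (at r)"
      by (auto intro!: derivative_eq_intros)
    then have "((\<lambda>r. \<phi> (z + r *\<^sub>R b)) has_derivative (\<lambda>h. frechet_derivative \<phi> (at (z + r *\<^sub>R b)) (h *\<^sub>R b))) (at r)"
      by (rule has_derivative_compose[OF _ has_derivative])
    then have "(?g has_derivative (\<lambda>h. frechet_derivative \<phi> (at (z + r *\<^sub>R b)) (h *\<^sub>R b) - h * p)) (at r)"
      by (rule has_derivative_diff) (auto intro!: derivative_eq_intros)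
    then show "(?g has_derivative (\<lambda>h. h * (pd b (z + r *\<^sub>R b) - p))) (at r within {- \<bar>\<tau>\<bar>..\<bar>\<tau>\<bar>})"
      by (simp add: linear_cmul[OF lin] right_diff_distrib has_derivative_at_withinI)
    have "onorm (\<lambda>h. h * (pd b (z + r *\<^sub>R b) - p)) \<le> \<bar>pd b (z + r *\<^sub>R b) - p\<bar>"
      by (rule onorm_bound) (auto simp: abs_mult)
    then show "onorm (\<lambda>h. h * (pd b (z + r *\<^sub>R b) - p)) \<le> \<eta>" using \<tau>[of r] r by (auto simp: abs_le_iff)
  qed auto
  then show ?thesis by (simp add: mult.commute algebra_simps)
qed

end

section \<open>Summation over the time levels\<close>

lemma sum_by_parts_nat:
  fixes a m :: "nat \<Rightarrow> real"
  assumes "m 0 = 0" "m k = 0"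
  shows "(\<Sum>n<k. (a (Suc n) - a n) * m n) = - (\<Sum>n<k. a (Suc n) * (m (Suc n) - m n))"
proof -
  have "(\<Sum>n<l. (a (Suc n) - a n) * m n) = a l * m l - a 0 * m 0 - (\<Sum>n<l. a (Suc n) * (m (Suc n) - m n))" for l
    by (induction l) (auto simp: algebra_simps)
  from this[of k] show ?thesis using assms by simp
qed

lemma sum_shift_nat:
  fixes Y :: "nat \<Rightarrow> real"
  assumes "Y 0 = 0" "Y k = 0" shows "(\<Sum>n<k. Y n) = (\<Sum>n<k. Y (Suc n))"
  using sum_lessThan_telescope[of Y k] assms by (simp add: sum_subtractf)

lemma sum_indicator_disjoint:
  fixes c :: "'i \<Rightarrow> 'b::real_vector"
  assumes "finite I" "disjoint_family_on E I" "a \<in> I" "z \<in> E a"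
  shows "(\<Sum>b\<in>I. indicat_real (E b) z *\<^sub>R c b) = c a"
proof -
  have "indicat_real (E b) z *\<^sub>R c b = (if b = a then c a else 0)" if "b \<in> I" for b
    using assms that by (auto simp: disjoint_family_on_def indicator_def)
  then have "(\<Sum>b\<in>I. indicat_real (E b) z *\<^sub>R c b) = (\<Sum>b\<in>I. if b = a then c a else 0)"
    by (rule sum.cong[OF refl])
  then show ?thesis using assms(1,3) by simp
qed

lemma sum_indicator_mult:
  fixes p q :: "'i \<Rightarrow> real"
  assumes "finite I" "disjoint_family_on E I"
  shows "(\<Sum>a\<in>I. indicat_real (E a) z * p a) * (\<Sum>a\<in>I. indicat_real (E a) z * q a)
    = (\<Sum>a\<in>I. indicat_real (E a) z * (p a * q a))"
proof (cases "\<exists>a\<in>I. z \<in> E a")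
  case True
  then obtain a where "a \<in> I" "z \<in> E a" by blast
  from sum_indicator_disjoint[OF assms this, of p] sum_indicator_disjoint[OF assms this, of q]
    sum_indicator_disjoint[OF assms this, of "\<lambda>a. p a * q a"]
  show ?thesis by simp
next
  case False
  then show ?thesis by (auto simp: indicator_def intro!: sum.neutral)
qed

context adm_mesh
begin

lemma mean_diff:
  assumes "continuous_on UNIV f" "continuous_on UNIV g"
  shows "mean (\<lambda>x. f x - g x) \<sigma> = mean f \<sigma> - mean g \<sigma>"
proof -
  have i: "set_integrable lebesgue (dual_cell M \<sigma>) f" if "continuous_on UNIV f" for f :: "real^'d \<Rightarrow> real"
    by (rule set_integrable_continuous)
      (use that dual_cell_lmeasurable bounded_subset[OF bounded_\<Omega> dual_cell_subset] in \<open>auto simp: fmeasurable_def\<close>)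
  show ?thesis unfolding mean_def set_integral_diff(2)[OF i[OF assms(1)] i[OF assms(2)]] by (simp add: right_diff_distrib)
qed

lemma mean_zero:
  assumes "\<And>y. y \<in> dual_cell M \<sigma> \<Longrightarrow> f y = 0" shows "mean f \<sigma> = 0"
proof -
  have "(LINT y:dual_cell M \<sigma>|lebesgue. f y) = (LINT y:dual_cell M \<sigma>|lebesgue. 0)"
    unfolding set_lebesgue_integral_def
    by (intro Bochner_Integration.integral_cong refl) (use assms in \<open>auto simp: indicator_def\<close>)
  then show ?thesis by (simp add: mean_def)
qed

lemma vol_dual_density:
  assumes "\<sigma> \<in> all_faces M"
  shows "vol (dual_cell M \<sigma>) * dual_density M S n \<sigma> = (\<Sum>K\<in>cells_of M \<sigma>. vol (half_diamond M K \<sigma>) * density S n K)"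
  using vol_dual_cell_pos[OF assms] by (simp add: dual_density_def cells_of_def)

end

context level
begin

text \<open>To be used with the increment of \<open>\<phi>\<close> over a time step as
  \<open>\<psi>\<close>, its time derivative as \<open>g\<close> and the step as
  \<open>\<tau>\<close>. Each dual cell splits into half-diamonds, on which the dual density is
  replaced by the cell densities.\<close>

theorem time_estimate:
  assumes \<psi>: "continuous_on UNIV \<psi>" and g: "\<And>x. \<bar>g x\<bar> \<le> \<Lambda>" and \<tau>: "\<tau> \<ge> 0"
    and close: "\<And>K \<sigma> y. K \<in> cells M \<Longrightarrow> \<sigma> \<in> faces M K \<Longrightarrow> y \<in> dual_cell M \<sigma> \<Longrightarrow> \<bar>\<psi> y - \<tau> * g (xc K)\<bar> \<le> \<tau> * \<omega>"
  shows "\<bar>(\<Sum>\<sigma>\<in>all_faces M. vol (dual_cell M \<sigma>) * (dual_density M S n \<sigma> * velocity S n \<sigma> $ i) * mean \<psi> \<sigma>)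
      - \<tau> * (\<Sum>K\<in>cells M. vol K * (r (xc K) * U (xc K) $ i * g (xc K)))\<bar>
    \<le> \<tau> * ((B\<^sup>2 + 2 * B * \<Lambda>) * (\<Sum>K\<in>cells M. vol K * (err K + \<omega>)))"
proof -
  let ?D = "\<lambda>K \<sigma>. vol (half_diamond M K \<sigma>)"
  let ?q = "\<lambda>K. r (xc K) * U (xc K) $ i * g (xc K)"
  let ?c = "\<tau> * (B\<^sup>2 + 2 * B * \<Lambda>)"
  have "vol (dual_cell M \<sigma>) * (dual_density M S n \<sigma> * velocity S n \<sigma> $ i) * mean \<psi> \<sigma>
      = (\<Sum>K\<in>cells_of M \<sigma>. ?D K \<sigma> * (density S n K * velocity S n \<sigma> $ i * mean \<psi> \<sigma>))" if "\<sigma> \<in> all_faces M" for \<sigma>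
  proof -
    have "vol (dual_cell M \<sigma>) * (dual_density M S n \<sigma> * velocity S n \<sigma> $ i) * mean \<psi> \<sigma>
      = (vol (dual_cell M \<sigma>) * dual_density M S n \<sigma>) * (velocity S n \<sigma> $ i * mean \<psi> \<sigma>)" by (simp only: mult.assoc)
    then show ?thesis unfolding vol_dual_density[OF that] sum_distrib_right by (simp only: mult.assoc)
  qed
  then have "(\<Sum>\<sigma>\<in>all_faces M. vol (dual_cell M \<sigma>) * (dual_density M S n \<sigma> * velocity S n \<sigma> $ i) * mean \<psi> \<sigma>)
      = (\<Sum>\<sigma>\<in>all_faces M. \<Sum>K\<in>cells_of M \<sigma>. ?D K \<sigma> * (density S n K * velocity S n \<sigma> $ i * mean \<psi> \<sigma>))"
    by (rule sum.cong[OF refl])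
  also have "\<dots> = (\<Sum>K\<in>cells M. \<Sum>\<sigma>\<in>faces M K. ?D K \<sigma> * (density S n K * velocity S n \<sigma> $ i * mean \<psi> \<sigma>))"
    by (rule sum_all_faces)
  finally have 1: "(\<Sum>\<sigma>\<in>all_faces M. vol (dual_cell M \<sigma>) * (dual_density M S n \<sigma> * velocity S n \<sigma> $ i) * mean \<psi> \<sigma>)
      = (\<Sum>K\<in>cells M. \<Sum>\<sigma>\<in>faces M K. ?D K \<sigma> * (density S n K * velocity S n \<sigma> $ i * mean \<psi> \<sigma>))" .
  have 2: "\<tau> * (\<Sum>K\<in>cells M. vol K * ?q K) = (\<Sum>K\<in>cells M. \<Sum>\<sigma>\<in>faces M K. ?D K \<sigma> * (\<tau> * ?q K))"
    unfolding sum_distrib_left by (intro sum.cong refl) (simp add: sum_half_diamond flip: sum_distrib_right)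
  have t: "\<bar>density S n K * velocity S n \<sigma> $ i * mean \<psi> \<sigma> - \<tau> * ?q K\<bar> \<le> ?c * (err K + \<omega>)"
    if K: "K \<in> cells M" "\<sigma> \<in> faces M K" for K \<sigma>
  proof -
    let ?\<rho> = "density S n K" and ?u = "velocity S n \<sigma> $ i" and ?r = "r (xc K)" and ?U = "U (xc K) $ i" and ?g = "g (xc K)"
    have m: "\<bar>mean \<psi> \<sigma> - \<tau> * ?g\<bar> \<le> \<tau> * \<omega>"
      by (rule mean_close[OF face_all[OF K] \<psi> close[OF K]])
    have u: "\<bar>?u\<bar> \<le> B" "\<bar>?U\<bar> \<le> B" "\<bar>?u - ?U\<bar> \<le> err K"
      using component_le_norm_cart[of "velocity S n \<sigma>" i] velocity_le[OF face_all[OF K]]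
        component_le_norm_cart[of "U (xc K)" i] U_le[of "xc K"]
        component_le_norm_cart[of "velocity S n \<sigma> - U (xc K)" i] cell_velocity_err[OF K] by auto
    \<comment> \<open>One factor is exchanged at a time: first the mean of \<open>\<psi>\<close>,
      then the density, then the velocity.\<close>
    have "?\<rho> * ?u * mean \<psi> \<sigma> - \<tau> * ?q K
      = ?\<rho> * ?u * (mean \<psi> \<sigma> - \<tau> * ?g) + \<tau> * (?g * (?u * (?\<rho> - ?r)) + ?g * (?r * (?u - ?U)))"
      by (simp add: algebra_simps)
    also have "\<bar>\<dots>\<bar> \<le> (B * B) * (\<tau> * \<omega>) + \<tau> * (\<Lambda> * (B * err K) + \<Lambda> * (B * err K))"
    proof (rule order_trans[OF abs_triangle_ineq], rule add_mono)
      show "\<bar>?\<rho> * ?u * (mean \<psi> \<sigma> - \<tau> * ?g)\<bar> \<le> (B * B) * (\<tau> * \<omega>)"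
        unfolding abs_mult by (intro mult_mono u m density_le K) (use nonneg in auto)
      have "\<bar>?g * (?u * (?\<rho> - ?r))\<bar> \<le> \<Lambda> * (B * err K)" "\<bar>?g * (?r * (?u - ?U))\<bar> \<le> \<Lambda> * (B * err K)"
        unfolding abs_mult by (intro mult_mono u g cell_density_err r_le; use nonneg in simp)+
      then have "\<bar>?g * (?u * (?\<rho> - ?r)) + ?g * (?r * (?u - ?U))\<bar> \<le> \<Lambda> * (B * err K) + \<Lambda> * (B * err K)" by linarith
      then show "\<bar>\<tau> * (?g * (?u * (?\<rho> - ?r)) + ?g * (?r * (?u - ?U)))\<bar> \<le> \<tau> * (\<Lambda> * (B * err K) + \<Lambda> * (B * err K))"
        unfolding abs_mult using \<tau> by (simp add: mult_left_mono)
    qed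
    also have "\<dots> \<le> ?c * (err K + \<omega>)"
    proof -
      have "?c * (err K + \<omega>) - ((B * B) * (\<tau> * \<omega>) + \<tau> * (\<Lambda> * (B * err K) + \<Lambda> * (B * err K)))
        = \<tau> * (B * B * err K + 2 * B * \<Lambda> * \<omega>)" by (simp add: algebra_simps power2_eq_square)
      also have "\<dots> \<ge> 0" using \<tau> nonneg err_nonneg[of K] by simp
      finally show ?thesis by linarith
    qed
    finally show ?thesis .
  qed
  have "\<bar>(\<Sum>K\<in>cells M. \<Sum>\<sigma>\<in>faces M K. ?D K \<sigma> * (density S n K * velocity S n \<sigma> $ i * mean \<psi> \<sigma> - \<tau> * ?q K))\<bar>
    \<le> (\<Sum>K\<in>cells M. \<Sum>\<sigma>\<in>faces M K. ?D K \<sigma> * (?c * (err K + \<omega>)))"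
    by (rule order_trans[OF sum_abs], rule sum_mono, rule order_trans[OF sum_abs], rule sum_mono)
      (simp add: abs_mult mult_left_mono t)
  also have "\<dots> = (\<Sum>K\<in>cells M. vol K * (?c * (err K + \<omega>)))"
    by (intro sum.cong refl) (simp add: sum_half_diamond flip: sum_distrib_right)
  also have "\<dots> = \<tau> * ((B\<^sup>2 + 2 * B * \<Lambda>) * (\<Sum>K\<in>cells M. vol K * (err K + \<omega>)))"
    unfolding sum_distrib_left by (intro sum.cong refl) (simp only: ac_simps)
  finally show ?thesis unfolding 1 2 by (simp add: sum_subtractf right_diff_distrib)
qed

end

section \<open>Consistency of the space-time scheme on a fixed mesh\<close>

lemma iterated_set_integral:
  fixes f :: "'a::euclidean_space \<times> 'b::euclidean_space \<Rightarrow> real"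
  assumes "set_integrable lebesgue (A \<times> B) f"
  shows "(LINT t:B|lebesgue. (LINT x:A|lebesgue. f (x, t))) = (LINT z:A \<times> B|lebesgue. f z)"
proof -
  have "(LINT t:B|lebesgue. (LINT x:A|lebesgue. f (x, t)))
    = (LINT t|lebesgue. (LINT x|lebesgue. indicat_real (A \<times> B) (x, t) *\<^sub>R f (x, t)))"
    unfolding set_lebesgue_integral_def
    by (simp add: indicator_times mult_ac flip: integral_mult_right_zero)
  also have "\<dots> = (LINT z|lebesgue. indicat_real (A \<times> B) z *\<^sub>R f z)"
    using assms unfolding set_integrable_def by (rule iterated_lebesgue_integral)
  finally show ?thesis by (simp add: set_lebesgue_integral_def)
qed

text \<open>The sum of the constants of the space and time estimates, stated outside the locale to
  make visible that it depends neither on the mesh nor on \<open>\<omega>\<close>.\<close>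

definition consistency_const :: "nat \<Rightarrow> real \<Rightarrow> real \<Rightarrow> real \<Rightarrow> real \<Rightarrow> real \<Rightarrow> real" where
  "consistency_const d B \<theta> C \<Lambda> N = (let \<Lambda>' = \<Lambda> * (1 + \<theta> * \<theta> * 2 ^ d); A = 4 ^ d * \<theta> in
     4 * \<Lambda>' * C * A * B\<^sup>2 * N\<^sup>2 + 2 * \<Lambda>' * A * B\<^sup>2 * N + 2 * \<Lambda>' * A * B\<^sup>2 * (2 * \<theta> * N)
     + d * B ^ 3 + N * d * (2 * \<Lambda>' * A) + (B\<^sup>2 + 2 * B * \<Lambda>))"

lemma (in level) consistency_const_eq:
  "\<kappa> + (B\<^sup>2 + 2 * B * \<Lambda>) = consistency_const CARD('d) B \<theta> C \<Lambda> N"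
  unfolding consistency_const_def \<kappa>_def k1_def k2_def \<Lambda>'_def A_def Let_def by simp

text \<open>Here \<open>r\<close> and \<open>U\<close> are continuous functions close to the limits, \<open>\<delta>\<close> is a modulus of continuity for the
  accuracy \<open>\<omega>\<close>, and all quantities are compared with their values at \<open>xc K\<close> and the time level \<open>Suc n\<close>.\<close>

locale consistency = adm_mesh \<Omega> M + tf: test_function "\<Omega> \<times> {0<..<T}" \<phi>
  for \<Omega> :: "(real^'d) set" and M :: "'d mesh" and T :: real and \<phi> :: "(real^'d) \<times> real \<Rightarrow> real" +
  fixes S :: "'d scheme" and i :: 'd and B \<theta> C \<omega> \<Lambda> N \<delta> :: real
    and r :: "(real^'d) \<times> real \<Rightarrow> real" and U :: "(real^'d) \<times> real \<Rightarrow> real^'d"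
  assumes T: "T > 0" and steps: "steps S \<ge> 1"
    and pf: "primal_fluxes M S" and H1: "H1 M S" and H2: "H2 M S"
    and H3: "H3 C M S" and dv: "dual_velocities M S"
    and nonneg: "B \<ge> 0" "C \<ge> 0" "\<omega> \<ge> 0" "\<Lambda> \<ge> 0" and \<theta>: "\<theta> \<ge> 1" and N: "N \<ge> 0"
    and density_le: "\<And>n K. n < steps S \<Longrightarrow> K \<in> cells M \<Longrightarrow> \<bar>density S (Suc n) K\<bar> \<le> B"
    and velocity_le: "\<And>n \<sigma>. n < steps S \<Longrightarrow> \<sigma> \<in> all_faces M \<Longrightarrow> norm (velocity S (Suc n) \<sigma>) \<le> B"
    and r_le: "\<And>z. \<bar>r z\<bar> \<le> B" and U_le: "\<And>z. norm (U z) \<le> B"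
    and theta1: "\<And>K. K \<in> cells M \<Longrightarrow> diameter K ^ CARD('d) \<le> \<theta> * measure lebesgue K"
    and theta2: "\<And>K L \<sigma>. interface M K L \<sigma> \<Longrightarrow> measure lebesgue K \<le> \<theta> * measure lebesgue L"
    and card_le: "\<And>K. K \<in> cells M \<Longrightarrow> real (card (faces M K)) \<le> N"
    and lip: "\<And>z z'. \<bar>\<phi> z - \<phi> z'\<bar> \<le> \<Lambda> * dist z z'"
    and pd_le: "\<And>z b. b \<in> Basis \<Longrightarrow> \<bar>frechet_derivative \<phi> (at z) b\<bar> \<le> \<Lambda>"
    and pd_mod: "\<And>z z' b. b \<in> Basis \<Longrightarrow> dist z z' < \<delta> \<Longrightarrow> \<bar>frechet_derivative \<phi> (at z) b - frechet_derivative \<phi> (at z') b\<bar> \<le> \<omega>"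
    and vanish: "\<And>z q. q \<notin> \<Omega> \<times> {0<..<T} \<Longrightarrow> dist z q < \<delta> \<Longrightarrow> z \<notin> tf.supp"
    and rU_mod: "\<And>z z'. z \<in> closure \<Omega> \<times> {0..T} \<Longrightarrow> z' \<in> closure \<Omega> \<times> {0..T} \<Longrightarrow> dist z z' < \<delta> \<Longrightarrow>
        \<bar>r z - r z'\<bar> \<le> \<omega> \<and> norm (U z - U z') \<le> \<omega> \<and> norm ((r z * U z $ i) *\<^sub>R U z - (r z' * U z' $ i) *\<^sub>R U z') \<le> \<omega>"
    and small: "cells M \<noteq> {} \<Longrightarrow> 2 * mesh_size M + time_step T S < \<delta>"
begin

definition dt :: real where "dt = time_step T S"
definition t :: "nat \<Rightarrow> real" where "t n = time_level T S n"
definition xc :: "(real^'d) set \<Rightarrow> real^'d" where "xc K = (SOME x. x \<in> K)"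
text \<open>The smallest diameter is an admissible shift for every cell at once; the value 1 merely
  keeps \<open>s\<close> positive in the degenerate case.\<close>

definition s :: real where "s = (if cells M = {} then 1 else Min (diameter ` cells M))"
definition err :: "nat \<Rightarrow> (real^'d) set \<Rightarrow> real" where
  "err n K = \<bar>density S n K - r (xc K, t n)\<bar> + (\<Sum>\<sigma>\<in>faces M K. norm (velocity S n \<sigma> - U (xc K, t n)))"
text \<open>The integrand of the limit, with \<open>r\<close> and \<open>U\<close> in place of the
  limit functions.\<close>

definition Q :: "(real^'d) \<times> real \<Rightarrow> real" where
  "Q z = r z * U z $ i * time_derivative \<phi> z + r z * U z $ i * (U z \<bullet> space_gradient \<phi> z)"

lemma dt_pos: "dt > 0" and t_simps: "t 0 = 0" "t (steps S) = T" "t (Suc n) = t n + dt"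
  using T steps by (auto simp: dt_def t_def time_step_def time_level_def field_simps)

lemma t_bounds: "n \<le> steps S \<Longrightarrow> 0 \<le> t n \<and> t n \<le> T"
proof -
  assume "n \<le> steps S"
  then have le: "real n * dt \<le> real (steps S) * dt" using dt_pos by (intro mult_right_mono) auto
  have tk: "t k = real k * dt" for k by (simp add: t_def time_level_def dt_def)
  have "real n * dt \<ge> 0" using dt_pos by simp
  then show ?thesis using le t_simps(2) tk[of n] tk[of "steps S"] by linarith
qed

lemma xc: "K \<in> cells M \<Longrightarrow> xc K \<in> K"
  unfolding xc_def using cell_nonempty by (simp add: some_in_eq)

lemma s_pos: "s > 0" and s_le: "K \<in> cells M \<Longrightarrow> s \<le> diameter K"
  unfolding s_def using finite_cells diameter_pos by auto

lemma axis_Basis: "(axis j 1, 0) \<in> (Basis :: ((real^'d) \<times> real) set)" "(0, 1) \<in> (Basis :: ((real^'d) \<times> real) set)"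
  by (auto simp: Basis_prod_def Basis_vec_def)

lemma phi_zero: "z \<notin> tf.supp \<Longrightarrow> \<phi> z = 0" "z \<notin> tf.supp \<Longrightarrow> space_gradient \<phi> z = 0"
  using tf.zero_outside tf.pd_zero_outside by (auto simp: space_gradient_def vec_eq_iff)

lemma continuous_slice: "continuous_on UNIV (\<lambda>x. \<phi> (x, c))"
  by (rule continuous_on_compose2[OF tf.continuous]) (auto intro!: continuous_intros)

lemma mesh_size_less: assumes "K \<in> cells M"
  shows "2 * mesh_size M + dt < \<delta>" "diameter K \<le> mesh_size M" "mesh_size M > 0"
  using small assms diameter_le_mesh_size[OF assms] diameter_pos[OF assms] by (auto simp: dt_def)

text \<open>The space estimate is instantiated at the levels \<open>Suc n\<close>, whose unknowns
  are values of the discrete functions and hence bounded. The initial level is not seen by these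
  functions.\<close>

lemma level_Suc:
  assumes n: "n < steps S"
  shows "level \<Omega> M S (Suc n) i B \<theta> C \<omega> \<Lambda> s N (\<lambda>x. \<phi> (x, t (Suc n))) (\<lambda>x. space_gradient \<phi> (x, t (Suc n)))
    (\<lambda>x. r (x, t (Suc n))) (\<lambda>x. U (x, t (Suc n))) xc"
proof (intro level.intro adm_mesh_axioms level_axioms.intro)
  let ?t = "t (Suc n)"
  have tb: "0 \<le> ?t" "?t \<le> T" using t_bounds[of "Suc n"] n by auto
  have dist: "dist (x, ?t) (y, ?t) = dist x y" for x y :: "real^'d" by (simp add: dist_Pair_Pair)
  show "\<bar>\<phi> (x, ?t) - \<phi> (y, ?t)\<bar> \<le> \<Lambda> * dist x y" for x y using lip[of "(x, ?t)" "(y, ?t)"] by (simp add: dist)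
  show "\<bar>\<phi> (x, ?t) - \<phi> (x - s *\<^sub>R axis j 1, ?t) - s * space_gradient \<phi> (xc K, ?t) $ j\<bar> \<le> s * \<omega>"
    if K: "K \<in> cells M" "x \<in> K" for K x j
  proof -
    let ?b = "(axis j 1, 0) :: (real^'d) \<times> real"
    \<comment> \<open>A backward step of length \<open>s\<close>, with the derivative frozen at the
      sample point; the distance stays below the diameter plus \<open>s\<close>.\<close>
    have "\<bar>\<phi> ((x, ?t) + (- s) *\<^sub>R ?b) - \<phi> (x, ?t) - (- s) * frechet_derivative \<phi> (at (xc K, ?t)) ?b\<bar> \<le> \<bar>- s\<bar> * \<omega>"
    proof (rule tf.increment_close[OF axis_Basis(1)])
      fix q :: real assume q: "\<bar>q\<bar> \<le> \<bar>- s\<bar>"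
      have "dist (x + q *\<^sub>R axis j 1) x \<le> s" using q s_pos by (simp add: dist_norm)
      moreover have "dist x (xc K) \<le> diameter K"
        using dist_cell_closure[OF K(1)] xc[OF K(1)] K(2) closure_subset by blast
      ultimately have "dist (x + q *\<^sub>R axis j 1) (xc K) < \<delta>"
        using dist_triangle[of "x + q *\<^sub>R axis j 1" "xc K" x] s_le[OF K(1)] mesh_size_less[OF K(1)] dt_pos by linarith
      then show "\<bar>frechet_derivative \<phi> (at ((x, ?t) + q *\<^sub>R ?b)) ?b - frechet_derivative \<phi> (at (xc K, ?t)) ?b\<bar> \<le> \<omega>"
        by (intro pd_mod axis_Basis) (simp add: dist)
    qed
    then have "\<bar>\<phi> (x - s *\<^sub>R axis j 1, ?t) - \<phi> (x, ?t) + s * space_gradient \<phi> (xc K, ?t) $ j\<bar> \<le> s * \<omega>"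
      using s_pos by (simp add: space_gradient_def)
    then show ?thesis by (simp add: abs_le_iff)
  qed
  \<comment> \<open>Without cells \<open>mesh_size M\<close> would be an unspecified maximum of the
    empty set; a point of \<open>\<Omega>\<close> guarantees a cell, and then \<open>small\<close>
    applies.\<close>
  have cellsne: "cells M \<noteq> {}" if "q \<notin> \<Omega>" "dist z q \<le> 2 * mesh_size M" "z \<in> \<Omega>" for z q
  proof -
    have "z \<in> (\<Union>K\<in>cells M. closure K)" using pm that(3) closure_subset unfolding primal_mesh_def by blast
    then show ?thesis by blast
  qed
  have supp: "(z, ?t) \<notin> tf.supp" if z: "q \<notin> \<Omega>" "dist z q \<le> 2 * mesh_size M" for z q
  proof (cases "z \<in> \<Omega>")
    case True
    then show ?thesis using small[OF cellsne[OF z True]] dt_pos z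
      by (intro vanish[of "(q, ?t)"]) (auto simp: dist dt_def)
  next
    case False
    then show ?thesis using tf.supp_subset by blast
  qed
  show "\<phi> (z, ?t) = 0" "space_gradient \<phi> (z, ?t) = 0" if "q \<notin> \<Omega>" "dist z q \<le> 2 * mesh_size M" for z q
    using phi_zero[OF supp[OF that]] by auto
  have m: "\<bar>r (x, ?t) - r (y, ?t)\<bar> \<le> \<omega> \<and> norm (U (x, ?t) - U (y, ?t)) \<le> \<omega> \<and>
      norm ((r (x, ?t) * U (x, ?t) $ i) *\<^sub>R U (x, ?t) - (r (y, ?t) * U (y, ?t) $ i) *\<^sub>R U (y, ?t)) \<le> \<omega>"
    if xy: "x \<in> closure \<Omega>" "y \<in> closure \<Omega>" "dist x y \<le> 2 * mesh_size M" for x y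
  proof -
    have "cells M \<noteq> {}" using pm xy(1) unfolding primal_mesh_def by blast
    then show ?thesis using small xy dt_pos tb by (intro rU_mod) (auto simp: dist dt_def)
  qed
  show "\<bar>r (x, ?t) - r (y, ?t)\<bar> \<le> \<omega>"
    "norm ((r (x, ?t) * U (x, ?t) $ i) *\<^sub>R U (x, ?t) - (r (y, ?t) * U (y, ?t) $ i) *\<^sub>R U (y, ?t)) \<le> \<omega>"
    if "x \<in> closure \<Omega>" "y \<in> closure \<Omega>" "dist x y \<le> 2 * mesh_size M" for x y
    using m[OF that] by auto
  show "\<bar>density S (Suc n) K\<bar> \<le> B" if "K \<in> cells M" for K using density_le[OF n that] .
  show "norm (velocity S (Suc n) \<sigma>) \<le> B" if "\<sigma> \<in> all_faces M" for \<sigma> using velocity_le[OF n that] .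
  show "Suc n \<le> steps S" using n by simp
qed ((rule pf H1 H2 H3 dv nonneg \<theta> N s_pos r_le U_le theta1 theta2 card_le s_le xc; assumption?)+)

abbreviation m :: "nat \<Rightarrow> (real^'d) set \<Rightarrow> real" where "m n \<equiv> mean (\<lambda>x. \<phi> (x, t n))"

lemma mean_end: "m 0 \<sigma> = 0" "m (steps S) \<sigma> = 0"
  using t_simps tf.supp_subset by (auto intro!: mean_zero phi_zero)

text \<open>This removes the arbitrary data \<open>bd_flux\<close> and \<open>bd_velocity\<close>
  from the tested operator.\<close>

lemma mean_external:
  assumes "\<sigma> \<in> external_faces \<Omega> M" shows "m n \<sigma> = 0"
proof (rule mean_zero, rule phi_zero)
  fix y assume "y \<in> dual_cell M \<sigma>"
  then obtain K where K: "K \<in> cells M" "\<sigma> \<in> faces M K" "y \<in> K"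
    unfolding dual_cell_eq cells_of_def using half_diamond(2) by blast
  obtain q where q: "q \<in> \<sigma>" using face_nonempty[OF K(1,2)] by blast
  have "q \<in> frontier \<Omega>" using assms q by (auto simp: external_faces_def)
  then have q\<Omega>: "q \<notin> \<Omega>" using open_\<Omega> by (simp add: frontier_def interior_open)
  have "dist y q \<le> diameter K"
    using dist_cell_closure[OF K(1)] face_subset[OF K(1,2)] q K(3) closure_subset by blast
  then have "dist y q < \<delta>" using mesh_size_less[OF K(1)] dt_pos by linarith
  then show "(y, t n) \<notin> tf.supp" using q\<Omega> by (intro vanish[of "(q, t n)"]) (auto simp: dist_Pair_Pair)
qed

text \<open>Open in time, as in \<open>convection\<close> and \<open>interpolate\<close>; the time
  levels left out form a null set of the cylinder.\<close>

definition time_box :: "nat \<Rightarrow> (real^'d) set \<Rightarrow> ((real^'d) \<times> real) set" where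
  "time_box n A = A \<times> {t n<..<t (Suc n)}"

lemma t_mono: "n \<le> k \<Longrightarrow> t n \<le> t k"
  using dt_pos by (simp add: t_def time_level_def dt_def mult_right_mono)

lemma time_box_disjoint: assumes "n \<noteq> k \<or> A \<inter> A' = {}" shows "time_box n A \<inter> time_box k A' = {}"
proof (cases "n = k")
  case False
  then have "t (Suc n) \<le> t k \<or> t (Suc k) \<le> t n" using t_mono[of "Suc n" k] t_mono[of "Suc k" n] by linarith
  then show ?thesis by (auto simp: time_box_def)
qed (use assms in \<open>auto simp: time_box_def\<close>)

lemma time_box_lmeasurable: assumes "A \<in> lmeasurable"
  shows "time_box n A \<in> lmeasurable" "measure lebesgue (time_box n A) = vol A * dt"
  using lmeasurable_Times_interval[OF assms, of "t n" "t (Suc n)"] dt_pos by (auto simp: time_box_def t_simps(3))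

lemma time_box_subset: "n < steps S \<Longrightarrow> A \<subseteq> \<Omega> \<Longrightarrow> time_box n A \<subseteq> \<Omega> \<times> {0<..<T}"
  using t_bounds[of n] t_bounds[of "Suc n"] by (auto simp: time_box_def)

text \<open>Both factors are step functions over the same disjoint boxes, so their product is one
  too and is integrated box by box.\<close>

lemma convection_integral:
  "(LINT \<tau>:{0<..<T}|lebesgue. (LINT x:\<Omega>|lebesgue. convection \<Omega> T M S i (x, \<tau>) * interpolate T M S \<phi> (x, \<tau>)))
   = (\<Sum>n<steps S. \<Sum>\<sigma>\<in>all_faces M. dt * (vol (dual_cell M \<sigma>) * convection_value \<Omega> T M S i n \<sigma> * m n \<sigma>))"
proof -
  define I where "I = {..<steps S} \<times> all_faces M"
  define E where "E a = time_box (fst a) (dual_cell M (snd a))" for a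
  define p where "p a = convection_value \<Omega> T M S i (fst a) (snd a)" for a
  define q where "q a = m (fst a) (snd a)" for a
  have I: "finite I" using finite_all_faces by (simp add: I_def)
  have dis: "disjoint_family_on E I"
    unfolding disjoint_family_on_def E_def
  proof (intro ballI impI time_box_disjoint)
    fix a b assume "a \<in> I" "b \<in> I" "a \<noteq> b"
    then show "fst a \<noteq> fst b \<or> dual_cell M (snd a) \<inter> dual_cell M (snd b) = {}"
      using dual_cell_disjoint[of "snd a" "snd b"] by (cases "fst a = fst b") (auto simp: prod_eq_iff)
  qed
  have Em: "E a \<in> lmeasurable" "measure lebesgue (E a) = vol (dual_cell M (snd a)) * dt" for a
    unfolding E_def by (rule time_box_lmeasurable[OF dual_cell_lmeasurable])+
  have sub: "E a \<subseteq> \<Omega> \<times> {0<..<T}" if "a \<in> I" for a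
    using that dual_cell_subset unfolding E_def I_def by (intro time_box_subset) auto
  have cp: "convection \<Omega> T M S i z = (\<Sum>a\<in>I. indicat_real (E a) z * p a)" for z
    unfolding convection_def I_def E_def p_def time_box_def t_def sum.cartesian_product by (simp add: case_prod_beta)
  have iq: "interpolate T M S \<phi> z = (\<Sum>a\<in>I. indicat_real (E a) z * q a)" for z
    unfolding interpolate_def I_def E_def q_def time_box_def t_def mean_def sum.cartesian_product by (simp add: case_prod_beta)
  have prod: "convection \<Omega> T M S i z * interpolate T M S \<phi> z = (\<Sum>a\<in>I. indicat_real (E a) z * (p a * q a))" for z
    unfolding cp iq by (rule sum_indicator_mult[OF I dis])
  let ?X = "\<Omega> \<times> {0<..<T}"
  have X: "indicat_real ?X z *\<^sub>R (\<Sum>a\<in>I. indicat_real (E a) z * (p a * q a)) = (\<Sum>a\<in>I. indicat_real (E a) z * (p a * q a))" for z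
  proof (cases "z \<in> ?X")
    case False
    then have "z \<notin> E a" if "a \<in> I" for a using sub[OF that] by blast
    then show ?thesis by (simp add: indicator_def)
  qed simp
  have int: "integrable lebesgue (\<lambda>z. indicat_real (E a) z * c)" for a and c :: real
    using Em(1)[of a] by (auto simp: fmeasurable_def)
  have "set_integrable lebesgue ?X (\<lambda>z. convection \<Omega> T M S i z * interpolate T M S \<phi> z)"
    unfolding set_integrable_def prod X using int by (intro Bochner_Integration.integrable_sum)
  then have "(LINT \<tau>:{0<..<T}|lebesgue. (LINT x:\<Omega>|lebesgue. convection \<Omega> T M S i (x, \<tau>) * interpolate T M S \<phi> (x, \<tau>)))
    = (LINT z:?X|lebesgue. convection \<Omega> T M S i z * interpolate T M S \<phi> z)"
    by (rule iterated_set_integral)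
  also have "\<dots> = (LINT z|lebesgue. (\<Sum>a\<in>I. indicat_real (E a) z * (p a * q a)))"
    unfolding set_lebesgue_integral_def prod X ..
  also have "\<dots> = (\<Sum>a\<in>I. LINT z|lebesgue. indicat_real (E a) z * (p a * q a))"
    by (rule Bochner_Integration.integral_sum) (rule int)
  also have "\<dots> = (\<Sum>a\<in>I. dt * (vol (dual_cell M (snd a)) * p a * q a))"
    using Em by (intro sum.cong refl) (simp add: mult_ac fmeasurable_def)
  finally show ?thesis
    unfolding I_def p_def q_def sum.cartesian_product by (simp add: case_prod_beta)
qed

text \<open>The means of \<open>\<phi>\<close> vanish at the first and at the last time level: this gives the summation by parts in time,
  and lets the explicit convection term be shifted to the level \<open>Suc n\<close>, where the bounds are available.\<close>

theorem consistency_estimate: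
  "\<bar>(LINT \<tau>:{0<..<T}|lebesgue. (LINT x:\<Omega>|lebesgue. convection \<Omega> T M S i (x, \<tau>) * interpolate T M S \<phi> (x, \<tau>)))
    + (\<Sum>n<steps S. \<Sum>K\<in>cells M. (vol K * dt) * Q (xc K, t (Suc n)))\<bar>
   \<le> consistency_const CARD('d) B \<theta> C \<Lambda> N * (\<Sum>n<steps S. \<Sum>K\<in>cells M. (vol K * dt) * (err (Suc n) K + \<omega>))"
proof -
  let ?c = "consistency_const CARD('d) B \<theta> C \<Lambda> N"
  define a where "a n \<sigma> = vol (dual_cell M \<sigma>) * (dual_density M S n \<sigma> * velocity S n \<sigma> $ i)" for n \<sigma>
  define F where "F n \<sigma> = (\<Sum>\<epsilon>\<in>dual_faces M \<sigma>. dual_flux S n \<sigma> \<epsilon> * dual_velocity S n \<epsilon> $ i)" for n \<sigma>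
  define Y where "Y n = (\<Sum>\<sigma>\<in>all_faces M. m n \<sigma> * F n \<sigma>)" for n
  define P where "P n = (\<Sum>\<sigma>\<in>all_faces M. a (Suc n) \<sigma> * (m (Suc n) \<sigma> - m n \<sigma>))" for n
  define R where "R n = (\<Sum>K\<in>cells M. vol K * (err (Suc n) K + \<omega>))" for n
  define q1 where "q1 n = (\<Sum>K\<in>cells M. vol K * (r (xc K, t (Suc n)) * U (xc K, t (Suc n)) $ i * time_derivative \<phi> (xc K, t (Suc n))))" for n
  define q2 where "q2 n = (\<Sum>K\<in>cells M. vol K * (((r (xc K, t (Suc n)) * U (xc K, t (Suc n)) $ i) *\<^sub>R U (xc K, t (Suc n))) \<bullet> space_gradient \<phi> (xc K, t (Suc n))))" for n
  have summand: "dt * (vol (dual_cell M \<sigma>) * convection_value \<Omega> T M S i n \<sigma> * m n \<sigma>)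
     = (a (Suc n) \<sigma> - a n \<sigma>) * m n \<sigma> + dt * (m n \<sigma> * F n \<sigma>)" if "\<sigma> \<in> all_faces M" for n \<sigma>
  proof (cases "\<sigma> \<in> external_faces \<Omega> M")
    case True
    then show ?thesis by (simp add: mean_external)
  next
    case False
    then show ?thesis
      using vol_dual_cell_pos[OF that] dt_pos
      by (simp add: convection_value_def a_def F_def flip: dt_def) (simp add: field_simps)
  qed
  have "(\<Sum>n<steps S. \<Sum>\<sigma>\<in>all_faces M. dt * (vol (dual_cell M \<sigma>) * convection_value \<Omega> T M S i n \<sigma> * m n \<sigma>))
    = (\<Sum>n<steps S. \<Sum>\<sigma>\<in>all_faces M. (a (Suc n) \<sigma> - a n \<sigma>) * m n \<sigma>) + (\<Sum>n<steps S. dt * Y n)"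
    by (simp add: summand sum.distrib Y_def sum_distrib_left)
  also have "(\<Sum>n<steps S. \<Sum>\<sigma>\<in>all_faces M. (a (Suc n) \<sigma> - a n \<sigma>) * m n \<sigma>)
     = (\<Sum>\<sigma>\<in>all_faces M. \<Sum>n<steps S. (a (Suc n) \<sigma> - a n \<sigma>) * m n \<sigma>)" by (rule sum.swap)
  also have "\<dots> = (\<Sum>\<sigma>\<in>all_faces M. - (\<Sum>n<steps S. a (Suc n) \<sigma> * (m (Suc n) \<sigma> - m n \<sigma>)))"
    by (intro sum.cong refl sum_by_parts_nat mean_end)
  also have "\<dots> = - (\<Sum>n<steps S. P n)"
    unfolding sum_negf P_def by (simp add: sum.swap[of _ "all_faces M"])
  also have "(\<Sum>n<steps S. dt * Y n) = (\<Sum>n<steps S. dt * Y (Suc n))"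
    by (rule sum_shift_nat) (simp_all add: Y_def mean_end)
  finally have 1: "(LINT \<tau>:{0<..<T}|lebesgue. (LINT x:\<Omega>|lebesgue. convection \<Omega> T M S i (x, \<tau>) * interpolate T M S \<phi> (x, \<tau>)))
     = - (\<Sum>n<steps S. P n) + (\<Sum>n<steps S. dt * Y (Suc n))"
    unfolding convection_integral .
  have 2: "(\<Sum>n<steps S. \<Sum>K\<in>cells M. (vol K * dt) * Q (xc K, t (Suc n))) = (\<Sum>n<steps S. dt * (q1 n + q2 n))"
    unfolding q1_def q2_def sum.distrib[symmetric] sum_distrib_left
    by (intro sum.cong refl) (simp add: Q_def algebra_simps)
  \<comment> \<open>\<open>time_estimate\<close> brings \<open>P n\<close> close to
    \<open>dt * q1 n\<close>, and \<open>space_estimate\<close> brings \<open>Y (Suc n)\<close>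
    close to \<open>- q2 n\<close>.\<close>
  have 3: "\<bar>dt * q1 n - P n + dt * (Y (Suc n) + q2 n)\<bar> \<le> ?c * (dt * R n)" if n: "n < steps S" for n
  proof -
    let ?t = "t (Suc n)" and ?\<psi> = "\<lambda>x. \<phi> (x, t (Suc n)) - \<phi> (x, t n)"
    interpret L: level \<Omega> M S "Suc n" i B \<theta> C \<omega> \<Lambda> s N "\<lambda>x. \<phi> (x, t (Suc n))" "\<lambda>x. space_gradient \<phi> (x, t (Suc n))"
      "\<lambda>x. r (x, t (Suc n))" "\<lambda>x. U (x, t (Suc n))" xc
      by (rule level_Suc[OF n])
    have err: "L.err K = err (Suc n) K" for K by (simp add: L.err_def err_def)
    have "\<bar>Y (Suc n) + q2 n\<bar> \<le> L.\<kappa> * R n"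
      using L.space_estimate unfolding err R_def Y_def F_def q2_def L.W_def .
    moreover have "\<bar>P n - dt * q1 n\<bar> \<le> dt * ((B\<^sup>2 + 2 * B * \<Lambda>) * R n)"
    proof -
      have close: "\<bar>?\<psi> y - dt * time_derivative \<phi> (xc K, ?t)\<bar> \<le> dt * \<omega>"
        if K: "K \<in> cells M" "\<sigma> \<in> faces M K" "y \<in> dual_cell M \<sigma>" for K \<sigma> y
      proof -
        have "K \<in> cells_of M \<sigma>" using K by (simp add: cells_of_def)
        then obtain L where L: "L \<in> cells_of M \<sigma>" "dist (xc K) y \<le> diameter K + diameter L"
          using dist_dual_cell[OF _ L.xc_closure[OF K(1)] K(3)] by metis
        have "diameter L \<le> mesh_size M" using L(1) diameter_le_mesh_size by (auto simp: cells_of_def)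
        then have dy: "dist y (xc K) \<le> 2 * mesh_size M" using L(2) mesh_size_less[OF K(1)] by (simp add: dist_commute)
        \<comment> \<open>A backward time step from level \<open>Suc n\<close>, with the derivative
          frozen at \<open>xc K\<close>, although \<open>y\<close> may lie in the neighbouring
          cell.\<close>
        have "\<bar>\<phi> ((y, ?t) + (- dt) *\<^sub>R (0, 1)) - \<phi> (y, ?t) - (- dt) * frechet_derivative \<phi> (at (xc K, ?t)) (0, 1)\<bar> \<le> \<bar>- dt\<bar> * \<omega>"
        proof (rule tf.increment_close[OF axis_Basis(2)])
          fix q :: real assume q: "\<bar>q\<bar> \<le> \<bar>- dt\<bar>"
          have "dist (y, ?t + q) (xc K, ?t) \<le> dist (y, ?t + q) (y, ?t) + dist (y, ?t) (xc K, ?t)" by (rule dist_triangle)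
          also have "\<dots> \<le> dt + 2 * mesh_size M" using q dy dt_pos by (simp add: dist_Pair_Pair dist_real_def)
          finally have "dist (y, ?t + q) (xc K, ?t) < \<delta>" using mesh_size_less[OF K(1)] by linarith
          then show "\<bar>frechet_derivative \<phi> (at ((y, ?t) + q *\<^sub>R (0, 1))) (0, 1) - frechet_derivative \<phi> (at (xc K, ?t)) (0, 1)\<bar> \<le> \<omega>"
            by (intro pd_mod axis_Basis) simp
        qed
        moreover have "t n = ?t - dt" by (simp add: t_simps(3))
        ultimately show ?thesis using dt_pos by (simp add: time_derivative_def abs_le_iff)
      qed
      have mm: "mean ?\<psi> \<sigma> = m (Suc n) \<sigma> - m n \<sigma>" for \<sigma>
        by (rule mean_diff) (rule continuous_slice)+
      have c: "continuous_on UNIV ?\<psi>" by (intro continuous_on_diff continuous_slice)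
      have g: "\<bar>time_derivative \<phi> (x, ?t)\<bar> \<le> \<Lambda>" for x
        unfolding time_derivative_def by (rule pd_le[OF axis_Basis(2)])
      show ?thesis
        using L.time_estimate[where g="\<lambda>x. time_derivative \<phi> (x, ?t)", OF c g less_imp_le[OF dt_pos] close]
        unfolding mm err R_def P_def a_def q1_def .
    qed
    moreover have "dt * \<bar>Y (Suc n) + q2 n\<bar> \<le> dt * (L.\<kappa> * R n)" using calculation(1) dt_pos by (intro mult_left_mono) auto
    moreover have "?c * (dt * R n) = dt * (L.\<kappa> * R n) + dt * ((B\<^sup>2 + 2 * B * \<Lambda>) * R n)"
      unfolding L.consistency_const_eq[symmetric] by (simp add: algebra_simps)
    moreover have "\<bar>dt * (Y (Suc n) + q2 n)\<bar> = dt * \<bar>Y (Suc n) + q2 n\<bar>" using dt_pos by (simp add: abs_mult)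
    ultimately show ?thesis by linarith
  qed
  have "\<bar>(\<Sum>n<steps S. dt * q1 n - P n + dt * (Y (Suc n) + q2 n))\<bar> \<le> (\<Sum>n<steps S. ?c * (dt * R n))"
    by (rule order_trans[OF sum_abs], rule sum_mono, rule 3) simp
  moreover have "(\<Sum>n<steps S. dt * q1 n - P n + dt * (Y (Suc n) + q2 n)) = - (\<Sum>n<steps S. P n) + (\<Sum>n<steps S. dt * Y (Suc n)) + (\<Sum>n<steps S. dt * (q1 n + q2 n))"
    by (simp add: sum.distrib sum_subtractf distrib_left)
  moreover have "(\<Sum>n<steps S. ?c * (dt * R n)) = ?c * (\<Sum>n<steps S. \<Sum>K\<in>cells M. (vol K * dt) * (err (Suc n) K + \<omega>))"
    unfolding R_def sum_distrib_left by (intro sum.cong refl) (simp only: ac_simps)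
  ultimately show ?thesis unfolding 1 2 by simp
qed

end

section \<open>Bounds and error sums\<close>

lemma Linf_norm_AE:
  assumes "Linf_norm A f \<le> ereal c" shows "AE x in lebesgue_on A. norm (f x) \<le> c"
proof -
  have "AE x in lebesgue_on A. ereal (norm (f x)) \<le> Linf_norm A f"
    unfolding Linf_norm_def by (rule esssup_AE)
  then show ?thesis by eventually_elim (use assms order_trans in fastforce)
qed

lemma Linf_bounded:
  assumes "f \<in> Linf A"
  obtains c where "c \<ge> 0" "AE x in lebesgue_on A. norm (f x) \<le> c" "f \<in> borel_measurable (lebesgue_on A)"
proof -
  have l: "Linf_norm A f < \<infinity>" and m: "f \<in> borel_measurable (lebesgue_on A)" using assms by (auto simp: Linf_def)
  obtain c where c: "Linf_norm A f \<le> ereal c" using l by (cases "Linf_norm A f") auto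
  have "AE x in lebesgue_on A. norm (f x) \<le> max c 0"
    using Linf_norm_AE[OF c] by eventually_elim auto
  then show thesis using that[of "max c 0"] m by auto
qed

text \<open>Essential bounds on a step function become bounds on each of its values, because every
  piece has positive measure.\<close>

lemma AE_positive_measure_ex:
  assumes "AE z in lebesgue_on X. P z" "X \<in> sets lebesgue" "E \<in> lmeasurable" "E \<subseteq> X" "measure lebesgue E > 0"
  shows "\<exists>z\<in>E. P z"
proof (rule ccontr)
  assume *: "\<not> (\<exists>z\<in>E. P z)"
  have "AE z in lebesgue. z \<in> X \<longrightarrow> P z" using assms(1,2) by (simp add: AE_restrict_space_iff)
  then have "AE z in lebesgue. z \<notin> E" by eventually_elim (use * assms(4) in auto)
  then have "E \<in> null_sets lebesgue" using assms(3) by (subst AE_iff_null_sets) (auto simp: fmeasurable_def)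
  then show False using assms(5) by (simp add: measure_eq_0_null_sets)
qed

section \<open>Values, bounds and measurability of the discrete functions\<close>

context adm_mesh
begin

lemma time_level_mono: "T \<ge> 0 \<Longrightarrow> n \<le> k \<Longrightarrow> time_level T S n \<le> time_level T S k"
  by (simp add: time_level_def time_step_def mult_right_mono divide_right_mono)

lemma time_slabs_disjoint:
  assumes "T \<ge> 0" "n \<noteq> k"
  shows "{time_level T S n<..time_level T S (Suc n)} \<inter> {time_level T S k<..time_level T S (Suc k)} = {}"
proof -
  have "time_level T S (Suc n) \<le> time_level T S k \<or> time_level T S (Suc k) \<le> time_level T S n"
    using assms time_level_mono[of T "Suc n" k S] time_level_mono[of T "Suc k" n S] by linarith
  then show ?thesis by auto
qed

lemma density_fun_value:
  assumes "T \<ge> 0" "n < steps S" "K \<in> cells M" "z \<in> K \<times> {time_level T S n<..time_level T S (Suc n)}"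
  shows "density_fun T M S z = density S (Suc n) K"
proof -
  let ?I = "{..<steps S} \<times> cells M" and ?E = "\<lambda>a. snd a \<times> {time_level T S (fst a)<..time_level T S (Suc (fst a))}"
  have "disjoint_family_on ?E ?I"
    unfolding disjoint_family_on_def
  proof (intro ballI impI)
    fix a b assume "a \<in> ?I" "b \<in> ?I" "a \<noteq> b"
    then show "?E a \<inter> ?E b = {}"
      using disjoint_cells[of "snd a" "snd b"] time_slabs_disjoint[OF assms(1), of "fst a" "fst b" S]
      by (cases "fst a = fst b") (auto simp: prod_eq_iff Times_Int_Times)
  qed
  from sum_indicator_disjoint[OF _ this, of "(n, K)" z "\<lambda>a. density S (Suc (fst a)) (snd a)"]
  show ?thesis using assms finite_cells unfolding density_fun_def sum.cartesian_product by (simp add: case_prod_beta)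
qed

lemma velocity_fun_value:
  assumes "T \<ge> 0" "n < steps S" "\<sigma> \<in> all_faces M" "z \<in> dual_cell M \<sigma> \<times> {time_level T S n<..time_level T S (Suc n)}"
  shows "velocity_fun T M S z = velocity S (Suc n) \<sigma>"
proof -
  let ?I = "{..<steps S} \<times> all_faces M"
    and ?E = "\<lambda>a. dual_cell M (snd a) \<times> {time_level T S (fst a)<..time_level T S (Suc (fst a))}"
  have "disjoint_family_on ?E ?I"
    unfolding disjoint_family_on_def
  proof (intro ballI impI)
    fix a b assume "a \<in> ?I" "b \<in> ?I" "a \<noteq> b"
    then show "?E a \<inter> ?E b = {}"
      using dual_cell_disjoint[of "snd a" "snd b"] time_slabs_disjoint[OF assms(1), of "fst a" "fst b" S]
      by (cases "fst a = fst b") (auto simp: prod_eq_iff Times_Int_Times)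
  qed
  from sum_indicator_disjoint[OF _ this, of "(n, \<sigma>)" z "\<lambda>a. velocity S (Suc (fst a)) (snd a)"]
  show ?thesis using assms finite_all_faces unfolding velocity_fun_def sum.cartesian_product by (simp add: case_prod_beta)
qed

lemma slab_lmeasurable:
  assumes "A \<in> lmeasurable" "T > 0" "steps S \<ge> 1"
  shows "A \<times> {time_level T S n<..<time_level T S (Suc n)} \<in> lmeasurable"
    and "vol A > 0 \<Longrightarrow> measure lebesgue (A \<times> {time_level T S n<..<time_level T S (Suc n)}) > 0"
proof -
  have t: "time_level T S (Suc n) - time_level T S n = T / real (steps S)" "T / real (steps S) > 0"
    using assms by (auto simp: time_level_def time_step_def algebra_simps add_divide_distrib)
  then have le: "time_level T S n \<le> time_level T S (Suc n)" by linarith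
  show "A \<times> {time_level T S n<..<time_level T S (Suc n)} \<in> lmeasurable"
    by (rule lmeasurable_Times_interval(1)[OF assms(1) le])
  have "measure lebesgue (A \<times> {time_level T S n<..<time_level T S (Suc n)}) = vol A * (T / real (steps S))"
    using lmeasurable_Times_interval(2)[OF assms(1), of "time_level T S n" "time_level T S (Suc n)"] t by simp
  then show "vol A > 0 \<Longrightarrow> measure lebesgue (A \<times> {time_level T S n<..<time_level T S (Suc n)}) > 0" using mult_pos_pos[OF _ t(2), of "vol A"] by simp
qed

lemma time_slab_subset:
  assumes "T > 0" "steps S \<ge> 1" "n < steps S" "A \<subseteq> \<Omega>"
  shows "A \<times> {time_level T S n<..<time_level T S (Suc n)} \<subseteq> \<Omega> \<times> {0<..<T}"
proof -
  have "time_level T S (Suc n) \<le> time_level T S (steps S)" "time_level T S 0 \<le> time_level T S n"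
    using assms by (intro time_level_mono; simp)+
  moreover have "time_level T S (steps S) = T" "time_level T S 0 = 0" using assms by (auto simp: time_level_def time_step_def)
  ultimately show ?thesis using assms(4) by auto
qed

lemma cylinder:
  fixes T :: real
  shows "\<Omega> \<times> {0<..<T} \<in> lmeasurable" "\<Omega> \<times> {0<..<T} \<in> sets lebesgue" "open (\<Omega> \<times> {0<..<T})"
proof -
  show o: "open (\<Omega> \<times> {0<..<T})" using open_\<Omega> by (intro open_Times) auto
  then show "\<Omega> \<times> {0<..<T} \<in> sets lebesgue" by simp
  show "\<Omega> \<times> {0<..<T} \<in> lmeasurable"
    using o bounded_\<Omega> by (intro lmeasurable_open bounded_Times) auto
qed

lemma density_bound:
  assumes b: "Linf_norm (\<Omega> \<times> {0<..<T}) (density_fun T M S) \<le> ereal c" and T: "T > 0" "steps S \<ge> 1"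
    and n: "n < steps S" and K: "K \<in> cells M"
  shows "\<bar>density S (Suc n) K\<bar> \<le> c"
proof -
  let ?E = "K \<times> {time_level T S n<..<time_level T S (Suc n)}"
  have "\<exists>z\<in>?E. norm (density_fun T M S z) \<le> c"
    by (rule AE_positive_measure_ex[OF Linf_norm_AE[OF b] cylinder(2)])
      (use slab_lmeasurable[OF cell_lmeasurable[OF K] T] vol_pos[OF K] time_slab_subset[OF T n cell(1)[OF K]] in auto)
  then obtain z where "z \<in> ?E" "norm (density_fun T M S z) \<le> c" by blast
  moreover from this have "density_fun T M S z = density S (Suc n) K"
    using T n K by (intro density_fun_value) auto
  ultimately show ?thesis by simp
qed

lemma velocity_bound:
  assumes b: "Linf_norm (\<Omega> \<times> {0<..<T}) (velocity_fun T M S) \<le> ereal c" and T: "T > 0" "steps S \<ge> 1"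
    and n: "n < steps S" and \<sigma>: "\<sigma> \<in> all_faces M"
  shows "norm (velocity S (Suc n) \<sigma>) \<le> c"
proof -
  let ?E = "dual_cell M \<sigma> \<times> {time_level T S n<..<time_level T S (Suc n)}"
  have "\<exists>z\<in>?E. norm (velocity_fun T M S z) \<le> c"
    by (rule AE_positive_measure_ex[OF Linf_norm_AE[OF b] cylinder(2)])
      (use slab_lmeasurable[OF dual_cell_lmeasurable T] vol_dual_cell_pos[OF \<sigma>] time_slab_subset[OF T n dual_cell_subset] in auto)
  then obtain z where "z \<in> ?E" "norm (velocity_fun T M S z) \<le> c" by blast
  moreover from this have "velocity_fun T M S z = velocity S (Suc n) \<sigma>"
    using T n \<sigma> by (intro velocity_fun_value) auto
  ultimately show ?thesis by simp
qed

lemma density_fun_measurable: "density_fun T M S \<in> borel_measurable lebesgue"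
  and velocity_fun_measurable: "velocity_fun T M S \<in> borel_measurable lebesgue"
proof -
  have slab: "A \<times> {a<..b} \<in> sets lebesgue" if A: "A \<in> lmeasurable" for A :: "(real^'d) set" and a b :: real
  proof (cases "a \<le> b")
    case True
    have "A \<times> {a<..<b} \<in> sets lebesgue" using lmeasurable_Times_interval(1)[OF A True] by (auto simp: fmeasurable_def)
    \<comment> \<open>The closed end lies in a hyperplane; being null it is measurable, although
      \<open>A\<close> is only Lebesgue measurable.\<close>
    moreover have "negligible (A \<times> {b})"
    proof (rule negligible_subset)
      show "negligible {z :: (real^'d) \<times> real. (0, 1) \<bullet> z = b}" by (rule negligible_hyperplane) (simp add: zero_prod_def)
    qed auto
    then have "A \<times> {b} \<in> sets lebesgue" by (rule negligible_imp_sets)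
    ultimately have "A \<times> {a<..<b} \<union> A \<times> (if a < b then {b} else {}) \<in> sets lebesgue" by auto
    moreover have "A \<times> {a<..<b} \<union> A \<times> (if a < b then {b} else {}) = A \<times> {a<..b}" using True by force
    ultimately show ?thesis by simp
  qed simp
  show "density_fun T M S \<in> borel_measurable lebesgue"
    unfolding density_fun_def[abs_def]
    by (intro borel_measurable_sum borel_measurable_times borel_measurable_const borel_measurable_indicator slab cell_lmeasurable)
  show "velocity_fun T M S \<in> borel_measurable lebesgue"
    unfolding velocity_fun_def[abs_def]
    by (intro borel_measurable_sum borel_measurable_scaleR borel_measurable_const borel_measurable_indicator slab dual_cell_lmeasurable)
qed

lemma negligible_uncovered: "negligible (\<Omega> - \<Union>(cells M))"
proof (rule negligible_subset)
  show "negligible (\<Union>K\<in>cells M. \<Union>(faces M K))"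
  proof (intro negligible_finite_UN finite_cells negligible_Union)
    show "finite (faces M K)" if "K \<in> cells M" for K by (rule cell(6)[OF that])
    show "negligible \<sigma>" if "K \<in> cells M" "\<sigma> \<in> faces M K" for K \<sigma>
      by (rule negligible_aff_lowdim) (use facial[OF that] in \<open>simp add: facial_def\<close>)
  qed
  show "\<Omega> - \<Union>(cells M) \<subseteq> (\<Union>K\<in>cells M. \<Union>(faces M K))"
  proof
    fix x assume x: "x \<in> \<Omega> - \<Union>(cells M)"
    then obtain K where K: "K \<in> cells M" "x \<in> closure K"
      using pm closure_subset unfolding primal_mesh_def by blast
    then have "x \<in> frontier K" using x cell(3)[OF K(1)] by (auto simp: frontier_def interior_open)
    then show "x \<in> (\<Union>K\<in>cells M. \<Union>(faces M K))" using cell(5)[OF K(1)] K(1) by blast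
  qed
qed

end

section \<open>Space-time boxes, Riemann sums and the total error\<close>

context consistency
begin

lemma time_box_slab: "time_box n A = A \<times> {time_level T S n<..<time_level T S (Suc n)}"
  by (simp add: time_box_def t_def)

lemma time_box_negligible_complement:
  "negligible (\<Omega> \<times> {0<..<T} - (\<Union>a\<in>{..<steps S} \<times> cells M. time_box (fst a) (snd a)))"
proof (rule negligible_subset)
  have n1: "negligible ((\<Omega> - \<Union>(cells M)) \<times> {0<..<T})"
  proof -
    have l: "\<Omega> - \<Union>(cells M) \<in> lmeasurable" and z: "vol (\<Omega> - \<Union>(cells M)) = 0"
      using negligible_uncovered by (auto simp: negligible_iff_measure)
    show ?thesis using lmeasurable_Times_interval[OF l, of 0 T] T z by (simp add: negligible_iff_measure)
  qed
  have n2: "negligible (\<Union>n\<le>steps S. {z :: (real^'d) \<times> real. (0, 1) \<bullet> z = t n})"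
    by (intro negligible_finite_UN negligible_hyperplane) (auto simp: zero_prod_def)
  show "negligible ((\<Omega> - \<Union>(cells M)) \<times> {0<..<T} \<union> (\<Union>n\<le>steps S. {z. (0, 1) \<bullet> z = t n}))"
    by (rule negligible_Un[OF n1 n2])
  show "\<Omega> \<times> {0<..<T} - (\<Union>a\<in>{..<steps S} \<times> cells M. time_box (fst a) (snd a))
    \<subseteq> (\<Omega> - \<Union>(cells M)) \<times> {0<..<T} \<union> (\<Union>n\<le>steps S. {z. (0, 1) \<bullet> z = t n})"
  proof
    fix z assume z: "z \<in> \<Omega> \<times> {0<..<T} - (\<Union>a\<in>{..<steps S} \<times> cells M. time_box (fst a) (snd a))"
    obtain x \<tau> where x: "z = (x, \<tau>)" by (cases z)
    then have x\<Omega>: "x \<in> \<Omega>" "0 < \<tau>" "\<tau> < T" using z by auto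
    \<comment> \<open>The first level not before \<open>\<tau>\<close> is positive since
      \<open>\<tau> > 0\<close>; its predecessor \<open>k\<close> is the index of the box.\<close>
    define n where "n = (LEAST n. \<tau> \<le> t n)"
    have ex: "\<tau> \<le> t (steps S)" using x\<Omega> t_simps by simp
    have n: "\<tau> \<le> t n" "n \<le> steps S" unfolding n_def using LeastI[of "\<lambda>n. \<tau> \<le> t n", OF ex] Least_le[of "\<lambda>n. \<tau> \<le> t n", OF ex] by auto
    have "n \<noteq> 0" using n x\<Omega> t_simps(1) by (metis not_le)
    then obtain k where k: "n = Suc k" by (cases n) auto
    have "\<not> \<tau> \<le> t k" using not_less_Least[of k "\<lambda>n. \<tau> \<le> t n"] k unfolding n_def by auto
    then have \<tau>: "t k < \<tau>" "\<tau> \<le> t (Suc k)" "k < steps S" using n k by auto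
    show "z \<in> (\<Omega> - \<Union>(cells M)) \<times> {0<..<T} \<union> (\<Union>n\<le>steps S. {z. (0, 1) \<bullet> z = t n})"
    proof (cases "x \<in> \<Union>(cells M) \<and> \<tau> \<noteq> t n")
      case True
      then obtain K where "K \<in> cells M" "x \<in> K" by blast
      then have "z \<in> time_box k K" "(k, K) \<in> {..<steps S} \<times> cells M" using True \<tau> k x by (auto simp: time_box_def)
      then show ?thesis using z by force
    next
      case False
      then show ?thesis using x x\<Omega> n(2) by auto
    qed
  qed
qed

lemma point_close:
  assumes n: "n < steps S" and K: "K \<in> cells M" and z: "z \<in> time_box n K"
  shows "dist z (xc K, t (Suc n)) < \<delta>" "z \<in> closure \<Omega> \<times> {0..T}" "(xc K, t (Suc n)) \<in> closure \<Omega> \<times> {0..T}"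
proof -
  obtain x \<tau> where x: "z = (x, \<tau>)" "x \<in> K" "t n < \<tau>" "\<tau> < t (Suc n)" using z by (auto simp: time_box_def)
  have "dist z (xc K, t (Suc n)) \<le> dist (x, \<tau>) (x, t (Suc n)) + dist (x, t (Suc n)) (xc K, t (Suc n))"
    unfolding x(1) by (rule dist_triangle)
  also have "\<dots> \<le> dt + diameter K"
  proof (rule add_mono)
    show "dist (x, \<tau>) (x, t (Suc n)) \<le> dt" using x t_simps(3)[of n] by (simp add: dist_Pair_Pair dist_real_def)
    have "x \<in> closure K" "xc K \<in> closure K" using x xc[OF K] closure_subset by blast+
    then show "dist (x, t (Suc n)) (xc K, t (Suc n)) \<le> diameter K"
      using dist_cell_closure[OF K] by (simp add: dist_Pair_Pair)
  qed
  finally show "dist z (xc K, t (Suc n)) < \<delta>" using mesh_size_less[OF K] by linarith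
  show "z \<in> closure \<Omega> \<times> {0..T}" "(xc K, t (Suc n)) \<in> closure \<Omega> \<times> {0..T}"
    using x t_bounds[of n] t_bounds[of "Suc n"] n xc[OF K] cell(1)[OF K] closure_subset[of \<Omega>] by auto
qed

lemma time_boxes:
  "finite ({..<steps S} \<times> cells M)"
  "a \<in> {..<steps S} \<times> cells M \<Longrightarrow> time_box (fst a) (snd a) \<in> lmeasurable"
  "disjoint_family_on (\<lambda>a. time_box (fst a) (snd a)) ({..<steps S} \<times> cells M)"
  "a \<in> {..<steps S} \<times> cells M \<Longrightarrow> time_box (fst a) (snd a) \<subseteq> \<Omega> \<times> {0<..<T}"
proof -
  show "disjoint_family_on (\<lambda>a. time_box (fst a) (snd a)) ({..<steps S} \<times> cells M)"
    unfolding disjoint_family_on_def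
  proof (intro ballI impI time_box_disjoint)
    fix a b assume "a \<in> {..<steps S} \<times> cells M" "b \<in> {..<steps S} \<times> cells M" "a \<noteq> b"
    then show "fst a \<noteq> fst b \<or> snd a \<inter> snd b = {}"
      using disjoint_cells[of "snd a" "snd b"] by (cases "fst a = fst b") (auto simp: prod_eq_iff)
  qed
  show "a \<in> {..<steps S} \<times> cells M \<Longrightarrow> time_box (fst a) (snd a) \<subseteq> \<Omega> \<times> {0<..<T}"
    by (intro time_box_subset cell(1)) auto
qed (use finite_cells time_box_lmeasurable(1) cell_lmeasurable in auto)

lemma sum_time_box: "(\<Sum>n<steps S. \<Sum>K\<in>cells M. (vol K * dt) * f n K)
   = (\<Sum>a\<in>{..<steps S} \<times> cells M. measure lebesgue (time_box (fst a) (snd a)) * f (fst a) (snd a))"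
  unfolding sum.cartesian_product
  by (intro sum.cong refl) (auto simp: time_box_lmeasurable(2)[OF cell_lmeasurable])

lemma riemann_sum:
  assumes "set_integrable lebesgue (\<Omega> \<times> {0<..<T}) Q"
    and "\<And>z z'. z \<in> closure \<Omega> \<times> {0..T} \<Longrightarrow> z' \<in> closure \<Omega> \<times> {0..T} \<Longrightarrow> dist z z' < \<delta> \<Longrightarrow> \<bar>Q z - Q z'\<bar> \<le> \<omega>"
  shows "\<bar>(\<Sum>n<steps S. \<Sum>K\<in>cells M. (vol K * dt) * Q (xc K, t (Suc n))) - (LINT z:\<Omega> \<times> {0<..<T}|lebesgue. Q z)\<bar>
    \<le> \<omega> * measure lebesgue (\<Omega> \<times> {0<..<T})"
  unfolding sum_time_box
proof (rule riemann_sum_close[OF time_boxes cylinder(1) time_box_negligible_complement assms(1) nonneg(3)])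
  fix a z assume "a \<in> {..<steps S} \<times> cells M" "z \<in> time_box (fst a) (snd a)"
  then show "\<bar>Q z - Q (xc (snd a), t (Suc (fst a)))\<bar> \<le> \<omega>"
    using point_close[of "fst a" "snd a" z] by (intro assms(2)) auto
qed

lemma sum_vol_le: "(\<Sum>n<steps S. \<Sum>K\<in>cells M. (vol K * dt) * c) \<le> measure lebesgue (\<Omega> \<times> {0<..<T}) * c" if "c \<ge> 0"
proof -
  have "(\<Sum>a\<in>{..<steps S} \<times> cells M. measure lebesgue (time_box (fst a) (snd a)))
     = measure lebesgue (\<Union>a\<in>{..<steps S} \<times> cells M. time_box (fst a) (snd a))"
  proof (rule measure_finite_Union[symmetric])
    show "emeasure lebesgue (time_box (fst a) (snd a)) \<noteq> \<infinity>" if "a \<in> {..<steps S} \<times> cells M" for a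
      using fmeasurableD2[OF time_boxes(2)[OF that]] by simp
    show "(\<lambda>a. time_box (fst a) (snd a)) ` ({..<steps S} \<times> cells M) \<subseteq> sets lebesgue"
      using time_boxes(2) by (auto dest: fmeasurableD)
  qed (rule time_boxes(1) time_boxes(3))+
  also have "\<dots> \<le> measure lebesgue (\<Omega> \<times> {0<..<T})"
  proof (rule measure_mono_fmeasurable)
    show "(\<Union>a\<in>{..<steps S} \<times> cells M. time_box (fst a) (snd a)) \<in> sets lebesgue"
      by (intro sets.finite_UN time_boxes(1) fmeasurableD time_boxes(2))
  qed (use time_boxes(4) cylinder(1) in blast)+
  finally show ?thesis unfolding sum_time_box using that by (simp add: mult_right_mono flip: sum_distrib_right)
qed

text \<open>The density is constant on cells, the velocity only on half-diamonds, so a velocity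
  error is first integrated over its half-diamond. Passing to the whole cell costs a factor
  \<open>N\<close>, as the half-diamonds share the volume of the cell equally.\<close>

lemma err_sum:
  assumes a: "integrable (lebesgue_on (\<Omega> \<times> {0<..<T})) (\<lambda>z. norm (density_fun T M S z - r z))"
      "(LINT z|lebesgue_on (\<Omega> \<times> {0<..<T}). norm (density_fun T M S z - r z)) \<le> a"
    and b: "integrable (lebesgue_on (\<Omega> \<times> {0<..<T})) (\<lambda>z. norm (velocity_fun T M S z - U z))"
      "(LINT z|lebesgue_on (\<Omega> \<times> {0<..<T}). norm (velocity_fun T M S z - U z)) \<le> b"
  defines "V \<equiv> measure lebesgue (\<Omega> \<times> {0<..<T})"
  shows "(\<Sum>n<steps S. \<Sum>K\<in>cells M. (vol K * dt) * (err (Suc n) K + \<omega>)) \<le> (a + \<omega> * V) + N * (b + \<omega> * V) + V * \<omega>"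
proof -
  let ?X = "\<Omega> \<times> {0<..<T}"
  let ?e1 = "\<lambda>n K. norm (density S (Suc n) K - r (xc K, t (Suc n)))"
  let ?e2 = "\<lambda>n K \<sigma>. norm (velocity S (Suc n) \<sigma> - U (xc K, t (Suc n)))"
  have T0: "T \<ge> 0" using T by simp
  have 1: "(\<Sum>n<steps S. \<Sum>K\<in>cells M. (vol K * dt) * ?e1 n K) \<le> a + \<omega> * V"
  proof -
    have "(\<Sum>c\<in>{..<steps S} \<times> cells M. measure lebesgue (time_box (fst c) (snd c)) * ?e1 (fst c) (snd c))
       \<le> (LINT z|lebesgue_on ?X. norm (density_fun T M S z - r z)) + \<omega> * measure lebesgue ?X"
    proof (rule step_function_L1[OF time_boxes cylinder(1) nonneg(3) a(1)])
      fix c z assume c: "c \<in> {..<steps S} \<times> cells M" "z \<in> time_box (fst c) (snd c)"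
      then show "density_fun T M S z = density S (Suc (fst c)) (snd c)"
        by (intro density_fun_value[OF T0]) (auto simp: time_box_slab)
      show "norm (r z - r (xc (snd c), t (Suc (fst c)))) \<le> \<omega>"
        using point_close[of "fst c" "snd c" z] c rU_mod by fastforce
    qed
    then show ?thesis using a(2) unfolding sum_time_box V_def by linarith
  qed
  \<comment> \<open>Indices are triples of a time level, a cell and a face of that cell.
    Half-diamonds replace dual cells since \<open>xc K\<close> is tied to one cell.\<close>
  define I where "I = (SIGMA p:{..<steps S} \<times> cells M. faces M (snd p))"
  define E where "E c = time_box (fst (fst c)) (half_diamond M (snd (fst c)) (snd c))" for c
  have I: "finite I" unfolding I_def using finite_cells cell(6) by (intro finite_SigmaI) auto
  have Em: "E c \<in> lmeasurable" "measure lebesgue (E c) = vol (half_diamond M (snd (fst c)) (snd c)) * dt" if "c \<in> I" for c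
    using that unfolding E_def I_def by (auto intro!: time_box_lmeasurable half_diamond(1))
  have "(\<Sum>c\<in>I. measure lebesgue (E c) * ?e2 (fst (fst c)) (snd (fst c)) (snd c))
       \<le> (LINT z|lebesgue_on ?X. norm (velocity_fun T M S z - U z)) + \<omega> * measure lebesgue ?X"
  proof (rule step_function_L1[OF I Em(1) _ _ cylinder(1) nonneg(3) b(1)])
    show "disjoint_family_on E I"
      unfolding disjoint_family_on_def E_def
    proof (intro ballI impI time_box_disjoint)
      fix c c' assume "c \<in> I" "c' \<in> I" "c \<noteq> c'"
      then show "fst (fst c) \<noteq> fst (fst c') \<or> half_diamond M (snd (fst c)) (snd c) \<inter> half_diamond M (snd (fst c')) (snd c') = {}"
        using half_diamond_disjoint[of "snd (fst c)" "snd c" "snd (fst c')" "snd c'"] unfolding I_def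
        by (cases "fst (fst c) = fst (fst c')") (auto simp: prod_eq_iff)
    qed
    fix c assume c: "c \<in> I"
    then have K: "fst (fst c) < steps S" "snd (fst c) \<in> cells M" "snd c \<in> faces M (snd (fst c))" by (auto simp: I_def)
    note D = half_diamond(2)[OF K(2,3)]
    show "E c \<subseteq> ?X" unfolding E_def using D cell(1)[OF K(2)] K(1) by (intro time_box_subset) auto
    fix z assume z: "z \<in> E c"
    have "half_diamond M (snd (fst c)) (snd c) \<subseteq> dual_cell M (snd c)"
      using K unfolding dual_cell_eq cells_of_def by blast
    then show "velocity_fun T M S z = velocity S (Suc (fst (fst c))) (snd c)"
      using z K by (intro velocity_fun_value[OF T0]) (auto simp: E_def time_box_slab all_faces_def)
    have "z \<in> time_box (fst (fst c)) (snd (fst c))" using z D by (auto simp: E_def time_box_def)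
    note pc = point_close[OF K(1,2) this]
    show "norm (U z - U (xc (snd (fst c)), t (Suc (fst (fst c))))) \<le> \<omega>"
      using rU_mod[OF pc(2,3,1)] by simp
  qed
  also have "\<dots> \<le> b + \<omega> * V" using b(2) by (simp add: V_def)
  also have "(\<Sum>c\<in>I. measure lebesgue (E c) * ?e2 (fst (fst c)) (snd (fst c)) (snd c))
    = (\<Sum>n<steps S. \<Sum>K\<in>cells M. \<Sum>\<sigma>\<in>faces M K. (vol (half_diamond M K \<sigma>) * dt) * ?e2 n K \<sigma>)"
  proof -
    have "(\<Sum>c\<in>I. measure lebesgue (E c) * ?e2 (fst (fst c)) (snd (fst c)) (snd c))
      = (\<Sum>c\<in>I. (vol (half_diamond M (snd (fst c)) (snd c)) * dt) * ?e2 (fst (fst c)) (snd (fst c)) (snd c))"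
      by (intro sum.cong refl) (simp add: Em(2))
    also have "\<dots> = (\<Sum>p\<in>{..<steps S} \<times> cells M. \<Sum>\<sigma>\<in>faces M (snd p). (vol (half_diamond M (snd p) \<sigma>) * dt) * ?e2 (fst p) (snd p) \<sigma>)"
      unfolding I_def by (subst sum.Sigma) (use finite_cells cell(6) in \<open>auto simp: case_prod_beta\<close>)
    finally show ?thesis unfolding sum.cartesian_product by (simp add: case_prod_beta)
  qed
  finally have 2: "(\<Sum>n<steps S. \<Sum>K\<in>cells M. \<Sum>\<sigma>\<in>faces M K. (vol (half_diamond M K \<sigma>) * dt) * ?e2 n K \<sigma>) \<le> b + \<omega> * V" .
  have 3: "(vol K * dt) * err (Suc n) K \<le> (vol K * dt) * ?e1 n K + N * (\<Sum>\<sigma>\<in>faces M K. (vol (half_diamond M K \<sigma>) * dt) * ?e2 n K \<sigma>)"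
    if K: "K \<in> cells M" for n K
  proof -
    have "vol K \<le> N * vol (half_diamond M K \<sigma>)" if "\<sigma> \<in> faces M K" for \<sigma>
    proof -
      have "real (card (faces M K)) > 0" using cell(6,7)[OF K] by (simp add: card_gt_0_iff)
      then have "vol K = real (card (faces M K)) * vol (half_diamond M K \<sigma>)"
        using half_diamond(3)[OF K that] by simp
      then show ?thesis using mult_right_mono[OF card_le[OF K], of "vol (half_diamond M K \<sigma>)"] by simp
    qed
    then have "(\<Sum>\<sigma>\<in>faces M K. (vol K * dt) * ?e2 n K \<sigma>) \<le> (\<Sum>\<sigma>\<in>faces M K. ((N * vol (half_diamond M K \<sigma>)) * dt) * ?e2 n K \<sigma>)"
      using dt_pos by (intro sum_mono mult_right_mono) auto
    then show ?thesis unfolding err_def by (simp add: distrib_left sum_distrib_left mult.assoc)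
  qed
  have "(\<Sum>n<steps S. \<Sum>K\<in>cells M. (vol K * dt) * (err (Suc n) K + \<omega>))
    = (\<Sum>n<steps S. \<Sum>K\<in>cells M. (vol K * dt) * err (Suc n) K) + (\<Sum>n<steps S. \<Sum>K\<in>cells M. (vol K * dt) * \<omega>)"
    by (simp add: distrib_left sum.distrib)
  also have "\<dots> \<le> (\<Sum>n<steps S. \<Sum>K\<in>cells M. (vol K * dt) * ?e1 n K + N * (\<Sum>\<sigma>\<in>faces M K. (vol (half_diamond M K \<sigma>) * dt) * ?e2 n K \<sigma>)) + V * \<omega>"
    unfolding V_def by (intro add_mono sum_mono 3 sum_vol_le nonneg)
  also have "\<dots> = (\<Sum>n<steps S. \<Sum>K\<in>cells M. (vol K * dt) * ?e1 n K)
      + N * (\<Sum>n<steps S. \<Sum>K\<in>cells M. \<Sum>\<sigma>\<in>faces M K. (vol (half_diamond M K \<sigma>) * dt) * ?e2 n K \<sigma>) + V * \<omega>"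
    by (simp add: sum.distrib sum_distrib_left)
  also have "\<dots> \<le> (a + \<omega> * V) + N * (b + \<omega> * V) + V * \<omega>"
    by (rule add_right_mono[OF add_mono[OF 1 mult_left_mono[OF 2 N]]])
  finally show ?thesis .
qed

end

section \<open>Transfer of the uniform mesh bounds, and auxiliary estimates\<close>

context adm_mesh
begin

lemma H3_mono: assumes "H3 C M S" "C \<le> C'" shows "H3 C' M S"
  unfolding H3_def
proof (intro allI impI ballI)
  fix n K \<sigma> \<epsilon> assume *: "n \<le> steps S" "K \<in> cells M" "\<sigma> \<in> faces M K" "\<epsilon> \<in> {\<epsilon> \<in> dual_faces M \<sigma>. fst \<epsilon> = K}"
  let ?m = "Max ((\<lambda>\<sigma>'. \<bar>flux S n K \<sigma>'\<bar>) ` faces M K)"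
  have "?m \<in> (\<lambda>\<sigma>'. \<bar>flux S n K \<sigma>'\<bar>) ` faces M K" using cell(6,7)[OF *(2)] by (intro Max_in) auto
  then have "?m \<ge> 0" by auto
  then have "C * ?m \<le> C' * ?m" using assms(2) by (intro mult_right_mono)
  moreover have "\<bar>dual_flux S n \<sigma> \<epsilon>\<bar> \<le> C * ?m" using assms(1) * unfolding H3_def by blast
  ultimately show "\<bar>dual_flux S n \<sigma> \<epsilon>\<bar> \<le> C' * ?m" by linarith
qed

lemma theta1_bound: assumes "theta1 M \<le> \<theta>" "K \<in> cells M" shows "diameter K ^ CARD('d) \<le> \<theta> * vol K"
proof -
  have "diameter K ^ CARD('d) / vol K \<le> theta1 M"
    unfolding theta1_def using finite_cells assms(2) by (intro Max_ge) auto
  then have "diameter K ^ CARD('d) / vol K \<le> \<theta>" using assms(1) by linarith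
  then show ?thesis using vol_pos[OF assms(2)] by (simp add: divide_le_eq)
qed

lemma theta2_bound: assumes "theta2 M \<le> \<theta>" "interface M K L \<sigma>" shows "vol K \<le> \<theta> * vol L"
proof -
  let ?R = "{vol K / vol L | K L. \<exists>\<sigma>. interface M K L \<sigma>}"
  have "?R \<subseteq> (\<lambda>(K, L). vol K / vol L) ` (cells M \<times> cells M)" by (auto simp: interface_def)
  then have "finite ?R" using finite_cells finite_subset by blast
  moreover have "vol K / vol L \<in> ?R" using assms(2) by blast
  ultimately have "vol K / vol L \<le> theta2 M" unfolding theta2_def by (intro Max_ge) auto
  then have "vol K / vol L \<le> \<theta>" using assms(1) by linarith
  then show ?thesis using vol_pos[of L] assms(2) by (simp add: divide_le_eq interface_def)
qed

end

lemma tendsto_of_eventual_bound: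
  fixes a :: "nat \<Rightarrow> real"
  assumes k: "k \<ge> 0" and ev: "\<And>\<eta>. \<eta> > 0 \<Longrightarrow> \<forall>\<^sub>F m in sequentially. \<bar>a m - l\<bar> \<le> k * \<eta>"
  shows "a \<longlonglongrightarrow> l"
proof (rule tendstoI)
  fix e :: real assume e: "e > 0"
  have "k * (e / (k + 1)) < e" using k e by (simp add: field_simps)
  moreover have "\<forall>\<^sub>F m in sequentially. \<bar>a m - l\<bar> \<le> k * (e / (k + 1))" using k e by (intro ev) auto
  ultimately show "\<forall>\<^sub>F m in sequentially. dist (a m) l < e"
    by (auto elim!: eventually_mono simp: dist_real_def)
qed

text \<open>The products are expanded with one factor changing at a time. The estimate serves twice:
  comparison with zero bounds the integrand of the limit, and comparison of two states replaces
  \<open>r\<close> and \<open>U\<close> by the limits.\<close>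

lemma flux_function_lipschitz:
  fixes v V G :: "real^'d" and \<rho> r g :: real
  assumes b: "\<bar>\<rho>\<bar> \<le> B" "norm v \<le> B" "norm V \<le> B" "\<bar>g\<bar> \<le> \<Lambda>" "norm G \<le> \<Gamma>"
  shows "\<bar>(r * V $ i * g + r * V $ i * (V \<bullet> G)) - (\<rho> * v $ i * g + \<rho> * v $ i * (v \<bullet> G))\<bar>
    \<le> (B * \<Lambda> + 2 * B\<^sup>2 * \<Gamma>) * (\<bar>\<rho> - r\<bar> + norm (v - V))"
proof -
  let ?e = "\<bar>\<rho> - r\<bar> + norm (v - V)"
  have nn: "B \<ge> 0" "\<Lambda> \<ge> 0" "\<Gamma> \<ge> 0" "?e \<ge> 0" using b norm_ge_zero[of v] norm_ge_zero[of G]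
    by (linarith, linarith, linarith, simp)
  have comp: "\<bar>V $ i\<bar> \<le> B" "\<bar>v $ i\<bar> \<le> B" "\<bar>V $ i - v $ i\<bar> \<le> norm (v - V)"
    using component_le_norm_cart[of V i] component_le_norm_cart[of v i] component_le_norm_cart[of "v - V" i] b by auto
  have d: "\<bar>r * V $ i - \<rho> * v $ i\<bar> \<le> B * ?e"
  proof -
    have "r * V $ i - \<rho> * v $ i = (r - \<rho>) * V $ i + \<rho> * (V $ i - v $ i)" by (simp add: algebra_simps)
    also have "\<bar>\<dots>\<bar> \<le> \<bar>r - \<rho>\<bar> * \<bar>V $ i\<bar> + \<bar>\<rho>\<bar> * \<bar>V $ i - v $ i\<bar>"
      by (rule order_trans[OF abs_triangle_ineq]) (simp add: abs_mult)
    also have "\<dots> \<le> \<bar>\<rho> - r\<bar> * B + B * norm (v - V)"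
      by (intro add_mono mult_mono comp b) (use nn in auto)
    finally show ?thesis by (simp add: algebra_simps)
  qed
  have VG: "\<bar>V \<bullet> G\<bar> \<le> B * \<Gamma>" "\<bar>(V - v) \<bullet> G\<bar> \<le> norm (v - V) * \<Gamma>"
    by (rule order_trans[OF Cauchy_Schwarz_ineq2], rule mult_mono, use b nn in \<open>auto simp: norm_minus_commute\<close>)+
  have "(r * V $ i * g + r * V $ i * (V \<bullet> G)) - (\<rho> * v $ i * g + \<rho> * v $ i * (v \<bullet> G))
    = (r * V $ i - \<rho> * v $ i) * g + ((r * V $ i - \<rho> * v $ i) * (V \<bullet> G) + (\<rho> * v $ i) * ((V - v) \<bullet> G))"
    by (simp add: algebra_simps inner_diff_left)
  also have "\<bar>\<dots>\<bar> \<le> (B * ?e) * \<Lambda> + ((B * ?e) * (B * \<Gamma>) + (B * B) * (norm (v - V) * \<Gamma>))"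
  proof (rule order_trans[OF abs_triangle_ineq], rule add_mono)
    show "\<bar>(r * V $ i - \<rho> * v $ i) * g\<bar> \<le> (B * ?e) * \<Lambda>"
      unfolding abs_mult by (rule mult_mono[OF d b(4)]) (use nn in auto)
    show "\<bar>(r * V $ i - \<rho> * v $ i) * (V \<bullet> G) + (\<rho> * v $ i) * ((V - v) \<bullet> G)\<bar> \<le> (B * ?e) * (B * \<Gamma>) + (B * B) * (norm (v - V) * \<Gamma>)"
    proof (rule order_trans[OF abs_triangle_ineq], rule add_mono)
      show "\<bar>(r * V $ i - \<rho> * v $ i) * (V \<bullet> G)\<bar> \<le> (B * ?e) * (B * \<Gamma>)"
        unfolding abs_mult by (rule mult_mono[OF d VG(1)]) (use nn in auto)
      have "\<bar>\<rho>\<bar> * \<bar>v $ i\<bar> \<le> B * B" by (rule mult_mono[OF b(1) comp(2)]) (use nn in auto)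
      then show "\<bar>(\<rho> * v $ i) * ((V - v) \<bullet> G)\<bar> \<le> (B * B) * (norm (v - V) * \<Gamma>)"
        unfolding abs_mult by (rule mult_mono[OF _ VG(2)]) (use nn in auto)
    qed
  qed
  also have "(B * B) * (norm (v - V) * \<Gamma>) \<le> (B * B) * (?e * \<Gamma>)"
    using nn by (intro mult_left_mono mult_right_mono) auto
  finally show ?thesis by (simp add: algebra_simps power2_eq_square)
qed

text \<open>Combines uniform convergence of the discrete functions with the \<open>L\<^sup>1\<close>
  approximation of the limits; on a set of finite measure the uniform part is integrable.\<close>

lemma L1_triangle:
  fixes f g h :: "'a::euclidean_space \<Rightarrow> 'b::euclidean_space"
  assumes X: "X \<in> lmeasurable" and m: "f \<in> borel_measurable (lebesgue_on X)" "h \<in> borel_measurable (lebesgue_on X)"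
    and fg: "AE z in lebesgue_on X. norm (f z - g z) \<le> \<eta>"
    and gh: "integrable (lebesgue_on X) (\<lambda>z. norm (g z - h z))" "(LINT z|lebesgue_on X. norm (g z - h z)) \<le> e"
  shows "integrable (lebesgue_on X) (\<lambda>z. norm (f z - h z))"
    and "(LINT z|lebesgue_on X. norm (f z - h z)) \<le> \<eta> * measure lebesgue X + e"
proof -
  interpret finite_measure "lebesgue_on X"
    using X by (auto intro!: finite_measureI simp: emeasure_restrict_space fmeasurable_def)
  have Xm: "X \<in> sets lebesgue" using X by (rule fmeasurableD)
  have i: "integrable (lebesgue_on X) (\<lambda>z. \<eta> + norm (g z - h z))" using gh(1) by (intro Bochner_Integration.integrable_add) auto
  have ae: "AE z in lebesgue_on X. norm (f z - h z) \<le> \<eta> + norm (g z - h z)"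
    using fg
  proof eventually_elim
    case (elim z)
    have "norm (f z - h z) \<le> norm (f z - g z) + norm (g z - h z)" by (rule norm_diff_triangle_le[OF order_refl order_refl])
    then show ?case using elim by linarith
  qed
  show 1: "integrable (lebesgue_on X) (\<lambda>z. norm (f z - h z))"
  proof (rule Bochner_Integration.integrable_bound[OF i])
    show "(\<lambda>z. norm (f z - h z)) \<in> borel_measurable (lebesgue_on X)"
      using m by measurable
    show "AE z in lebesgue_on X. norm (norm (f z - h z)) \<le> norm (\<eta> + norm (g z - h z))"
      using ae by eventually_elim auto
  qed
  have "(LINT z|lebesgue_on X. norm (f z - h z)) \<le> (LINT z|lebesgue_on X. \<eta> + norm (g z - h z))"
    by (rule integral_mono_AE[OF 1 i ae])
  also have "\<dots> = \<eta> * measure lebesgue X + (LINT z|lebesgue_on X. norm (g z - h z))"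
    using gh(1) Xm by (subst Bochner_Integration.integral_add) (auto simp: measure_restrict_space)
  finally show "(LINT z|lebesgue_on X. norm (f z - h z)) \<le> \<eta> * measure lebesgue X + e" using gh(2) by linarith
qed

lemma L1_norm_vector:
  fixes f g :: "'a \<Rightarrow> real^'d" and \<eta> :: real
  assumes i: "\<And>j. integrable M (\<lambda>z. \<bar>f z $ j - g z $ j\<bar>)" "\<And>j. (LINT z|M. \<bar>f z $ j - g z $ j\<bar>) \<le> \<eta>"
    and m: "f \<in> borel_measurable M" "g \<in> borel_measurable M"
  shows "integrable M (\<lambda>z. norm (f z - g z))" "(LINT z|M. norm (f z - g z)) \<le> CARD('d) * \<eta>"
proof -
  have le: "norm (f z - g z) \<le> (\<Sum>j\<in>UNIV. \<bar>f z $ j - g z $ j\<bar>)" for z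
    using norm_le_l1_cart[of "f z - g z"] by simp
  have s: "integrable M (\<lambda>z. \<Sum>j\<in>UNIV. \<bar>f z $ j - g z $ j\<bar>)" using i(1) by (intro Bochner_Integration.integrable_sum)
  show 1: "integrable M (\<lambda>z. norm (f z - g z))"
    by (rule Bochner_Integration.integrable_bound[OF s]) (use m le in \<open>auto intro: order_trans\<close>)
  have "(LINT z|M. norm (f z - g z)) \<le> (LINT z|M. (\<Sum>j\<in>UNIV. \<bar>f z $ j - g z $ j\<bar>))"
    by (rule integral_mono[OF 1 s le])
  also have "\<dots> = (\<Sum>j\<in>UNIV. LINT z|M. \<bar>f z $ j - g z $ j\<bar>)" by (rule Bochner_Integration.integral_sum[OF i(1)])
  also have "\<dots> \<le> CARD('d) * \<eta>" using i(2) by (intro sum_bounded_above)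
  finally show "(LINT z|M. norm (f z - g z)) \<le> CARD('d) * \<eta>" .
qed

section \<open>The convergence theorem\<close>

lemma uniform_modulus:
  fixes f :: "'a::metric_space \<Rightarrow> 'b::real_normed_vector"
  assumes "continuous_on UNIV f" "compact C" "\<eta> > 0"
  obtains \<delta> where "\<delta> > 0" "\<And>z z'. z \<in> C \<Longrightarrow> z' \<in> C \<Longrightarrow> dist z z' < \<delta> \<Longrightarrow> norm (f z - f z') \<le> \<eta>"
proof -
  have "uniformly_continuous_on C f"
    using assms by (intro compact_uniformly_continuous) (auto intro: continuous_on_subset)
  then obtain \<delta> where "\<delta> > 0" "\<And>z z'. z \<in> C \<Longrightarrow> z' \<in> C \<Longrightarrow> dist z' z < \<delta> \<Longrightarrow> dist (f z') (f z) < \<eta>"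
    using assms(3) unfolding uniformly_continuous_on_def by metis
  then show thesis using that[of \<delta>] by (metis dist_norm less_imp_le)
qed

lemma borel_measurable_vec_nth:
  fixes f :: "'a \<Rightarrow> real^'d"
  assumes "f \<in> borel_measurable M" shows "(\<lambda>z. f z $ j) \<in> borel_measurable M"
proof (rule measurable_compose[OF assms])
  show "(\<lambda>x :: real^'d. x $ j) \<in> borel_measurable borel"
    by (intro borel_measurable_continuous_onI continuous_on_component continuous_on_id)
qed

theorem theorem4p1:
  fixes \<Omega> :: "(real^'d) set" and T :: real
    and \<rho>0 :: "real^'d \<Rightarrow> real" and u0 :: "real^'d \<Rightarrow> real^'d"
    and M :: "nat \<Rightarrow> 'd mesh" and S :: "nat \<Rightarrow> 'd scheme"
    and \<rho> :: "(real^'d) \<times> real \<Rightarrow> real" and u :: "(real^'d) \<times> real \<Rightarrow> real^'d"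
    and i :: 'd and \<phi> :: "(real^'d) \<times> real \<Rightarrow> real"
  assumes "CARD('d) \<in> {2, 3}"
    and "open \<Omega>" and "bounded \<Omega>" and "connected \<Omega>" and "polyhedral_boundary \<Omega>"
    and "T > 0"
    and "\<rho>0 \<in> Linf \<Omega>" and "u0 \<in> Linf \<Omega>"
    and "\<And>m. admissible_mesh \<Omega> (M m)"
    and "\<And>m. discrete_solution \<rho>0 u0 (M m) (S m)"
    and "\<exists>C. \<forall>m. H3 C (M m) (S m)"
    and "(\<lambda>m. mesh_size (M m)) \<longlonglongrightarrow> 0"
    and "(\<lambda>m. time_step T (S m)) \<longlonglongrightarrow> 0"
    and "\<exists>\<theta>. \<forall>m. max (theta1 (M m)) (theta2 (M m)) \<le> \<theta>"
    and "\<exists>N\<^sub>E::real. \<forall>m. \<forall>K\<in>cells (M m). real (card (faces (M m) K)) \<le> N\<^sub>E"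
    and "\<exists>C1\<ge>0. \<exists>C2\<ge>0. \<forall>m.
           Linf_norm (\<Omega> \<times> {0<..<T}) (density_fun T (M m) (S m)) \<le> ereal C1 \<and>
           Linf_norm (\<Omega> \<times> {0<..<T}) (velocity_fun T (M m) (S m)) \<le> ereal C2"
    and "\<rho> \<in> Linf (\<Omega> \<times> {0<..<T})" and "u \<in> Linf (\<Omega> \<times> {0<..<T})"
    and "(\<lambda>m. Linf_norm (\<Omega> \<times> {0<..<T}) (\<lambda>z. density_fun T (M m) (S m) z - \<rho> z)) \<longlonglongrightarrow> 0"
    and "(\<lambda>m. Linf_norm (\<Omega> \<times> {0<..<T}) (\<lambda>z. velocity_fun T (M m) (S m) z - u z)) \<longlonglongrightarrow> 0"
    and "\<phi> \<in> test_functions (\<Omega> \<times> {0<..<T})"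
  shows "(\<lambda>m. LINT t:{0<..<T}|lebesgue. (LINT x:\<Omega>|lebesgue.
            convection \<Omega> T (M m) (S m) i (x, t) * interpolate T (M m) (S m) \<phi> (x, t)))
         \<longlonglongrightarrow>
           - (LINT x:\<Omega>|lebesgue. \<rho>0 x * u0 x $ i * \<phi> (x, 0))
           - (LINT t:{0<..<T}|lebesgue. (LINT x:\<Omega>|lebesgue.
                \<rho> (x, t) * u (x, t) $ i * time_derivative \<phi> (x, t)
                + \<rho> (x, t) * u (x, t) $ i * (u (x, t) \<bullet> space_gradient \<phi> (x, t))))"
proof -
  note d = assms(1) and op = assms(2) and bd = assms(3) and T = assms(6)
  have adm: "adm_mesh \<Omega> (M m)" for m
    by (rule adm_mesh.intro) (rule d assms(9) op bd)+
  let ?X = "\<Omega> \<times> {0<..<T}" and ?C = "closure \<Omega> \<times> {0..T}"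
  let ?L = "lebesgue_on ?X"
  have X: "?X \<in> lmeasurable" "?X \<in> sets lebesgue" "open ?X"
    using adm_mesh.cylinder[OF adm] by auto
  have C: "compact ?C" using bd by (intro compact_Times) (auto simp: compact_closure)
  define V where "V = measure lebesgue ?X"
  have V: "V \<ge> 0" by (simp add: V_def)
  interpret tf: test_function ?X \<phi> by (rule test_function.intro) (rule assms X)+
  obtain C0 where C0: "\<And>m. H3 C0 (M m) (S m)" using assms(11) by blast
  define Cf where "Cf = max C0 0"
  obtain \<theta>0 where \<theta>0: "\<And>m. max (theta1 (M m)) (theta2 (M m)) \<le> \<theta>0" using assms(14) by blast
  define \<theta> where "\<theta> = max \<theta>0 1"
  obtain N0 where N0: "\<And>m K. K \<in> cells (M m) \<Longrightarrow> real (card (faces (M m) K)) \<le> N0" using assms(15) by blast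
  define N where "N = max N0 0"
  obtain C1 C2 where C12: "C1 \<ge> 0" "C2 \<ge> 0"
    and C1: "\<And>m. Linf_norm ?X (density_fun T (M m) (S m)) \<le> ereal C1"
    and C2: "\<And>m. Linf_norm ?X (velocity_fun T (M m) (S m)) \<le> ereal C2"
    using assms(16) by blast
  obtain B1 where B1: "B1 \<ge> 0" "AE z in ?L. norm (\<rho> z) \<le> B1" and \<rho>m: "\<rho> \<in> borel_measurable ?L"
    using Linf_bounded[OF assms(17)] by blast
  obtain B2 where B2: "B2 \<ge> 0" "AE z in ?L. norm (u z) \<le> B2" and um: "u \<in> borel_measurable ?L"
    using Linf_bounded[OF assms(18)] by blast
  \<comment> \<open>One bound for all discrete and continuous states. The term
    \<open>CARD('d) * B2\<close> is for \<open>U\<close>, whose components are bounded separately by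
    \<open>B2\<close>.\<close>
  define B where "B = C1 + C2 + B1 + CARD('d) * B2 + B2"
  have B: "B \<ge> 0" "C1 \<le> B" "C2 \<le> B" "B1 \<le> B" "B2 \<le> B" "CARD('d) * B2 \<le> B"
    using C12 B1(1) B2(1) by (auto simp: B_def)
  obtain \<Lambda>1 where \<Lambda>1: "\<Lambda>1 \<ge> 0" "\<And>z z'. \<bar>\<phi> z - \<phi> z'\<bar> \<le> \<Lambda>1 * dist z z'" using tf.lipschitz by blast
  obtain \<Lambda>2 where \<Lambda>2: "\<Lambda>2 \<ge> 0" "\<And>z b. b \<in> Basis \<Longrightarrow> \<bar>frechet_derivative \<phi> (at z) b\<bar> \<le> \<Lambda>2" using tf.pd_bounded by blast
  define \<Lambda> where "\<Lambda> = \<Lambda>1 + \<Lambda>2"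
  have \<Lambda>: "\<Lambda> \<ge> 0" using \<Lambda>1(1) \<Lambda>2(1) by (simp add: \<Lambda>_def)
  have lip: "\<bar>\<phi> z - \<phi> z'\<bar> \<le> \<Lambda> * dist z z'" for z z'
    using \<Lambda>1(2)[of z z'] mult_right_mono[of \<Lambda>1 \<Lambda> "dist z z'"] \<Lambda>2(1) by (simp add: \<Lambda>_def)
  have pd: "\<bar>frechet_derivative \<phi> (at z) b\<bar> \<le> \<Lambda>" if "b \<in> Basis" for z b
    using \<Lambda>2(2)[OF that, of z] \<Lambda>1(1) by (simp add: \<Lambda>_def)
  have axis: "(axis j 1, 0) \<in> (Basis :: ((real^'d) \<times> real) set)" "(0, 1) \<in> (Basis :: ((real^'d) \<times> real) set)" for j
    by (auto simp: Basis_prod_def Basis_vec_def)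
  define \<Gamma> where "\<Gamma> = CARD('d) * \<Lambda>"
  have td: "\<bar>time_derivative \<phi> z\<bar> \<le> \<Lambda>" for z unfolding time_derivative_def by (rule pd[OF axis(2)])
  have sg: "norm (space_gradient \<phi> z) \<le> \<Gamma>" for z
  proof -
    have "norm (space_gradient \<phi> z) \<le> (\<Sum>j\<in>UNIV. \<bar>space_gradient \<phi> z $ j\<bar>)" by (rule norm_le_l1_cart)
    also have "\<dots> \<le> CARD('d) * \<Lambda>" using pd[OF axis(1)] by (intro sum_bounded_above) (simp add: space_gradient_def)
    finally show ?thesis by (simp add: \<Gamma>_def)
  qed
  have td_cont: "continuous_on UNIV (time_derivative \<phi>)"
    unfolding time_derivative_def[abs_def] by (rule tf.pd_continuous[OF axis(2)])
  have sg_cont: "continuous_on UNIV (space_gradient \<phi>)"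
    unfolding space_gradient_def[abs_def] by (intro continuous_on_vec_lambda tf.pd_continuous axis)
  have cm: "f \<in> borel_measurable ?L" if "continuous_on UNIV f" for f :: "(real^'d) \<times> real \<Rightarrow> 'z::euclidean_space"
    using that X(2) by (intro continuous_imp_measurable_on_sets_lebesgue) (auto intro: continuous_on_subset)
  define q where "q = (\<lambda>(r :: (real^'d) \<times> real \<Rightarrow> real) (U :: (real^'d) \<times> real \<Rightarrow> real^'d) z.
    r z * U z $ i * time_derivative \<phi> z + r z * U z $ i * (U z \<bullet> space_gradient \<phi> z))"
  define Lq where "Lq = B * \<Lambda> + 2 * B\<^sup>2 * \<Gamma>"
  have \<Gamma>: "\<Gamma> \<ge> 0" using \<Lambda> by (simp add: \<Gamma>_def)
  have Lq: "Lq \<ge> 0" using B(1) \<Lambda> \<Gamma> by (simp add: Lq_def)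
  have q_le: "\<bar>q r U z\<bar> \<le> Lq * (2 * B)" if "\<bar>r z\<bar> \<le> B" "norm (U z) \<le> B" for r U z
  proof -
    \<comment> \<open>The Lipschitz estimate is compared with the zero state, at which the integrand
      vanishes.\<close>
    have "\<bar>q r U z\<bar> \<le> Lq * (\<bar>r z\<bar> + norm (U z))"
      using flux_function_lipschitz[of 0 B 0 0 "time_derivative \<phi> z" \<Lambda> "space_gradient \<phi> z" \<Gamma> 0 i] flux_function_lipschitz[of "r z" B "U z" 0 "time_derivative \<phi> z" \<Lambda> "space_gradient \<phi> z" \<Gamma> 0 i]
        that td[of z] sg[of z] B(1) by (simp add: q_def Lq_def)
    also have "\<dots> \<le> Lq * (2 * B)" using that Lq by (intro mult_left_mono) auto
    finally show ?thesis .
  qed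
  have q_meas: "q r U \<in> borel_measurable ?L" if [measurable]: "r \<in> borel_measurable ?L" "U \<in> borel_measurable ?L" for r U
  proof -
    have [measurable]: "time_derivative \<phi> \<in> borel_measurable ?L" "space_gradient \<phi> \<in> borel_measurable ?L"
      by (rule cm[OF td_cont] cm[OF sg_cont])+
    have [measurable]: "(\<lambda>z. U z $ i) \<in> borel_measurable ?L"
      by (rule borel_measurable_vec_nth[OF that(2)])
    show ?thesis unfolding q_def by measurable
  qed
  have q_int: "integrable ?L (q r U)"
    if "r \<in> borel_measurable ?L" "U \<in> borel_measurable ?L" "AE z in ?L. \<bar>r z\<bar> \<le> B" "AE z in ?L. norm (U z) \<le> B" for r U
  proof (rule set_integrable_bounded[OF X(1) q_meas[OF that(1,2)]])
    show "AE z in ?L. norm (q r U z) \<le> Lq * (2 * B)"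
      using that(3,4) by eventually_elim (simp add: q_le)
  qed
  have \<rho>B: "AE z in ?L. \<bar>\<rho> z\<bar> \<le> B" using B1(2) by eventually_elim (use B in auto)
  have uB: "AE z in ?L. norm (u z) \<le> B" using B2(2) by eventually_elim (use B in auto)
  have set_int: "set_integrable lebesgue ?X f \<longleftrightarrow> integrable ?L f" for f :: "(real^'d) \<times> real \<Rightarrow> real"
    using X(2) by (simp add: set_integrable_def integrable_restrict_space)
  have set_lint: "(LINT z:?X|lebesgue. f z) = (LINT z|?L. f z)" for f :: "(real^'d) \<times> real \<Rightarrow> real"
    using X(2) by (simp add: set_lebesgue_integral_def integral_restrict_space)
  define J where "J = (LINT z|?L. q \<rho> u z)"
  have iq: "integrable ?L (q \<rho> u)" by (rule q_int[OF \<rho>m um \<rho>B uB])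
  have J: "(LINT t:{0<..<T}|lebesgue. (LINT x:\<Omega>|lebesgue.
                \<rho> (x, t) * u (x, t) $ i * time_derivative \<phi> (x, t)
                + \<rho> (x, t) * u (x, t) $ i * (u (x, t) \<bullet> space_gradient \<phi> (x, t)))) = J"
    using iterated_set_integral[of \<Omega> "{0<..<T}" "q \<rho> u"] iq unfolding set_int set_lint J_def q_def by simp
  have init: "(LINT x:\<Omega>|lebesgue. \<rho>0 x * u0 x $ i * \<phi> (x, 0)) = 0"
  proof -
    have "\<phi> (x, 0) = 0" for x
    proof (rule tf.zero_outside)
      show "(x, 0) \<notin> tf.supp" using tf.supp_subset by auto
    qed
    then show ?thesis by simp
  qed
  define kc where "kc = consistency_const CARD('d) B \<theta> Cf \<Lambda> N"
  have kc: "kc \<ge> 0"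
    unfolding kc_def consistency_const_def Let_def using B(1) \<Lambda> by (simp add: Cf_def N_def \<theta>_def)
  \<comment> \<open>The three errors for accuracy \<open>\<eta>\<close>, divided by
    \<open>\<eta>\<close>: consistency with the total of \<open>err_sum\<close>, the Riemann sum,
    and the replacement of \<open>r\<close> and \<open>U\<close> by the limits.\<close>
  define k where "k = kc * ((V + 1 + V) + N * ((V + CARD('d)) + V) + V) + V + Lq * (1 + CARD('d))"
  have k: "k \<ge> 0" unfolding k_def using kc V Lq by (simp add: N_def)
  let ?I = "\<lambda>m. LINT t:{0<..<T}|lebesgue. (LINT x:\<Omega>|lebesgue.
            convection \<Omega> T (M m) (S m) i (x, t) * interpolate T (M m) (S m) \<phi> (x, t))"
  have "?I \<longlonglongrightarrow> - J"
  \<comment> \<open>\<open>k\<close> is independent of \<open>\<eta>\<close>, whereas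
    \<open>r\<close>, \<open>U\<close>, \<open>\<delta>\<close> and the rank from which the bound
    holds may depend on it.\<close>
  proof (rule tendsto_of_eventual_bound[OF k])
    fix \<eta> :: real assume \<eta>: "\<eta> > 0"
    have \<rho>1: "AE z in ?L. \<bar>\<rho> z\<bar> \<le> B1" using B1(2) by simp
    obtain r where r: "continuous_on UNIV r" "\<And>z. \<bar>r z\<bar> \<le> B1" "(LINT z|?L. \<bar>\<rho> z - r z\<bar>) \<le> \<eta>"
      using L1_continuous_approximation[OF X(1) \<rho>m \<rho>1 B1(1) \<eta>] by blast
    have uj: "(\<lambda>z. u z $ j) \<in> borel_measurable ?L" "AE z in ?L. \<bar>u z $ j\<bar> \<le> B2" for j
    proof -
      show "(\<lambda>z. u z $ j) \<in> borel_measurable ?L" by (rule borel_measurable_vec_nth[OF um])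
      show "AE z in ?L. \<bar>u z $ j\<bar> \<le> B2"
        using B2(2) by eventually_elim (use component_le_norm_cart order_trans in blast)
    qed
    have "\<forall>j. \<exists>g. continuous_on UNIV g \<and> (\<forall>z. \<bar>g z\<bar> \<le> B2) \<and> (LINT z|?L. \<bar>u z $ j - g z\<bar>) \<le> \<eta>"
    proof
      fix j
      obtain g where "continuous_on UNIV g" "\<And>z. \<bar>g z\<bar> \<le> B2" "(LINT z|?L. \<bar>u z $ j - g z\<bar>) \<le> \<eta>"
        using L1_continuous_approximation[OF X(1) uj(1)[of j] uj(2)[of j] B2(1) \<eta>] by blast
      then show "\<exists>g. continuous_on UNIV g \<and> (\<forall>z. \<bar>g z\<bar> \<le> B2) \<and> (LINT z|?L. \<bar>u z $ j - g z\<bar>) \<le> \<eta>" by blast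
    qed
    from choice[OF this] obtain g
      where g': "\<forall>j. continuous_on UNIV (g j) \<and> (\<forall>z. \<bar>g j z\<bar> \<le> B2) \<and> (LINT z|?L. \<bar>u z $ j - g j z\<bar>) \<le> \<eta>" by blast
    have g: "continuous_on UNIV (g j)" "\<bar>g j z\<bar> \<le> B2" "(LINT z|?L. \<bar>u z $ j - g j z\<bar>) \<le> \<eta>" for j z
      using g' by blast+
    define U where "U z = (\<chi> j. g j z)" for z
    have Uc: "continuous_on UNIV U" unfolding U_def using g(1) by (intro continuous_on_vec_lambda)
    have rB: "\<bar>r z\<bar> \<le> B" for z using r(2)[of z] B by linarith
    have UB: "norm (U z) \<le> B" for z
    proof -
      have "norm (U z) \<le> (\<Sum>j\<in>UNIV. \<bar>U z $ j\<bar>)" by (rule norm_le_l1_cart)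
      also have "\<dots> \<le> CARD('d) * B2" using g(2) by (intro sum_bounded_above) (simp add: U_def)
      finally show ?thesis using B by linarith
    qed
    have Ujc: "continuous_on UNIV (\<lambda>z. U z $ i)" using g(1)[of i] by (simp add: U_def)
    have rm: "r \<in> borel_measurable ?L" and Um: "U \<in> borel_measurable ?L" by (rule cm[OF r(1)], rule cm[OF Uc])
    have ri: "integrable ?L (\<lambda>z. \<bar>\<rho> z - r z\<bar>)"
    proof -
      have "integrable ?L \<rho>" by (rule set_integrable_bounded[OF X(1) \<rho>m B1(2)])
      moreover have "integrable ?L r" by (rule set_integrable_bounded[OF X(1) rm, of B]) (use rB in simp)
      ultimately have "integrable ?L (\<lambda>z. \<rho> z - r z)" by (rule Bochner_Integration.integrable_diff)
      then show ?thesis by simp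
    qed
    have uji: "integrable ?L (\<lambda>z. \<bar>u z $ j - U z $ j\<bar>)" for j
    proof -
      have "integrable ?L (\<lambda>z. u z $ j - g j z)"
      proof (rule Bochner_Integration.integrable_diff)
        show "integrable ?L (\<lambda>z. u z $ j)" by (rule set_integrable_bounded[OF X(1) uj(1), of _ B2]) (use uj(2)[of j] in simp)
        show "integrable ?L (g j)" by (rule set_integrable_bounded[OF X(1) cm[OF g(1)], of _ B2]) (use g(2)[of j] in auto)
      qed
      then show ?thesis by (simp add: U_def)
    qed
    note ui = L1_norm_vector[of ?L u U, OF uji _ um Um]
    have ui: "integrable ?L (\<lambda>z. norm (u z - U z))" "(LINT z|?L. norm (u z - U z)) \<le> CARD('d) * \<eta>"
      using ui[of \<eta>] g(3) by (simp_all add: U_def)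
    have W: "continuous_on UNIV (\<lambda>z. (r z * U z $ i) *\<^sub>R U z)" using r(1) Uc Ujc by (intro continuous_intros)
    have Qc: "continuous_on UNIV (q r U)" unfolding q_def using r(1) Uc Ujc td_cont sg_cont by (intro continuous_intros)
    obtain \<delta>1 where \<delta>1: "\<delta>1 > 0" "\<And>z z'. z \<in> ?C \<Longrightarrow> z' \<in> ?C \<Longrightarrow> dist z z' < \<delta>1 \<Longrightarrow> norm (r z - r z') \<le> \<eta>"
      using uniform_modulus[OF r(1) C \<eta>] by blast
    obtain \<delta>2 where \<delta>2: "\<delta>2 > 0" "\<And>z z'. z \<in> ?C \<Longrightarrow> z' \<in> ?C \<Longrightarrow> dist z z' < \<delta>2 \<Longrightarrow> norm (U z - U z') \<le> \<eta>"
      using uniform_modulus[OF Uc C \<eta>] by blast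
    obtain \<delta>3 where \<delta>3: "\<delta>3 > 0" "\<And>z z'. z \<in> ?C \<Longrightarrow> z' \<in> ?C \<Longrightarrow> dist z z' < \<delta>3 \<Longrightarrow> norm ((r z * U z $ i) *\<^sub>R U z - (r z' * U z' $ i) *\<^sub>R U z') \<le> \<eta>"
      using uniform_modulus[OF W C \<eta>] by blast
    obtain \<delta>4 where \<delta>4: "\<delta>4 > 0" "\<And>z z'. z \<in> ?C \<Longrightarrow> z' \<in> ?C \<Longrightarrow> dist z z' < \<delta>4 \<Longrightarrow> norm (q r U z - q r U z') \<le> \<eta>"
      using uniform_modulus[OF Qc C \<eta>] by blast
    obtain \<delta>5 where \<delta>5: "\<delta>5 > 0" "\<And>z z' b. b \<in> Basis \<Longrightarrow> dist z z' < \<delta>5 \<Longrightarrow> \<bar>frechet_derivative \<phi> (at z) b - frechet_derivative \<phi> (at z') b\<bar> < \<eta>"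
      using tf.pd_uniform[OF \<eta>] by blast
    obtain \<delta>6 where \<delta>6: "\<delta>6 > 0" "\<And>z p. p \<notin> ?X \<Longrightarrow> dist z p < \<delta>6 \<Longrightarrow> z \<notin> tf.supp"
      using tf.vanish_near_boundary by blast
    \<comment> \<open>A common modulus for \<open>r\<close>, \<open>U\<close>, the momentum flux,
      the integrand, the derivatives of \<open>\<phi>\<close> and the distance of its support from
      the outside.\<close>
    define \<delta> where "\<delta> = Min {\<delta>1, \<delta>2, \<delta>3, \<delta>4, \<delta>5, \<delta>6}"
    have \<delta>: "\<delta> > 0" "\<delta> \<le> \<delta>1" "\<delta> \<le> \<delta>2" "\<delta> \<le> \<delta>3" "\<delta> \<le> \<delta>4" "\<delta> \<le> \<delta>5" "\<delta> \<le> \<delta>6"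
      using \<delta>1(1) \<delta>2(1) \<delta>3(1) \<delta>4(1) \<delta>5(1) \<delta>6(1) by (auto simp: \<delta>_def)
    have key: "\<bar>?I m - (- J)\<bar> \<le> k * \<eta>"
      if small: "2 * mesh_size (M m) + time_step T (S m) < \<delta>"
        and c\<rho>: "Linf_norm ?X (\<lambda>z. density_fun T (M m) (S m) z - \<rho> z) \<le> ereal \<eta>"
        and cu: "Linf_norm ?X (\<lambda>z. velocity_fun T (M m) (S m) z - u z) \<le> ereal \<eta>" for m
    proof -
      interpret A: adm_mesh \<Omega> "M m" by (rule adm)
      have ds: "steps (S m) \<ge> 1" "primal_fluxes (M m) (S m)" "H1 (M m) (S m)" "H2 (M m) (S m)" "dual_velocities (M m) (S m)"
        using assms(10)[of m] by (auto simp: discrete_solution_def)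
      have \<theta>m: "theta1 (M m) \<le> \<theta>" "theta2 (M m) \<le> \<theta>" using \<theta>0[of m] by (auto simp: \<theta>_def)
      interpret Cs: consistency \<Omega> "M m" T \<phi> "S m" i B \<theta> Cf \<eta> \<Lambda> N \<delta> r U
      proof (intro consistency.intro consistency_axioms.intro adm tf.test_function_axioms)
        show "H3 Cf (M m) (S m)" by (rule A.H3_mono[OF C0]) (simp add: Cf_def)
        show "\<bar>density (S m) (Suc n) K\<bar> \<le> B" if "n < steps (S m)" "K \<in> cells (M m)" for n K
          using A.density_bound[OF C1 T ds(1) that] B by linarith
        show "norm (velocity (S m) (Suc n) \<sigma>) \<le> B" if "n < steps (S m)" "\<sigma> \<in> all_faces (M m)" for n \<sigma>
          using A.velocity_bound[OF C2 T ds(1) that] B by linarith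
        show "diameter K ^ CARD('d) \<le> \<theta> * measure lebesgue K" if "K \<in> cells (M m)" for K
          by (rule A.theta1_bound[OF \<theta>m(1) that])
        show "measure lebesgue K \<le> \<theta> * measure lebesgue L" if "interface (M m) K L \<sigma>" for K L \<sigma>
          by (rule A.theta2_bound[OF \<theta>m(2) that])
        show "real (card (faces (M m) K)) \<le> N" if "K \<in> cells (M m)" for K using N0[OF that] by (simp add: N_def)
        show "\<bar>frechet_derivative \<phi> (at z) b - frechet_derivative \<phi> (at z') b\<bar> \<le> \<eta>"
          if "b \<in> Basis" "dist z z' < \<delta>" for z z' b
          using \<delta>5(2)[OF that(1), of z z'] that(2) \<delta>(6) by linarith
        show "z \<notin> tf.supp" if "p \<notin> ?X" "dist z p < \<delta>" for z p
          using \<delta>6(2)[OF that(1), of z] that(2) \<delta>(7) by linarith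
        show "\<bar>r z - r z'\<bar> \<le> \<eta> \<and> norm (U z - U z') \<le> \<eta> \<and>
          norm ((r z * U z $ i) *\<^sub>R U z - (r z' * U z' $ i) *\<^sub>R U z') \<le> \<eta>"
          if "z \<in> ?C" "z' \<in> ?C" "dist z z' < \<delta>" for z z'
          using \<delta>1(2)[OF that(1,2)] \<delta>2(2)[OF that(1,2)] \<delta>3(2)[OF that(1,2)] that(3) \<delta> by simp
        show "2 * mesh_size (M m) + time_step T (S m) < \<delta>" by (rule small)
        show "0 \<le> \<eta>" "0 \<le> Cf" "1 \<le> \<theta>" "0 \<le> N" using \<eta> by (auto simp: Cf_def \<theta>_def N_def)
      qed (rule T ds B(1) \<Lambda> rB UB lip pd; assumption?)+
      have Qq: "Cs.Q = q r U" by (auto simp: fun_eq_iff Cs.Q_def q_def)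
      have dm: "density_fun T (M m) (S m) \<in> borel_measurable ?L" "velocity_fun T (M m) (S m) \<in> borel_measurable ?L"
        using A.density_fun_measurable A.velocity_fun_measurable by (auto intro: measurable_restrict_space1)
      \<comment> \<open>\<open>\<eta> * V\<close> comes from the uniform convergence, the remaining
        \<open>\<eta>\<close> from the continuous approximation.\<close>
      have a: "integrable ?L (\<lambda>z. norm (density_fun T (M m) (S m) z - r z))"
        "(LINT z|?L. norm (density_fun T (M m) (S m) z - r z)) \<le> \<eta> * V + \<eta>"
        using L1_triangle[OF X(1) dm(1) rm Linf_norm_AE[OF c\<rho>], of \<eta>] ri r(3) by (auto simp: V_def)
      have b: "integrable ?L (\<lambda>z. norm (velocity_fun T (M m) (S m) z - U z))"
        "(LINT z|?L. norm (velocity_fun T (M m) (S m) z - U z)) \<le> \<eta> * V + CARD('d) * \<eta>"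
        using L1_triangle[OF X(1) dm(2) Um Linf_norm_AE[OF cu] ui] by (auto simp: V_def)
      let ?R = "\<Sum>n<steps (S m). \<Sum>K\<in>cells (M m). (measure lebesgue K * Cs.dt) * Cs.Q (Cs.xc K, Cs.t (Suc n))"
      let ?E = "\<Sum>n<steps (S m). \<Sum>K\<in>cells (M m). (measure lebesgue K * Cs.dt) * (Cs.err (Suc n) K + \<eta>)"
      have 1: "\<bar>?I m + ?R\<bar> \<le> kc * ?E" unfolding kc_def by (rule Cs.consistency_estimate)
      have "?E \<le> (\<eta> * V + \<eta> + \<eta> * V) + N * (\<eta> * V + CARD('d) * \<eta> + \<eta> * V) + V * \<eta>"
        unfolding V_def by (rule Cs.err_sum[OF a(1) a(2)[unfolded V_def] b(1) b(2)[unfolded V_def]])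
      then have 2: "kc * ?E \<le> kc * ((\<eta> * V + \<eta> + \<eta> * V) + N * (\<eta> * V + CARD('d) * \<eta> + \<eta> * V) + V * \<eta>)"
        using kc by (rule mult_left_mono)
      have iQ: "integrable ?L (q r U)" by (rule q_int[OF rm Um]) (use rB UB in auto)
      have 3: "\<bar>?R - (LINT z|?L. q r U z)\<bar> \<le> \<eta> * V"
        using Cs.riemann_sum unfolding Qq set_int set_lint V_def
        using iQ \<delta>4(2) \<delta>(5) by (simp add: less_le_trans)
      have 4: "\<bar>(LINT z|?L. q r U z) - J\<bar> \<le> Lq * (\<eta> + CARD('d) * \<eta>)"
      proof -
        have sum_i: "integrable ?L (\<lambda>z. Lq * (\<bar>\<rho> z - r z\<bar> + norm (u z - U z)))" using ri ui(1) by simp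
        have "\<bar>(LINT z|?L. q r U z) - J\<bar> = \<bar>LINT z|?L. q r U z - q \<rho> u z\<bar>"
          unfolding J_def using iQ iq by simp
        also have "\<dots> \<le> (LINT z|?L. \<bar>q r U z - q \<rho> u z\<bar>)" using integral_norm_bound[of ?L "\<lambda>z. q r U z - q \<rho> u z"] by simp
        also have "\<dots> \<le> (LINT z|?L. Lq * (\<bar>\<rho> z - r z\<bar> + norm (u z - U z)))"
        proof (rule integral_mono_AE[OF _ sum_i])
          show "integrable ?L (\<lambda>z. \<bar>q r U z - q \<rho> u z\<bar>)" using iQ iq by simp
          show "AE z in ?L. \<bar>q r U z - q \<rho> u z\<bar> \<le> Lq * (\<bar>\<rho> z - r z\<bar> + norm (u z - U z))"
            using \<rho>B uB
          proof eventually_elim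
            case (elim z)
            then show ?case unfolding q_def Lq_def by (intro flux_function_lipschitz UB td sg)
          qed
        qed
        also have "\<dots> = Lq * ((LINT z|?L. \<bar>\<rho> z - r z\<bar>) + (LINT z|?L. norm (u z - U z)))" using ri ui(1) by simp
        also have "\<dots> \<le> Lq * (\<eta> + CARD('d) * \<eta>)" using r(3) ui(2) Lq by (intro mult_left_mono add_mono)
        finally show ?thesis .
      qed
      have "k * \<eta> = kc * ((\<eta> * V + \<eta> + \<eta> * V) + N * (\<eta> * V + CARD('d) * \<eta> + \<eta> * V) + V * \<eta>) + \<eta> * V + Lq * (\<eta> + CARD('d) * \<eta>)"
        by (simp add: k_def algebra_simps)
      then show ?thesis using 1 2 3 4 by linarith
    qed
    have "(\<lambda>m. 2 * mesh_size (M m) + time_step T (S m)) \<longlonglongrightarrow> 2 * 0 + 0"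
      by (intro tendsto_intros assms)
    then have "\<forall>\<^sub>F m in sequentially. 2 * mesh_size (M m) + time_step T (S m) < \<delta>"
      using order_tendstoD(2)[of _ 0] \<delta>(1) by simp
    moreover have "\<forall>\<^sub>F m in sequentially. Linf_norm ?X (\<lambda>z. density_fun T (M m) (S m) z - \<rho> z) < ereal \<eta>"
      by (rule order_tendstoD(2)[OF assms(19)]) (use \<eta> in simp)
    moreover have "\<forall>\<^sub>F m in sequentially. Linf_norm ?X (\<lambda>z. velocity_fun T (M m) (S m) z - u z) < ereal \<eta>"
      by (rule order_tendstoD(2)[OF assms(20)]) (use \<eta> in simp)
    ultimately show "\<forall>\<^sub>F m in sequentially. \<bar>?I m - (- J)\<bar> \<le> k * \<eta>"
      by eventually_elim (rule key; simp)
  qed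
  then show ?thesis unfolding J init by simp
qed

end
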